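(* Let $K\subset O(n)$ be a finite pseudo-reflection group and $G=\mathbb{R}^n\rtimes K$. For each $\lambda\in\mathbb{C}^n$ one has $\dim E_\lambda\le |K|$. Furthermore, if $\lambda$ is generic, then the eigenspace representation $(T_\lambda,E_\lambda)$ of $G$ is irreducible. Moreover, let $$A=\{\mathrm{Ind}_{\mathbb{R}^n}^{\mathbb{R}^n\rtimes K}(\chi)\mid \chi \text{ is generic}\},\qquad B=\{(T_\lambda,E_\lambda)\mid E_\lambda \text{ is generic}\}.$$ Then there exists an equivalent one-one correspondence between the elements of $A$ and the elements of $B$, that is, a one-one correspondence under which corresponding representations are equivalent as representations of $G$.
   Context: A finite pseudo-reflection group is a finite subgroup $K$ of $O(n)$ generated by pseudo-reflections, where an element of a finite subgroup of $GL(\mathbb{R}^n)$ is a pseudo-reflection if precisely one of its eigenvalues is not equal to $1$. The group $G=\mathbb{R}^n\rtimes K$ has multiplication $(x_1,k_1)(x_2,k_2)=(x_1+k_1\cdot x_2,\,k_1k_2)$, and $G/K$ is identified with $\mathbb{R}^n$, on which $G$ acts by $(x,k)\cdot y=x+k\cdot y$. For $\lambda=(\lambda_1,\dots,\lambda_n)^T\in\mathbb{C}^n$, the joint eigenspace is $$E_\lambda=\{f\in C^\infty(G/K)\mid P(\tfrac{\partial}{\partial x_1},\dots,\tfrac{\partial}{\partial x_n})f=P(\lambda_1,\dots,\lambda_n)f\ \ \forall P\in\mathbb{C}[x_1,\dots,x_n]^K\},$$ where functions are complex-valued, and $T_\lambda$ is the representation of $G$ on $E_\lambda$ given by $(T_\lambda(g)f)(x)=f(g^{-1}\cdot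 x)$. Every (unitary) character $\chi$ of $\mathbb{R}^n$ has the form $\chi(x)=e^{-\lambda^T x}$ with $\lambda=(i\lambda_1,\dots,i\lambda_n)^T\in\mathbb{C}^n$, $\lambda_j\in\mathbb{R}$. The character $\chi$ (or $\lambda$) is called generic if $g\cdot\lambda\ne\lambda$ for all $g\in K$ with $g\ne e$; $(T_\lambda,E_\lambda)$ (or $E_\lambda$) is called generic if the same condition holds for $\lambda$. The induced representation $\mathrm{Ind}_{\mathbb{R}^n}^{\mathbb{R}^n\rtimes K}(\chi)$ is the representation of $G$ on the space of functions $f:G\to\mathbb{C}$ with $f(g\,(x,e))=\chi(x)^{-1}f(g)$ for all $g\in G$, $x\in\mathbb{R}^n$ (square integrable modulo $\mathbb{R}^n$, which is automatic since $G/\mathbb{R}^n\cong K$ is finite), with $G$ acting by $(\Phi(g_0)f)(g)=f(g_0^{-1}g)$.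
   Formalization: The one-one correspondence is between equivalence classes of representations in A and in B (as function spaces, |K| elements of A match each element of B), and in B the generic λ is restricted to purely imaginary vectors, since other E_λ are equivalent to no unitary induced representation. *)

theory Defs
  imports
    "HOL-Analysis.Analysis"
    "HOL-Computational_Algebra.Computational_Algebra"
    "HOL-Algebra.Generated_Groups"
    "HOL-Library.Function_Algebras"
    "HOL-Library.Poly_Mapping"
begin

subsection \<open>Finite pseudo-reflection groups\<close>

text \<open>Eigenvalues are complex and are counted with algebraic multiplicity, so that a
  pseudo-reflection has a single eigenvalue different from 1, and that eigenvalue is simple.\<close>

definition complex_matrix :: "real^'n^'n \<Rightarrow> complex^'n^'n" where
  "complex_matrix = map_matrix of_real"

definition charpoly :: "complex^'n^'n \<Rightarrow> complex poly" where
  "charpoly A = det (mat [:0, 1:] - map_matrix (\<lambda>a. [:a:]) A)"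

definition eigenvalues :: "complex^'n^'n \<Rightarrow> complex multiset" where
  "eigenvalues A = proots (charpoly A)"

definition pseudo_reflection :: "real^'n^'n \<Rightarrow> bool" where
  "pseudo_reflection s \<longleftrightarrow> size {#z \<in># eigenvalues (complex_matrix s). z \<noteq> 1#} = 1"

definition orthogonal_group :: "(real^'n^'n) monoid" where
  "orthogonal_group =
     \<lparr>carrier = {A. orthogonal_matrix A}, monoid.mult = (**), one = mat 1\<rparr>"

definition finite_pseudo_reflection_group :: "(real^'n^'n) set \<Rightarrow> bool" where
  "finite_pseudo_reflection_group K \<longleftrightarrow>
     finite K \<and> subgroup K orthogonal_group \<and>
     (\<exists>S\<subseteq>K. (\<forall>s\<in>S. pseudo_reflection s) \<and> generate orthogonal_group S = K)"

subsection \<open>The semidirect product and its action\<close>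

definition motion_group :: "(real^'n^'n) set \<Rightarrow> ((real^'n) \<times> (real^'n^'n)) monoid" where
  "motion_group K =
     \<lparr>carrier = UNIV \<times> K,
      monoid.mult = (\<lambda>(x\<^sub>1, k\<^sub>1) (x\<^sub>2, k\<^sub>2). (x\<^sub>1 + k\<^sub>1 *v x\<^sub>2, k\<^sub>1 ** k\<^sub>2)),
      one = (0, mat 1)\<rparr>"

definition act :: "(real^'n) \<times> (real^'n^'n) \<Rightarrow> real^'n \<Rightarrow> real^'n" where
  "act = (\<lambda>(x, k) y. x + k *v y)"

subsection \<open>Complex function spaces and representations on them\<close>

text \<open>Addition of functions is the pointwise one of \<open>Function_Algebras\<close>.\<close>

definition cscale :: "complex \<Rightarrow> ('a \<Rightarrow> complex) \<Rightarrow> 'a \<Rightarrow> complex" where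
  "cscale c f = (\<lambda>x. c * f x)"

interpretation cfun: vector_space "cscale :: complex \<Rightarrow> ('a \<Rightarrow> complex) \<Rightarrow> 'a \<Rightarrow> complex"
  by unfold_locales (auto simp: cscale_def fun_eq_iff algebra_simps)

definition clinear_on ::
  "('a \<Rightarrow> complex) set \<Rightarrow> (('a \<Rightarrow> complex) \<Rightarrow> 'b \<Rightarrow> complex) \<Rightarrow> bool" where
  "clinear_on V \<Phi> \<longleftrightarrow>
     (\<forall>f\<in>V. \<forall>h\<in>V. \<Phi> (f + h) = \<Phi> f + \<Phi> h) \<and> (\<forall>c. \<forall>f\<in>V. \<Phi> (cscale c f) = cscale c (\<Phi> f))"

text \<open>A candidate representation is a pair of a set of functions and a family of operators;
  the operators matter only on that set and for elements of the group.\<close>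

type_synonym ('g, 'a) rep =
  "('a \<Rightarrow> complex) set \<times> ('g \<Rightarrow> ('a \<Rightarrow> complex) \<Rightarrow> 'a \<Rightarrow> complex)"

definition representation :: "'g monoid \<Rightarrow> ('g, 'a) rep \<Rightarrow> bool" where
  "representation G = (\<lambda>(V, \<rho>).
     cfun.subspace V \<and>
     (\<forall>g\<in>carrier G. \<rho> g ` V \<subseteq> V \<and> clinear_on V (\<rho> g)) \<and>
     (\<forall>f\<in>V. \<rho> \<one>\<^bsub>G\<^esub> f = f) \<and>
     (\<forall>g\<in>carrier G. \<forall>h\<in>carrier G. \<forall>f\<in>V. \<rho> (g \<otimes>\<^bsub>G\<^esub> h) f = \<rho> g (\<rho> h f)))"

definition irreducible_rep :: "'g monoid \<Rightarrow> ('g, 'a) rep \<Rightarrow> bool" where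
  "irreducible_rep G = (\<lambda>(V, \<rho>).
     representation G (V, \<rho>) \<and> V \<noteq> {0} \<and>
     (\<forall>W. cfun.subspace W \<and> W \<subseteq> V \<and> (\<forall>g\<in>carrier G. \<rho> g ` W \<subseteq> W) \<longrightarrow> W = {0} \<or> W = V))"

definition equivalent_rep :: "'g monoid \<Rightarrow> ('g, 'a) rep \<Rightarrow> ('g, 'b) rep \<Rightarrow> bool" where
  "equivalent_rep G = (\<lambda>(V, \<rho>) (W, \<sigma>).
     \<exists>\<Phi>. clinear_on V \<Phi> \<and> bij_betw \<Phi> V W \<and>
         (\<forall>g\<in>carrier G. \<forall>f\<in>V. \<Phi> (\<rho> g f) = \<sigma> g (\<Phi> f)))"

text \<open>Families of representations are compared up to equivalence: inducing \<open>\<psi>\<close> and \<open>k \<cdot> \<psi>\<close> gives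
  equivalent representations on different spaces of functions on the group, whereas \<open>\<Lambda>\<close> and
  \<open>k \<cdot> \<Lambda>\<close> have the same joint eigenspace.\<close>

definition equivalence_classes :: "'g monoid \<Rightarrow> ('g, 'a) rep set \<Rightarrow> ('g, 'a) rep set set" where
  "equivalence_classes G \<R> = \<R> // {(R, S). R \<in> \<R> \<and> S \<in> \<R> \<and> equivalent_rep G R S}"

subsection \<open>Constant coefficient differential operators\<close>

definition partial_deriv :: "'n \<Rightarrow> (real^'n \<Rightarrow> complex) \<Rightarrow> real^'n \<Rightarrow> complex" where
  "partial_deriv i f x = frechet_derivative f (at x) (axis i 1)"

definition iterated_partial_deriv :: "'n list \<Rightarrow> (real^'n \<Rightarrow> complex) \<Rightarrow> real^'n \<Rightarrow> complex" where
  "iterated_partial_deriv is f = foldr partial_deriv is f"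

text \<open>The class of smooth functions: differentiability of the partial derivatives of each order
  includes the continuity of those of the order below.\<close>

definition smooth :: "(real^'n \<Rightarrow> complex) \<Rightarrow> bool" where
  "smooth f \<longleftrightarrow> (\<forall>is x. iterated_partial_deriv is f differentiable (at x))"

type_synonym 'n cpoly = "('n \<Rightarrow>\<^sub>0 nat) \<Rightarrow>\<^sub>0 complex"

definition poly_eval :: "'n::finite cpoly \<Rightarrow> complex^'n \<Rightarrow> complex" where
  "poly_eval P z =
     (\<Sum>m\<in>Poly_Mapping.keys P.
        Poly_Mapping.lookup P m * (\<Prod>i\<in>UNIV. (z $ i) ^ Poly_Mapping.lookup m i))"

text \<open>Partial derivatives of a smooth function commute, so any list containing each index
  the prescribed number of times gives the same derivative of such a function.\<close>

definition monomial_deriv ::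
  "('n::finite \<Rightarrow>\<^sub>0 nat) \<Rightarrow> (real^'n \<Rightarrow> complex) \<Rightarrow> real^'n \<Rightarrow> complex" where
  "monomial_deriv m =
     iterated_partial_deriv (SOME is. \<forall>i. count_list is i = Poly_Mapping.lookup m i)"

definition poly_diff_op ::
  "'n::finite cpoly \<Rightarrow> (real^'n \<Rightarrow> complex) \<Rightarrow> real^'n \<Rightarrow> complex" where
  "poly_diff_op P f x =
     (\<Sum>m\<in>Poly_Mapping.keys P. Poly_Mapping.lookup P m * monomial_deriv m f x)"

subsection \<open>Joint eigenspaces\<close>

definition complex_act :: "real^'n^'n \<Rightarrow> complex^'n \<Rightarrow> complex^'n" where
  "complex_act k z = complex_matrix k *v z"

text \<open>Invariance under the action by \<open>(k \<cdot> P)(z) = P(k\<^sup>-\<^sup>1 \<cdot> z)\<close>, where a complex polynomial is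
  determined by its values.\<close>

definition invariant_polys :: "(real^'n^'n) set \<Rightarrow> 'n::finite cpoly set" where
  "invariant_polys K = {P. \<forall>k\<in>K. \<forall>z. poly_eval P (complex_act k z) = poly_eval P z}"

definition joint_eigenspace ::
  "(real^'n^'n) set \<Rightarrow> complex^'n::finite \<Rightarrow> (real^'n \<Rightarrow> complex) set" where
  "joint_eigenspace K \<Lambda> =
     {f. smooth f \<and> (\<forall>P\<in>invariant_polys K. poly_diff_op P f = cscale (poly_eval P \<Lambda>) f)}"

definition eigenspace_rep ::
  "(real^'n^'n) set \<Rightarrow> complex^'n::finite \<Rightarrow> ((real^'n) \<times> (real^'n^'n), real^'n) rep" where
  "eigenspace_rep K \<Lambda> = (joint_eigenspace K \<Lambda>, \<lambda>g f x. f (act (inv\<^bsub>motion_group K\<^esub> g) x))"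

subsection \<open>Generic characters and induced representations\<close>

definition generic :: "(real^'n^'n) set \<Rightarrow> complex^'n \<Rightarrow> bool" where
  "generic K \<Lambda> \<longleftrightarrow> (\<forall>g\<in>K. g \<noteq> mat 1 \<longrightarrow> complex_act g \<Lambda> \<noteq> \<Lambda>)"

definition purely_imaginary :: "complex^'n \<Rightarrow> bool" where
  "purely_imaginary \<Lambda> \<longleftrightarrow> (\<forall>j. Re (\<Lambda> $ j) = 0)"

definition unitary_character :: "(real^'n \<Rightarrow> complex) \<Rightarrow> bool" where
  "unitary_character \<psi> \<longleftrightarrow>
     continuous_on UNIV \<psi> \<and> (\<forall>x y. \<psi> (x + y) = \<psi> x * \<psi> y) \<and> (\<forall>x. cmod (\<psi> x) = 1)"

definition exp_character :: "complex^'n \<Rightarrow> real^'n \<Rightarrow> complex" where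
  "exp_character \<Lambda> x = exp (- (\<Sum>j\<in>UNIV. \<Lambda> $ j * of_real (x $ j)))"

text \<open>The purely imaginary parameter of a unitary character exists and is unique.\<close>

definition generic_character :: "(real^'n^'n) set \<Rightarrow> (real^'n \<Rightarrow> complex) \<Rightarrow> bool" where
  "generic_character K \<psi> \<longleftrightarrow>
     unitary_character \<psi> \<and> (\<exists>\<Lambda>. purely_imaginary \<Lambda> \<and> \<psi> = exp_character \<Lambda> \<and> generic K \<Lambda>)"

text \<open>A function on the group is represented by its extension by zero to the whole type.
  Square integrability modulo the translations is vacuous, the quotient being finite.\<close>

definition induced_space ::
  "(real^'n^'n) set \<Rightarrow> (real^'n \<Rightarrow> complex) \<Rightarrow> ((real^'n) \<times> (real^'n^'n) \<Rightarrow> complex) set" where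
  "induced_space K \<psi> =
     {f. (\<forall>g. g \<notin> carrier (motion_group K) \<longrightarrow> f g = 0) \<and>
         (\<forall>g\<in>carrier (motion_group K). \<forall>x.
            f (g \<otimes>\<^bsub>motion_group K\<^esub> (x, mat 1)) = inverse (\<psi> x) * f g)}"

definition induced_rep ::
  "(real^'n^'n) set \<Rightarrow> (real^'n \<Rightarrow> complex)
     \<Rightarrow> ((real^'n) \<times> (real^'n^'n), (real^'n) \<times> (real^'n^'n)) rep" where
  "induced_rep K \<psi> =
     (induced_space K \<psi>,
      \<lambda>g\<^sub>0 f g. if g \<in> carrier (motion_group K)
               then f (inv\<^bsub>motion_group K\<^esub> g\<^sub>0 \<otimes>\<^bsub>motion_group K\<^esub> g) else 0)"

definition generic_induced_reps ::
  "(real^'n^'n) set \<Rightarrow> ((real^'n) \<times> (real^'n^'n), (real^'n) \<times> (real^'n^'n)) rep set" where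
  "generic_induced_reps K = {induced_rep K \<psi> | \<psi>. generic_character K \<psi>}"

text \<open>Here \<open>\<Lambda>\<close> is purely imaginary, like the parameters of the unitary characters: for other
  generic \<open>\<Lambda>\<close> no unitary induced representation is equivalent to the one on the eigenspace.\<close>

definition generic_eigenspace_reps ::
  "(real^'n^'n) set \<Rightarrow> ((real^'n) \<times> (real^'n^'n), real^'n) rep set" where
  "generic_eigenspace_reps K =
     {eigenspace_rep K \<Lambda> | \<Lambda>. purely_imaginary \<Lambda> \<and> generic K \<Lambda>}"

end

theory Submission
  imports Defs
begin

text \<open>Write \<open>S\<close> for the ring of polynomial functions on \<open>\<complex>\<^sup>n\<close>, \<open>R\<close> for its subring of
  \<open>K\<close>-invariants, and \<open>J\<close> for the ideal of \<open>S\<close> generated by the invariants that vanish at \<open>\<Lambda>\<close>.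

  The dimension bound comes from a duality between \<open>S/J\<close> and the joint eigenspace \<open>E\<close>. A joint
  eigenfunction \<open>f\<close> gives the linear functional \<open>p \<mapsto> (p(\<partial>)f)(0)\<close> on \<open>S\<close>, which vanishes on \<open>J\<close>
  because \<open>r(\<partial>)f = r(\<Lambda>)f\<close> for invariant \<open>r\<close>. The functional determines \<open>f\<close>: since \<open>S/J\<close> has finite
  dimension, \<open>J\<close> contains a nonzero polynomial in each single coordinate, so \<open>f\<close> and its derivatives
  satisfy an ordinary differential equation with constant coefficients along each axis and vanish
  when all derivatives at \<open>0\<close> do (\<open>joint_eigenfunction_determined_at_0\<close>). Hence
  \<open>dim E \<le> dim S/J\<close>.

  That \<open>dim S/J \<le> |K|\<close> is where reflections enter (\<open>fibre_ideal_codim_le\<close>). On the one hand, more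
  than \<open>|K|\<close> polynomials are always linearly dependent over \<open>R\<close>: the conditions
  \<open>\<Sum>\<^sub>i q\<^sub>i (z\<^sub>i \<circ> k) = 0\<close>, one for each \<open>k \<in> K\<close>, have a nonzero solution \<open>q\<close> in \<open>S\<close>, and a
  suitable average of it over \<open>K\<close> is an invariant solution (\<open>dependent_over_invariants\<close>). On the
  other hand, polynomials that are linearly independent modulo \<open>J\<close> are independent over \<open>R\<close>
  (\<open>independent_over_invariants\<close>). The latter is Chevalley's argument that \<open>S\<close> is a free
  \<open>R\<close>-module, carried out in the local ring of \<open>R\<close> at \<open>\<Lambda>\<close> instead of with graded ideals, which
  treats all \<open>\<Lambda>\<close> alike. Its core is \<open>syzygy_coefficient_in_fibre_ideal\<close>, an induction on the degree
  that uses that \<open>g \<circ> s - g\<close> is divisible by a linear form when \<open>s\<close> is a reflection.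

  For generic \<open>\<Lambda>\<close> the \<open>|K|\<close> exponentials with exponents \<open>k \<cdot> \<Lambda>\<close> lie in \<open>E\<close>, and as distinct
  characters of the translations they are linearly independent; so they form a basis of \<open>E\<close>
  (\<open>generic_joint_eigenspace\<close>). A subspace invariant under translations contains the components in
  the basis of each of its members, and \<open>K\<close> permutes the basis transitively; this is
  irreducibility. A function \<open>f\<close> in the space induced from the character with parameter \<open>\<Lambda>\<close>
  satisfies \<open>f(x, k) = f(0, k) exp(k\<Lambda> \<cdot> x)\<close>, so \<open>f \<mapsto> (x \<mapsto> \<Sum>\<^sub>k f(x, k))\<close> is an equivalence with
  \<open>E\<close> (\<open>induced_equivalent_eigenspace\<close>). The correspondence of equivalence classes is then formal.\<close>

lemma sum_fun_apply: "(\<Sum>i\<in>I. f i) x = (\<Sum>i\<in>I. f i x)"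
  for f :: "'i \<Rightarrow> 'a \<Rightarrow> 'b::comm_monoid_add"
  by (induction I rule: infinite_finite_induct) auto

lemma cscale_apply [simp]: "cscale c f x = c * f x"
  by (simp add: cscale_def)

section \<open>Homogeneous linear systems over subrings without zero divisors\<close>

text \<open>More unknowns than equations, with solutions sought in the subring itself: one Gaussian elimination
step per equation, multiplying by the pivot instead of dividing. The ambient ring may
have zero divisors, as the ring of all functions does, while polynomial functions form a subring
without any.\<close>

lemma underdetermined_system_solvable:
  fixes A :: "'r::comm_ring_1 set" and M :: "'e \<Rightarrow> 'i \<Rightarrow> 'r"
  assumes zero: "0 \<in> A" and one: "1 \<in> A"
    and add: "\<And>a b. a \<in> A \<Longrightarrow> b \<in> A \<Longrightarrow> a + b \<in> A"
    and uminus: "\<And>a. a \<in> A \<Longrightarrow> - a \<in> A"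
    and mult: "\<And>a b. a \<in> A \<Longrightarrow> b \<in> A \<Longrightarrow> a * b \<in> A"
    and domain: "\<And>a b. a \<in> A \<Longrightarrow> b \<in> A \<Longrightarrow> a * b = 0 \<Longrightarrow> a = 0 \<or> b = 0"
    and E: "finite E" and I: "finite I" "card E < card I"
    and M: "\<And>e i. e \<in> E \<Longrightarrow> i \<in> I \<Longrightarrow> M e i \<in> A"
  shows "\<exists>q. (\<forall>i\<in>I. q i \<in> A) \<and> (\<exists>i\<in>I. q i \<noteq> 0) \<and> (\<forall>e\<in>E. (\<Sum>i\<in>I. M e i * q i) = 0)"
  using E I M
proof (induction E arbitrary: I M rule: finite_induct)
  case empty
  then have "I \<noteq> {}" by auto
  then show ?case using one by (intro exI[of _ "\<lambda>_. 1"]) auto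
next
  case (insert e E)
  show ?case
  proof (cases "\<forall>i\<in>I. M e i = 0")
    case True
    obtain q where "\<forall>i\<in>I. q i \<in> A" "\<exists>i\<in>I. q i \<noteq> 0" "\<forall>e\<in>E. (\<Sum>i\<in>I. M e i * q i) = 0"
      using insert.IH[of I M] insert.prems insert.hyps by auto
    then show ?thesis using True by (intro exI[of _ q]) auto
  next
    case False
    then obtain j where j: "j \<in> I" "M e j \<noteq> 0" by blast
    define I' where "I' = I - {j}"
    define m where "m = M e j"
    define M' where "M' e' i = m * M e' i + - (M e' j * M e i)" for e' i
    have mA: "m \<in> A" using insert.prems j by (auto simp: m_def)
    have I': "finite I'" "card E < card I'" "I = insert j I'" "j \<notin> I'"
      using insert.prems insert.hyps j by (auto simp: I'_def)
    have M'A: "M' e' i \<in> A" if "e' \<in> E" "i \<in> I'" for e' i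
      unfolding M'_def using insert.prems(3) mA that I' j by (intro add uminus mult) auto
    obtain q' where q': "\<forall>i\<in>I'. q' i \<in> A" "\<exists>i\<in>I'. q' i \<noteq> 0"
        "\<forall>e\<in>E. (\<Sum>i\<in>I'. M' e i * q' i) = 0"
      using insert.IH[of I' M'] I'(1,2) M'A by blast
    \<comment> \<open>the eliminated unknown is solved for, after clearing the denominator \<open>m\<close>\<close>
    define q where "q i = (if i = j then - (\<Sum>i\<in>I'. M e i * q' i) else m * q' i)" for i
    have sumA: "sum f X \<in> A" if "\<And>i. i \<in> X \<Longrightarrow> f i \<in> A" for f and X :: "'i set"
      using that by (induction X rule: infinite_finite_induct) (auto intro: zero add)
    have split: "(\<Sum>i\<in>I. M e' i * q i) =
        m * (\<Sum>i\<in>I'. M e' i * q' i) - M e' j * (\<Sum>i\<in>I'. M e i * q' i)" for e'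
    proof -
      have "(\<Sum>i\<in>I. M e' i * q i) = M e' j * q j + (\<Sum>i\<in>I'. M e' i * q i)"
        using I' by simp
      also have "(\<Sum>i\<in>I'. M e' i * q i) = (\<Sum>i\<in>I'. m * (M e' i * q' i))"
        using I' by (intro sum.cong) (auto simp: q_def algebra_simps)
      finally show ?thesis by (simp add: q_def sum_distrib_left)
    qed
    have "(\<Sum>i\<in>I. M e' i * q i) = 0" if "e' \<in> E" for e'
    proof -
      have "(\<Sum>i\<in>I'. M' e' i * q' i) =
          m * (\<Sum>i\<in>I'. M e' i * q' i) - M e' j * (\<Sum>i\<in>I'. M e i * q' i)"
        by (simp add: M'_def algebra_simps sum_subtractf sum_distrib_left)
      then show ?thesis using split[of e'] q'(3) that by simp
    qed
    moreover have "(\<Sum>i\<in>I. M e i * q i) = 0"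
      using split[of e] by (simp add: m_def)
    moreover have "q i \<in> A" if "i \<in> I" for i
      using that q'(1) I' mA insert.prems(3) by (auto simp: q_def intro!: uminus sumA mult)
    moreover have "\<exists>i\<in>I. q i \<noteq> 0"
    proof -
      obtain i where i: "i \<in> I'" "q' i \<noteq> 0" using q'(2) by blast
      then have "m * q' i \<noteq> 0" using domain[of m "q' i"] mA q'(1) j by (auto simp: m_def)
      then show ?thesis using i I' by (intro bexI[of _ i]) (auto simp: q_def)
    qed
    ultimately show ?thesis by (intro exI[of _ q]) auto
  qed
qed

section \<open>Polynomial functions\<close>

text \<open>The index bounds the degree from above. Polynomial functions are used in place of formal polynomials
because substitution of a linear map is then composition; the bound is what the induction on the
degree in Chevalley's argument runs on.\<close>

inductive poly_fun_le :: "nat \<Rightarrow> (complex^'n \<Rightarrow> complex) \<Rightarrow> bool" where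
  const: "poly_fun_le d (\<lambda>z. c)"
| coord_mult: "poly_fun_le d f \<Longrightarrow> poly_fun_le (Suc d) (\<lambda>z. z $ i * f z)"
| add: "poly_fun_le d f \<Longrightarrow> poly_fun_le d g \<Longrightarrow> poly_fun_le d (\<lambda>z. f z + g z)"

definition poly_fun :: "(complex^'n \<Rightarrow> complex) set" where
  "poly_fun = {f. \<exists>d. poly_fun_le d f}"

lemma poly_fun_le_Suc: "poly_fun_le d f \<Longrightarrow> poly_fun_le (Suc d) f"
  by (induction rule: poly_fun_le.induct) (auto intro: poly_fun_le.intros)

lemma poly_fun_le_mono: "poly_fun_le d f \<Longrightarrow> d \<le> e \<Longrightarrow> poly_fun_le e f"
  by (induction e rule: nat_induct) (auto simp: le_Suc_eq poly_fun_le_Suc)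

lemma poly_fun_le_scale: "poly_fun_le d f \<Longrightarrow> poly_fun_le d (\<lambda>z. c * f z)"
proof (induction rule: poly_fun_le.induct)
  case (coord_mult d f i)
  then show ?case using poly_fun_le.coord_mult[of d "\<lambda>z. c * f z" i] by (simp add: mult.left_commute)
qed (auto simp: algebra_simps intro: poly_fun_le.intros)

lemma poly_fun_le_mult:
  "poly_fun_le d f \<Longrightarrow> poly_fun_le e g \<Longrightarrow> poly_fun_le (d + e) (\<lambda>z. f z * g z)"
proof (induction rule: poly_fun_le.induct)
  case (const d c)
  then show ?case by (intro poly_fun_le_mono[of e _ "d + e"] poly_fun_le_scale) auto
next
  case (coord_mult d f i)
  then show ?case using poly_fun_le.coord_mult[of "d+e" "\<lambda>z. f z * g z" i] by (simp add: mult.assoc)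
qed (auto simp: algebra_simps intro: poly_fun_le.intros)

lemma poly_fun_le_sum:
  "(\<And>i. i \<in> I \<Longrightarrow> poly_fun_le d (f i)) \<Longrightarrow> poly_fun_le d (\<lambda>z. \<Sum>i\<in>I. f i z)"
  by (induction I rule: infinite_finite_induct) (auto intro: poly_fun_le.intros)

lemma poly_fun_le_coord: "poly_fun_le (Suc 0) (\<lambda>z. z $ i)"
  using poly_fun_le.coord_mult[OF poly_fun_le.const, of 0 i 1] by simp

lemma poly_fun_le_linear_subst:
  fixes A :: "complex^'n^'n"
  shows "poly_fun_le d f \<Longrightarrow> poly_fun_le d (\<lambda>z. f (A *v z))"
proof (induction rule: poly_fun_le.induct)
  case (coord_mult d f i)
  have "poly_fun_le (Suc d) (\<lambda>z. \<Sum>j\<in>UNIV. z $ j * (A $ i $ j * f (A *v z)))"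
    using coord_mult by (intro poly_fun_le_sum poly_fun_le.coord_mult poly_fun_le_scale)
  then show ?case by (simp add: matrix_vector_mult_def sum_distrib_right algebra_simps)
qed (auto intro: poly_fun_le.intros)

lemma poly_fun_const [intro, simp]: "(\<lambda>z. c) \<in> poly_fun"
  by (auto simp: poly_fun_def intro: poly_fun_le.intros)

lemma poly_fun_coord [intro, simp]: "(\<lambda>z. z $ i) \<in> poly_fun"
  using poly_fun_le_coord by (auto simp: poly_fun_def)

lemma poly_fun_add_pw: "f \<in> poly_fun \<Longrightarrow> g \<in> poly_fun \<Longrightarrow> (\<lambda>z. f z + g z) \<in> poly_fun"
proof -
  assume "f \<in> poly_fun" "g \<in> poly_fun"
  then obtain d e where "poly_fun_le d f" "poly_fun_le e g" by (auto simp: poly_fun_def)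
  then have "poly_fun_le (max d e) (\<lambda>z. f z + g z)"
    by (intro poly_fun_le.add) (auto elim: poly_fun_le_mono)
  then show ?thesis by (auto simp: poly_fun_def)
qed

lemma poly_fun_mult_pw: "f \<in> poly_fun \<Longrightarrow> g \<in> poly_fun \<Longrightarrow> (\<lambda>z. f z * g z) \<in> poly_fun"
  unfolding poly_fun_def using poly_fun_le_mult by blast

lemma poly_fun_add: "f \<in> poly_fun \<Longrightarrow> g \<in> poly_fun \<Longrightarrow> f + g \<in> poly_fun"
  using poly_fun_add_pw[of f g] by (simp add: plus_fun_def)

lemma poly_fun_mult: "f \<in> poly_fun \<Longrightarrow> g \<in> poly_fun \<Longrightarrow> f * g \<in> poly_fun"
  using poly_fun_mult_pw[of f g] by (simp add: times_fun_def)

lemma poly_fun_uminus: "f \<in> poly_fun \<Longrightarrow> - f \<in> poly_fun"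
  using poly_fun_mult_pw[of "\<lambda>_. -1" f] by (simp add: fun_Compl_def)

lemma poly_fun_diff: "f \<in> poly_fun \<Longrightarrow> g \<in> poly_fun \<Longrightarrow> f - g \<in> poly_fun"
  using poly_fun_add[of f "- g"] poly_fun_uminus[of g] by simp

lemma poly_fun_cscale: "f \<in> poly_fun \<Longrightarrow> cscale c f \<in> poly_fun"
  unfolding cscale_def by (intro poly_fun_mult_pw poly_fun_const)

lemma poly_fun_zero: "0 \<in> poly_fun" and poly_fun_one: "1 \<in> poly_fun"
  using poly_fun_const[of 0] poly_fun_const[of 1] by (simp_all add: zero_fun_def one_fun_def)

lemma poly_fun_sum: "(\<And>i. i \<in> I \<Longrightarrow> f i \<in> poly_fun) \<Longrightarrow> sum f I \<in> poly_fun"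
  by (induction I rule: infinite_finite_induct) (auto intro: poly_fun_zero poly_fun_add)

lemma poly_fun_prod: "(\<And>i. i \<in> I \<Longrightarrow> f i \<in> poly_fun) \<Longrightarrow> prod f I \<in> poly_fun"
  by (induction I rule: infinite_finite_induct) (auto intro: poly_fun_one poly_fun_mult)

lemma poly_fun_power: "f \<in> poly_fun \<Longrightarrow> f ^ k \<in> poly_fun"
  by (induction k) (auto intro: poly_fun_one poly_fun_mult)

lemma subspace_poly_fun: "cfun.subspace poly_fun"
  by (auto simp: cfun.subspace_def poly_fun_zero poly_fun_add poly_fun_cscale)

lemma poly_fun_linear_subst:
  fixes A :: "complex^'n^'n"
  shows "f \<in> poly_fun \<Longrightarrow> (\<lambda>z. f (A *v z)) \<in> poly_fun"
  unfolding poly_fun_def using poly_fun_le_linear_subst by blast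

lemma poly_fun_induct [consumes 1, case_names const coord_mult add]:
  assumes "f \<in> poly_fun"
    and "\<And>c. P (\<lambda>z. c)"
    and "\<And>f i. f \<in> poly_fun \<Longrightarrow> P f \<Longrightarrow> P (\<lambda>z. z $ i * f z)"
    and "\<And>f g. f \<in> poly_fun \<Longrightarrow> P f \<Longrightarrow> g \<in> poly_fun \<Longrightarrow> P g \<Longrightarrow> P (\<lambda>z. f z + g z)"
  shows "P f"
proof -
  obtain d where "poly_fun_le d f" using assms(1) by (auto simp: poly_fun_def)
  then have "poly_fun_le d f \<and> P f"
    by (induction rule: poly_fun_le.induct)
       (auto intro: assms(2) assms(3,4)[unfolded poly_fun_def] poly_fun_le.intros)
  then show ?thesis ..
qed

text \<open>This reduces questions about zeros to polynomials in one variable.\<close>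

lemma poly_fun_on_line:
  assumes "f \<in> poly_fun"
  shows "\<exists>p. \<forall>t. f (x + t *s v) = poly p t"
  using assms
proof (induction rule: poly_fun_induct)
  case (const c)
  show ?case by (rule exI[of _ "[:c:]"]) simp
next
  case (coord_mult f i)
  then obtain p where "\<forall>t. f (x + t *s v) = poly p t" by blast
  then show ?case by (intro exI[of _ "[:x $ i, v $ i:] * p"]) (simp add: algebra_simps)
next
  case (add f g)
  then obtain p q where "\<forall>t. f (x + t *s v) = poly p t" "\<forall>t. g (x + t *s v) = poly q t" by blast
  then show ?case by (intro exI[of _ "p + q"]) simp
qed

text \<open>On the line through a point where \<open>f\<close> does not vanish and one where \<open>g\<close> does not, both are nonzero
polynomials in one variable.\<close>

lemma poly_fun_no_zero_divisors:
  assumes "f \<in> poly_fun" "g \<in> poly_fun" "f * g = 0"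
  shows "f = 0 \<or> g = 0"
proof (rule ccontr)
  assume "\<not> ?thesis"
  then obtain x y where xy: "f x \<noteq> 0" "g y \<noteq> 0" by (auto simp: fun_eq_iff)
  obtain p where p: "\<forall>t. f (x + t *s (y - x)) = poly p t" using poly_fun_on_line[OF assms(1)] by blast
  obtain q where q: "\<forall>t. g (x + t *s (y - x)) = poly q t" using poly_fun_on_line[OF assms(2)] by blast
  have "poly p 0 \<noteq> 0" "poly q 1 \<noteq> 0" using p[rule_format, of 0] q[rule_format, of 1] xy by auto
  then have "p * q \<noteq> 0" by auto
  moreover have "poly (p * q) t = 0" for t
    using p[rule_format, of t] q[rule_format, of t] fun_cong[OF assms(3)] by (metis poly_mult times_fun_apply zero_fun_apply)
  ultimately show False using poly_all_0_iff_0 by blast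
qed

lemma poly_fun_prod_nonzero:
  assumes "finite I" "\<And>i. i \<in> I \<Longrightarrow> f i \<in> poly_fun" "\<And>i. i \<in> I \<Longrightarrow> f i \<noteq> 0"
  shows "prod f I \<noteq> 0"
  using assms
proof (induction I rule: finite_induct)
  case (insert i I)
  then have "f i \<noteq> 0" "prod f I \<noteq> 0" "f i \<in> poly_fun" "prod f I \<in> poly_fun"
    by (blast intro: poly_fun_prod)+
  then show ?case
    using poly_fun_no_zero_divisors insert.hyps by (metis prod.insert)
qed (simp add: fun_eq_iff)

text \<open>For a map that moves each point along a fixed vector by the amount \<open>l\<close>, the difference is divisible
by \<open>l\<close>, and dividing lowers the degree. The quotient is built by the product rule for differences.\<close>

lemma poly_fun_difference_quotient:
  fixes A :: "complex^'n^'n" and l :: "complex^'n \<Rightarrow> complex"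
  assumes A: "\<And>z. A *v z = z + l z *s v"
  assumes "poly_fun_le d g"
  shows "\<exists>h. (\<forall>z. g (A *v z) - g z = l z * h z) \<and> (if d = 0 then h = (\<lambda>z. 0) else poly_fun_le (d - 1) h)"
  using assms(2)
proof (induction rule: poly_fun_le.induct)
  case (const d c)
  show ?case by (rule exI[of _ "\<lambda>z. 0"]) (auto intro: poly_fun_le.const)
next
  case (coord_mult d f i)
  then obtain h where h: "\<forall>z. f (A *v z) - f z = l z * h z"
     and h_le: "if d = 0 then h = (\<lambda>z. 0) else poly_fun_le (d - 1) h" by blast
  have "poly_fun_le d (\<lambda>z. v $ i * f (A *v z) + z $ i * h z)"
  proof (intro poly_fun_le.add poly_fun_le_scale poly_fun_le_linear_subst coord_mult.hyps)
    show "poly_fun_le d (\<lambda>z. z $ i * h z)"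
      using h_le poly_fun_le.coord_mult[of "d - 1" h i] by (cases "d = 0") (auto intro: poly_fun_le.const)
  qed
  moreover have "(A *v z) $ i * f (A *v z) - z $ i * f z = l z * (v $ i * f (A *v z) + z $ i * h z)" for z
    using h[rule_format, of z] A[of z] by (auto simp: algebra_simps)
  ultimately show ?case by auto
next
  case (add d f g)
  then obtain h h' where "\<forall>z. f (A *v z) - f z = l z * h z" "\<forall>z. g (A *v z) - g z = l z * h' z"
     "if d = 0 then h = (\<lambda>z. 0) else poly_fun_le (d - 1) h" "if d = 0 then h' = (\<lambda>z. 0) else poly_fun_le (d - 1) h'" by blast
  then show ?case by (intro exI[of _ "\<lambda>z. h z + h' z"]) (auto simp: algebra_simps intro: poly_fun_le.add)
qed


section \<open>Invariants of a finite orthogonal group\<close>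

lemma complex_matrix_mult: "complex_matrix (A ** B) = complex_matrix A ** complex_matrix B"
  by (simp add: complex_matrix_def map_matrix_def matrix_matrix_mult_def vec_eq_iff)

lemma complex_act_mult: "complex_act (A ** B) z = complex_act A (complex_act B z)"
  by (simp add: complex_act_def complex_matrix_mult matrix_vector_mul_assoc)

lemma complex_act_one [simp]: "complex_act (mat 1) z = z" for z :: "complex^'n"
proof -
  have "complex_matrix (mat 1 :: real^'n^'n) = mat 1"
    by (simp add: complex_matrix_def map_matrix_def mat_def vec_eq_iff)
  then show ?thesis by (simp add: complex_act_def)
qed

lemma poly_fun_complex_act: "f \<in> poly_fun \<Longrightarrow> (\<lambda>z. f (complex_act k z)) \<in> poly_fun"
  unfolding complex_act_def by (rule poly_fun_linear_subst)

lemma cscale_mult: "cscale c p * q = cscale c (p * q)"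
  by (simp add: cscale_def times_fun_def mult.assoc)

lemma group_orthogonal_group: "group (orthogonal_group :: (real^'n^'n) monoid)"
proof (rule groupI)
  fix x :: "real^'n^'n"
  assume "x \<in> carrier orthogonal_group"
  then show "\<exists>y\<in>carrier orthogonal_group. y \<otimes>\<^bsub>orthogonal_group\<^esub> x = \<one>\<^bsub>orthogonal_group\<^esub>"
    by (intro bexI[of _ "transpose x"]) (simp_all add: orthogonal_group_def orthogonal_matrix_transpose, simp add: orthogonal_matrix_def)
qed (simp_all add: orthogonal_group_def orthogonal_matrix_mul orthogonal_matrix_id matrix_mul_assoc)

lemma orthogonal_group_inv:
  assumes "orthogonal_matrix a"
  shows "inv\<^bsub>orthogonal_group\<^esub> a = transpose a"
proof (rule group.inv_equality[OF group_orthogonal_group])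
  show "transpose a \<otimes>\<^bsub>orthogonal_group\<^esub> a = \<one>\<^bsub>orthogonal_group\<^esub>"
    using assms by (simp add: orthogonal_group_def orthogonal_matrix_def)
qed (use assms in \<open>simp_all add: orthogonal_group_def orthogonal_matrix_transpose\<close>)

locale finite_orthogonal_group =
  fixes K :: "(real^'n^'n) set"
  assumes finite_K: "finite K"
    and one_mem: "mat 1 \<in> K"
    and mult_mem: "\<And>a b. a \<in> K \<Longrightarrow> b \<in> K \<Longrightarrow> a ** b \<in> K"
    and transpose_mem: "\<And>a. a \<in> K \<Longrightarrow> transpose a \<in> K"
    and orthogonal_mem: "\<And>a. a \<in> K \<Longrightarrow> orthogonal_matrix a"
begin

lemma transpose_mult_self: "a \<in> K \<Longrightarrow> transpose a ** a = mat 1"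
  and mult_transpose_self: "a \<in> K \<Longrightarrow> a ** transpose a = mat 1"
  using orthogonal_mem by (auto simp: orthogonal_matrix_def)

lemma complex_act_transpose [simp]:
  "k \<in> K \<Longrightarrow> complex_act (transpose k) (complex_act k z) = z"
  "k \<in> K \<Longrightarrow> complex_act k (complex_act (transpose k) z) = z"
  by (simp_all flip: complex_act_mult add: transpose_mult_self mult_transpose_self)

lemma card_K_pos: "card K > 0"
  using finite_K one_mem by (auto simp: card_gt_0_iff)

lemma bij_betw_mult_right: "h \<in> K \<Longrightarrow> bij_betw (\<lambda>k. k ** h) K K"
  by (rule bij_betw_byWitness[where f' = "\<lambda>k. k ** transpose h"])
     (auto simp: mult_mem transpose_mem mult_transpose_self transpose_mult_self simp flip: matrix_mul_assoc)

lemma bij_betw_mult_left: "h \<in> K \<Longrightarrow> bij_betw (\<lambda>k. h ** k) K K"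
  by (rule bij_betw_byWitness[where f' = "\<lambda>k. transpose h ** k"])
     (auto simp: mult_mem transpose_mem mult_transpose_self transpose_mult_self matrix_mul_assoc)

definition invariants :: "(complex^'n \<Rightarrow> complex) set" where
  "invariants = {r \<in> poly_fun. \<forall>k\<in>K. \<forall>z. r (complex_act k z) = r z}"

lemma invariant_poly_fun: "r \<in> invariants \<Longrightarrow> r \<in> poly_fun"
  and invariant_act: "r \<in> invariants \<Longrightarrow> k \<in> K \<Longrightarrow> r (complex_act k z) = r z"
  by (auto simp: invariants_def)

lemma invariants_const: "(\<lambda>z. c) \<in> invariants"
  and invariants_mult: "r \<in> invariants \<Longrightarrow> r' \<in> invariants \<Longrightarrow> r * r' \<in> invariants"
  and invariants_uminus: "r \<in> invariants \<Longrightarrow> - r \<in> invariants"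
  by (auto simp: invariants_def poly_fun_mult poly_fun_uminus)

text \<open>Translating the summation index by a member of \<open>K\<close> permutes the summands.\<close>

lemma orbit_sum_invariant:
  assumes "g \<in> poly_fun"
  shows "(\<Sum>k\<in>K. (\<lambda>z. g (complex_act k z))) \<in> invariants"
proof -
  have "(\<Sum>k\<in>K. g (complex_act k (complex_act h z))) = (\<Sum>k\<in>K. g (complex_act k z))" if "h \<in> K" for h z
    using sum.reindex_bij_betw[OF bij_betw_mult_right[OF that], of "\<lambda>k. g (complex_act k z)"]
    by (simp add: complex_act_mult)
  then show ?thesis
    using assms by (auto simp: invariants_def sum_fun_apply intro!: poly_fun_sum poly_fun_complex_act)
qed

definition average :: "(complex^'n \<Rightarrow> complex) \<Rightarrow> complex^'n \<Rightarrow> complex" where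
  "average g = cscale (1 / card K) (\<Sum>k\<in>K. (\<lambda>z. g (complex_act k z)))"

lemma average_invariant: "g \<in> poly_fun \<Longrightarrow> average g \<in> invariants"
  using invariants_mult[OF invariants_const[of "1 / card K"] orbit_sum_invariant[of g]]
  by (simp add: average_def cscale_def times_fun_def)

text \<open>A relation with invariant coefficients is preserved by each \<open>k \<in> K\<close>, hence by averaging.\<close>

lemma average_syzygy:
  assumes "\<And>i. i \<in> I \<Longrightarrow> f i \<in> invariants" "(\<Sum>i\<in>I. g i * f i) = 0"
  shows "(\<Sum>i\<in>I. average (g i) * f i) = 0"
proof
  fix z
  have "(\<Sum>i\<in>I. g i (complex_act k z) * f i z) = 0" if "k \<in> K" for k
  proof -
    have "(\<Sum>i\<in>I. g i (complex_act k z) * f i z) = (\<Sum>i\<in>I. g i (complex_act k z) * f i (complex_act k z))"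
      using assms(1) that by (intro sum.cong) (auto simp: invariant_act)
    also have "\<dots> = 0" using fun_cong[OF assms(2), of "complex_act k z"] by (simp add: sum_fun_apply)
    finally show ?thesis .
  qed
  then have "(\<Sum>k\<in>K. \<Sum>i\<in>I. g i (complex_act k z) * f i z) = 0" by simp
  moreover have "(\<Sum>i\<in>I. average (g i) * f i) z =
      1 / card K * (\<Sum>k\<in>K. \<Sum>i\<in>I. g i (complex_act k z) * f i z)"
    by (subst sum.swap) (simp add: average_def sum_fun_apply sum_distrib_left sum_distrib_right mult.assoc)
  ultimately show "(\<Sum>i\<in>I. average (g i) * f i) z = 0 z" by simp
qed

text \<open>The spanning elements are closed under multiplication by polynomial functions, so this is the ideal
  generated by the invariants that vanish at \<open>\<Lambda>\<close>; its zero set is the orbit of \<open>\<Lambda>\<close>, the fibre of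
  the quotient map by \<open>K\<close>.\<close>

definition fibre_ideal :: "complex^'n \<Rightarrow> (complex^'n \<Rightarrow> complex) set" where
  "fibre_ideal \<Lambda> = cfun.span {(\<lambda>z. (r z - r \<Lambda>) * q z) | r q. r \<in> invariants \<and> q \<in> poly_fun}"

lemma subspace_fibre_ideal: "cfun.subspace (fibre_ideal \<Lambda>)"
  by (simp add: fibre_ideal_def)

lemmas fibre_ideal_add = cfun.subspace_add[OF subspace_fibre_ideal]
  and fibre_ideal_diff = cfun.subspace_diff[OF subspace_fibre_ideal]
  and fibre_ideal_neg = cfun.subspace_neg[OF subspace_fibre_ideal]
  and fibre_ideal_sum = cfun.subspace_sum[OF subspace_fibre_ideal]
  and fibre_ideal_scale = cfun.subspace_scale[OF subspace_fibre_ideal]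
  and fibre_ideal_zero = cfun.subspace_0[OF subspace_fibre_ideal]

lemma fibre_ideal_induct [consumes 1, case_names subspace base]:
  assumes "p \<in> fibre_ideal \<Lambda>"
    and "cfun.subspace {p. P p}"
    and "\<And>r q. r \<in> invariants \<Longrightarrow> q \<in> poly_fun \<Longrightarrow> P (\<lambda>z. (r z - r \<Lambda>) * q z)"
  shows "P p"
  using assms(1) unfolding fibre_ideal_def
  by (rule cfun.span_induct[where P = P]) (use assms(2,3) in auto)

lemma fibre_ideal_base:
  "r \<in> invariants \<Longrightarrow> q \<in> poly_fun \<Longrightarrow> (\<lambda>z. (r z - r \<Lambda>) * q z) \<in> fibre_ideal \<Lambda>"
  unfolding fibre_ideal_def by (intro cfun.span_base) auto

lemma fibre_ideal_subset: "fibre_ideal \<Lambda> \<subseteq> poly_fun"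
  unfolding fibre_ideal_def
proof (rule cfun.span_minimal[OF _ subspace_poly_fun], safe)
  fix r q :: "complex^'n \<Rightarrow> complex" assume "r \<in> invariants" "q \<in> poly_fun"
  then show "(\<lambda>z. (r z - r \<Lambda>) * q z) \<in> poly_fun"
    using poly_fun_mult[OF poly_fun_diff[OF invariant_poly_fun poly_fun_const], of r q "r \<Lambda>"]
    by (simp add: times_fun_def)
qed

lemma fibre_ideal_mult:
  assumes "p \<in> fibre_ideal \<Lambda>" "q \<in> poly_fun"
  shows "p * q \<in> fibre_ideal \<Lambda>"
  using assms(1)
proof (induction rule: fibre_ideal_induct)
  case subspace
  show ?case
    by (rule cfun.subspaceI; simp only: mem_Collect_eq distrib_right cscale_mult mult_zero_left)
       (intro fibre_ideal_add fibre_ideal_scale fibre_ideal_zero; assumption)+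
next
  case (base r q')
  then show ?case
    using fibre_ideal_base[OF base(1) poly_fun_mult[OF base(2) assms(2)], of \<Lambda>]
    by (simp only: times_fun_def mult.assoc)
qed

lemma fibre_ideal_act:
  assumes "p \<in> fibre_ideal \<Lambda>" "k \<in> K"
  shows "(\<lambda>z. p (complex_act k z)) \<in> fibre_ideal \<Lambda>"
  using assms(1)
proof (induction rule: fibre_ideal_induct)
  case subspace
  show ?case
    using fibre_ideal_add fibre_ideal_scale fibre_ideal_zero
    by (auto simp: cfun.subspace_def cscale_def plus_fun_def zero_fun_def)
next
  case (base r q)
  then show ?case
    using fibre_ideal_base[of r "\<lambda>z. q (complex_act k z)"] assms(2)
    by (simp add: poly_fun_complex_act invariant_act)
qed

lemma fibre_ideal_invariant:
  assumes "r \<in> invariants" "r \<Lambda> = 0"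
  shows "r \<in> fibre_ideal \<Lambda>"
  using fibre_ideal_base[OF assms(1) poly_fun_const[of 1], of \<Lambda>] assms(2) by simp

lemma average_congruent_mod_fibre_ideal:
  assumes "\<And>k. k \<in> K \<Longrightarrow> (\<lambda>z. g (complex_act k z) - g z) \<in> fibre_ideal \<Lambda>"
  shows "average g - g \<in> fibre_ideal \<Lambda>"
proof -
  have "average g - g = cscale (1 / card K) (\<Sum>k\<in>K. (\<lambda>z. g (complex_act k z) - g z))"
    using card_K_pos by (auto simp: average_def fun_eq_iff sum_fun_apply sum_subtractf field_simps)
  then show ?thesis using assms by (simp add: fibre_ideal_scale fibre_ideal_sum)
qed

end

section \<open>Polynomials over the invariants of a group generated by reflections\<close>

text \<open>A family rather than a set, so that repetitions count as dependence.\<close>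

definition independent_mod :: "(complex^'n \<Rightarrow> complex) set \<Rightarrow> 'i set \<Rightarrow> ('i \<Rightarrow> complex^'n \<Rightarrow> complex) \<Rightarrow> bool"
  where "independent_mod J I z \<longleftrightarrow> (\<forall>c. (\<Sum>i\<in>I. cscale (c i) (z i)) \<in> J \<longrightarrow> (\<forall>i\<in>I. c i = 0))"

text \<open>Reflections enter as matrices \<open>s\<close> for which \<open>s - 1\<close> has rank at most one, the form that makes
\<open>g \<circ> s - g\<close> divisible by a linear form.\<close>

locale reflection_generated_group = finite_orthogonal_group K for K :: "(real^'n^'n) set" +
  fixes S
  assumes S_subset: "S \<subseteq> K"
    and rank_one: "\<And>s. s \<in> S \<Longrightarrow> \<exists>v a. \<forall>x. s *v x = x + (a \<bullet> x) *s v"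
    and generated: "generate orthogonal_group S = K"
begin

text \<open>The rank one form is inherited by the complexification, with a linear form \<open>l\<close> that has the same
coefficients.\<close>

lemma complex_act_rank_one:
  assumes "s \<in> S"
  shows "\<exists>v l. l \<in> poly_fun \<and> (\<forall>z. complex_act s z = z + l z *s v)"
proof -
  obtain v a where va: "\<forall>x. s *v x = x + (a \<bullet> x) *s v" using rank_one[OF assms] by blast
  have s: "s $ i $ j = (if i = j then 1 else 0) + a $ j * v $ i" for i j
  proof -
    have "(s *v axis j 1) $ i = (if i = j then 1 else 0) + a $ j * v $ i"
      using va[rule_format, of "axis j 1"] by (simp add: inner_axis) (simp add: axis_def)
    then show ?thesis by (simp add: matrix_vector_mult_basis column_def)
  qed
  have "complex_act s z $ i = z $ i + (\<Sum>j\<in>UNIV. of_real (a $ j) * z $ j) * of_real (v $ i)" for z i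
  proof -
    have "complex_act s z $ i = (\<Sum>j\<in>UNIV. (if i = j then z $ j else 0) + of_real (a $ j) * z $ j * of_real (v $ i))"
      by (simp add: complex_act_def complex_matrix_def map_matrix_def matrix_vector_mult_def s)
         (intro sum.cong, auto simp: algebra_simps)
    then show ?thesis by (simp add: sum.distrib sum_distrib_right)
  qed
  then have "complex_act s z = z + (\<Sum>j\<in>UNIV. of_real (a $ j) * z $ j) *s (\<chi> i. of_real (v $ i))" for z
    by (simp add: vec_eq_iff)
  moreover have "(\<lambda>z. \<Sum>j\<in>UNIV. of_real (a $ j) * z $ j) \<in> poly_fun"
    using poly_fun_sum[of UNIV "\<lambda>j z. of_real (a $ j) * z $ j"]
    by (simp add: poly_fun_mult_pw sum_fun_apply[abs_def])
  ultimately show ?thesis by blast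
qed

text \<open>The elements that fix \<open>g\<close> modulo the ideal form a group, since the ideal is stable under \<open>K\<close>.\<close>

lemma act_congruent_mod_fibre_ideal:
  assumes g: "\<And>s. s \<in> S \<Longrightarrow> (\<lambda>z. g (complex_act s z) - g z) \<in> fibre_ideal \<Lambda>"
    and k: "k \<in> K"
  shows "(\<lambda>z. g (complex_act k z) - g z) \<in> fibre_ideal \<Lambda>"
proof -
  have "k \<in> generate orthogonal_group S" using k generated by simp
  then show ?thesis
  proof (induction rule: generate.induct)
    case one
    show ?case using fibre_ideal_zero by (simp add: orthogonal_group_def zero_fun_def)
  next
    case (incl h)
    then show ?case by (rule g)
  next
    case (inv h)
    then have h: "h \<in> K" using S_subset by blast
    have "inv\<^bsub>orthogonal_group\<^esub> h = transpose h"
      by (rule orthogonal_group_inv[OF orthogonal_mem[OF h]])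
    moreover have "(\<lambda>z. g z - g (complex_act (transpose h) z)) \<in> fibre_ideal \<Lambda>"
      using fibre_ideal_act[OF g[OF inv] transpose_mem[OF h]] h by simp
    ultimately show ?case using fibre_ideal_neg by (fastforce simp: fun_Compl_def)
  next
    case (eng a b)
    then have b: "b \<in> K" using generated by simp
    show ?case
      using fibre_ideal_add[OF fibre_ideal_act[OF eng.IH(1) b] eng.IH(2)]
      by (simp add: plus_fun_def orthogonal_group_def complex_act_mult)
  qed
qed

text \<open>The hypothesis \<open>minimal\<close> says that \<open>f j\<close> is not generated by the other \<open>f i\<close> over the local ring
of the invariants at \<open>\<Lambda>\<close>: an invariant \<open>a\<close> with \<open>a \<Lambda> \<noteq> 0\<close> is a unit there. For a generator
\<open>s\<close>, the differences \<open>g i \<circ> s - g i\<close> form a syzygy again; divided by the linear form of \<open>s\<close> it has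
smaller degree, so \<open>g j \<circ> s - g j\<close> lies in the ideal by induction. Therefore \<open>g j\<close> is congruent to
its average. The averages form an invariant syzygy, and \<open>minimal\<close> forces the average of \<open>g j\<close> to
vanish at \<open>\<Lambda>\<close>, that is, to lie in the ideal.\<close>

lemma syzygy_coefficient_in_fibre_ideal:
  assumes I: "finite I" "j \<notin> I"
    and f: "\<And>i. i \<in> insert j I \<Longrightarrow> f i \<in> invariants"
    and g: "\<And>i. i \<in> insert j I \<Longrightarrow> g i \<in> poly_fun"
    and syzygy: "(\<Sum>i\<in>insert j I. g i * f i) = 0"
    and minimal: "\<And>a b. a \<in> invariants \<Longrightarrow> (\<And>i. i \<in> I \<Longrightarrow> b i \<in> invariants) \<Longrightarrow>
        a * f j = (\<Sum>i\<in>I. b i * f i) \<Longrightarrow> a \<Lambda> = 0"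
  shows "g j \<in> fibre_ideal \<Lambda>"
proof -
  obtain d where "poly_fun_le d (g j)" using g by (auto simp: poly_fun_def)
  then show ?thesis using g syzygy
  proof (induction d arbitrary: g rule: less_induct)
    case (less d)
    have "(\<lambda>z. g j (complex_act s z) - g j z) \<in> fibre_ideal \<Lambda>" if s: "s \<in> S" for s
    proof -
      obtain v l where l: "l \<in> poly_fun" and act: "\<And>z. complex_act s z = z + l z *s v"
        using complex_act_rank_one[OF s] by blast
      have "\<exists>h. h \<in> poly_fun \<and> (\<forall>z. g i (complex_act s z) - g i z = l z * h z) \<and>
          (i = j \<longrightarrow> (if d = 0 then h = (\<lambda>z. 0) else poly_fun_le (d - 1) h))"
        if i: "i \<in> insert j I" for i
      proof -
        obtain e where e: "poly_fun_le e (g i)" "i = j \<longrightarrow> e = d"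
          using less.prems(1,2) i by (cases "i = j") (auto simp: poly_fun_def)
        show ?thesis
          using poly_fun_difference_quotient[OF act[unfolded complex_act_def] e(1)] e(2)
          by (metis complex_act_def mem_Collect_eq poly_fun_const poly_fun_def)
      qed
      then obtain h where h: "\<And>i. i \<in> insert j I \<Longrightarrow> h i \<in> poly_fun"
          "\<And>i z. i \<in> insert j I \<Longrightarrow> g i (complex_act s z) - g i z = l z * h i z"
          "if d = 0 then h j = (\<lambda>z. 0) else poly_fun_le (d - 1) (h j)"
        by (metis insertI1)
      show ?thesis
      proof (cases "l = 0 \<or> d = 0")
        case True
        then have "(\<lambda>z. g j (complex_act s z) - g j z) = 0"
          using h(2)[of j] h(3) by (auto simp: fun_eq_iff)
        then show ?thesis by (simp add: fibre_ideal_zero)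
      next
        case False
        have "l * (\<Sum>i\<in>insert j I. h i * f i) = 0"
        proof
          fix z
          have "(l * (\<Sum>i\<in>insert j I. h i * f i)) z = (\<Sum>i\<in>insert j I. l z * h i z * f i z)"
            by (simp only: times_fun_apply sum_fun_apply sum_distrib_left mult.assoc)
          also have "\<dots> = (\<Sum>i\<in>insert j I. (g i (complex_act s z) - g i z) * f i z)"
            using h(2) by simp
          also have "\<dots> = (\<Sum>i\<in>insert j I. g i (complex_act s z) * f i (complex_act s z)) - (\<Sum>i\<in>insert j I. g i z * f i z)"
            unfolding sum_subtractf[symmetric]
            using f s S_subset by (intro sum.cong) (auto simp: invariant_act algebra_simps subset_iff)
          also have "\<dots> = 0"
            using fun_cong[OF less.prems(3), of z] fun_cong[OF less.prems(3), of "complex_act s z"]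
            by (simp only: sum_fun_apply times_fun_apply zero_fun_apply diff_self)
          finally show "(l * (\<Sum>i\<in>insert j I. h i * f i)) z = 0 z" by simp
        qed
        moreover have "(\<Sum>i\<in>insert j I. h i * f i) \<in> poly_fun"
          using h(1) f invariant_poly_fun by (intro poly_fun_sum poly_fun_mult) auto
        ultimately have h_syzygy: "(\<Sum>i\<in>insert j I. h i * f i) = 0"
          using poly_fun_no_zero_divisors[OF l] False by blast
        have "d - 1 < d" "poly_fun_le (d - 1) (h j)" using False h(3) by auto
        then have "h j \<in> fibre_ideal \<Lambda>"
          using h(1) h_syzygy by (rule less.IH[of "d - 1" h])
        then have "l * h j \<in> fibre_ideal \<Lambda>"
          using fibre_ideal_mult[OF _ l, of "h j" \<Lambda>] by (simp only: mult.commute)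
        then show ?thesis using h(2)[of j] by (simp add: times_fun_def)
      qed
    qed
    then have *: "average (g j) - g j \<in> fibre_ideal \<Lambda>"
      by (rule average_congruent_mod_fibre_ideal[OF act_congruent_mod_fibre_ideal[of "g j"]])
    have "(\<Sum>i\<in>insert j I. average (g i) * f i) = 0"
      by (rule average_syzygy[OF f less.prems(3)])
    then have "average (g j) * f j = (\<Sum>i\<in>I. - average (g i) * f i)"
      using I by (simp add: sum_negf eq_neg_iff_add_eq_0)
    then have "average (g j) \<Lambda> = 0"
      by (rule minimal[of "average (g j)" "\<lambda>i. - average (g i)", rotated 2])
         (intro invariants_uminus average_invariant less.prems(2); simp)+
    then have "average (g j) \<in> fibre_ideal \<Lambda>"
      using less.prems(2) by (intro fibre_ideal_invariant average_invariant) auto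
    from fibre_ideal_diff[OF this *] show ?case by simp
  qed
qed

text \<open>By induction on the number of terms. In a relation, each coefficient \<open>p j\<close> is generated by the others
over the local ring at \<open>\<Lambda>\<close>, for otherwise the preceding lemma, with the \<open>p i\<close> as the invariants and
the \<open>z i\<close> as their coefficients, would put \<open>z j\<close> into the ideal. Substituting for \<open>p j\<close> gives a
shorter relation.\<close>

lemma independent_over_invariants:
  assumes "finite I"
    and "\<And>i. i \<in> I \<Longrightarrow> z i \<in> poly_fun"
    and "independent_mod (fibre_ideal \<Lambda>) I z"
    and "\<And>i. i \<in> I \<Longrightarrow> p i \<in> invariants"
    and "(\<Sum>i\<in>I. z i * p i) = 0"
  shows "\<forall>i\<in>I. p i = 0"
  using assms
proof (induction I arbitrary: z rule: finite_induct)
  case (insert j I)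
  note z = insert.prems(1) and ind = insert.prems(2) and p = insert.prems(3) and rel = insert.prems(4)
  have "z j \<notin> fibre_ideal \<Lambda>"
  proof
    assume "z j \<in> fibre_ideal \<Lambda>"
    then have "(\<Sum>i\<in>insert j I. cscale (if i = j then 1 else 0) (z i)) \<in> fibre_ideal \<Lambda>"
      using insert.hyps fibre_ideal_zero
      by (simp add: cscale_def zero_fun_def[symmetric] if_distrib cong: if_cong sum.cong)
         (subst sum.neutral, auto)
    then show False using ind unfolding independent_mod_def by fastforce
  qed
  then obtain a b where a: "a \<in> invariants" "a \<Lambda> \<noteq> 0" and b: "\<And>i. i \<in> I \<Longrightarrow> b i \<in> invariants"
      and ab: "a * p j = (\<Sum>i\<in>I. b i * p i)"
    using syzygy_coefficient_in_fibre_ideal[of I j p z \<Lambda>] insert.hyps z p rel by blast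
  \<comment> \<open>\<open>a\<close> is invertible near \<open>\<Lambda>\<close>, so the relation eliminates \<open>p j\<close> at the cost of changing the \<open>z i\<close>\<close>
  define z' where "z' i = a * z i + b i * z j" for i
  have z': "z' i \<in> poly_fun" if "i \<in> I" for i
    using that z a b invariant_poly_fun by (auto simp: z'_def intro!: poly_fun_add poly_fun_mult)
  have "(\<Sum>i\<in>I. z' i * p i) = a * (\<Sum>i\<in>I. z i * p i) + z j * (\<Sum>i\<in>I. b i * p i)"
    by (simp add: z'_def sum_distrib_left sum.distrib[symmetric] algebra_simps)
  also have "\<dots> = a * (\<Sum>i\<in>insert j I. z i * p i)"
    using insert.hyps by (simp add: ab[symmetric] distrib_left mult_ac)
  finally have rel': "(\<Sum>i\<in>I. z' i * p i) = 0" by (simp only: rel mult_zero_right)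
  have "independent_mod (fibre_ideal \<Lambda>) I z'"
    unfolding independent_mod_def
  proof (intro allI impI)
    fix c assume c: "(\<Sum>i\<in>I. cscale (c i) (z' i)) \<in> fibre_ideal \<Lambda>"
    define e where "e = (\<Sum>i\<in>I. c i * b i \<Lambda>)"
    define c' where "c' i = (if i = j then e else c i * a \<Lambda>)" for i
    have d: "z' i - (cscale (a \<Lambda>) (z i) + cscale (b i \<Lambda>) (z j)) \<in> fibre_ideal \<Lambda>" if "i \<in> I" for i
      using fibre_ideal_add[OF fibre_ideal_base[OF a(1), of "z i" \<Lambda>] fibre_ideal_base[OF b[OF that], of "z j" \<Lambda>]] z that
      by (simp add: z'_def cscale_def plus_fun_def times_fun_def fun_diff_def algebra_simps)
    have "(\<Sum>i\<in>I. cscale (c i) (z' i)) - (\<Sum>i\<in>insert j I. cscale (c' i) (z i)) =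
        (\<Sum>i\<in>I. cscale (c i) (z' i - (cscale (a \<Lambda>) (z i) + cscale (b i \<Lambda>) (z j))))"
    proof
      fix x
      have "(\<Sum>i\<in>insert j I. c' i * z i x) = e * z j x + (\<Sum>i\<in>I. c i * a \<Lambda> * z i x)"
        using insert.hyps by (auto simp: c'_def intro!: sum.cong)
      then show "((\<Sum>i\<in>I. cscale (c i) (z' i)) - (\<Sum>i\<in>insert j I. cscale (c' i) (z i))) x =
        (\<Sum>i\<in>I. cscale (c i) (z' i - (cscale (a \<Lambda>) (z i) + cscale (b i \<Lambda>) (z j)))) x"
        by (simp only: minus_apply sum_fun_apply cscale_apply plus_fun_apply)
           (simp add: e_def algebra_simps sum.distrib sum_subtractf sum_distrib_left)
    qed
    also have "\<dots> \<in> fibre_ideal \<Lambda>" using d by (intro fibre_ideal_sum fibre_ideal_scale)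
    finally have "(\<Sum>i\<in>insert j I. cscale (c' i) (z i)) \<in> fibre_ideal \<Lambda>"
      using fibre_ideal_diff[OF c] by fastforce
    then have "\<forall>i\<in>insert j I. c' i = 0" using ind unfolding independent_mod_def by blast
    then show "\<forall>i\<in>I. c i = 0" using a(2) insert.hyps by (auto simp: c'_def split: if_splits)
  qed
  then have I0: "\<forall>i\<in>I. p i = 0"
    by (intro insert.IH[of z'] z' p rel') auto
  then have "a * p j = 0" using ab by simp
  moreover have "a \<noteq> 0" using a(2) by auto
  ultimately have "p j = 0"
    using poly_fun_no_zero_divisors[of a "p j"] a(1) p invariant_poly_fun by blast
  then show ?case using I0 by blast
qed simp

end


context finite_orthogonal_group
begin

text \<open>The trace form is nondegenerate: choose a point \<open>x\<close> with \<open>q x \<noteq> 0\<close> whose images under the members of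
\<open>K\<close> are distinct, and let \<open>h\<close> vanish at all these images except \<open>x\<close> itself. Then only one term of
the sum survives at \<open>x\<close>.\<close>

lemma separating_polynomial:
  assumes "q \<in> poly_fun" "q \<noteq> 0"
  shows "\<exists>h\<in>poly_fun. (\<Sum>k\<in>K. (\<lambda>z. (h * q) (complex_act k z))) \<noteq> 0"
proof -
  have moves: "\<exists>i. (\<lambda>z. complex_act k z $ i - z $ i) \<noteq> 0" if "k \<noteq> mat 1" for k :: "real^'n^'n"
  proof -
    obtain i where "k $ i \<noteq> (mat 1 :: real^'n^'n) $ i" using \<open>k \<noteq> mat 1\<close> vec_eq_iff[of k "mat 1"] by blast
    then obtain j where ij: "k $ i $ j \<noteq> (mat 1 :: real^'n^'n) $ i $ j"
      using vec_eq_iff[of "k $ i" "mat 1 $ i"] by blast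
    have "complex_act k (axis j 1) $ i = of_real (k $ i $ j)"
      by (simp add: complex_act_def matrix_vector_mult_def axis_def complex_matrix_def map_matrix_def
          if_distrib cong: if_cong)
    then have "complex_act k (axis j 1) $ i - axis j 1 $ i \<noteq> 0"
      using ij by (auto simp: mat_def axis_def split: if_splits)
    then have "(\<lambda>z. complex_act k z $ i - z $ i) \<noteq> 0"
      using zero_fun_apply[of "axis j (1::complex)"] by (intro notI) (drule fun_cong[of _ _ "axis j 1"], simp)
    then show ?thesis by (rule exI)
  qed
  define c where "c k = (SOME i. (\<lambda>z. complex_act k z $ i - z $ i) \<noteq> 0)" for k :: "real^'n^'n"
  have c: "(\<lambda>z. complex_act k z $ c k - z $ c k) \<noteq> 0" if "k \<noteq> mat 1" for k :: "real^'n^'n"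
    unfolding c_def by (rule someI_ex[OF moves[OF that]])
  \<comment> \<open>A point where \<open>F\<close> does not vanish is moved by each \<open>k \<noteq> 1\<close>, visibly in the coordinate \<open>c k\<close>.\<close>
  define F where "F = q * (\<Prod>k\<in>K - {mat 1}. (\<lambda>z. complex_act k z $ c k - z $ c k))"
  have pf: "(\<lambda>z. complex_act k z $ c k - z $ c k) \<in> poly_fun" for k
    using poly_fun_diff[OF poly_fun_complex_act[OF poly_fun_coord] poly_fun_coord, of k "c k" "c k"]
    by (simp add: fun_diff_def)
  have "(\<Prod>k\<in>K - {mat 1}. (\<lambda>z. complex_act k z $ c k - z $ c k)) \<noteq> 0"
    and "(\<Prod>k\<in>K - {mat 1}. (\<lambda>z. complex_act k z $ c k - z $ c k)) \<in> poly_fun"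
    by (rule poly_fun_prod_nonzero[OF finite_Diff[OF finite_K]], rule pf, use c in blast) (rule poly_fun_prod, rule pf)
  then have "F \<noteq> 0"
    using poly_fun_no_zero_divisors assms unfolding F_def by blast
  then obtain x where x: "F x \<noteq> 0" by (auto simp: fun_eq_iff)
  have prod_apply: "(\<Prod>k\<in>A. g k) y = (\<Prod>k\<in>A. g k y)"
    for g :: "real^'n^'n \<Rightarrow> complex^'n \<Rightarrow> complex" and A y
    by (induction A rule: infinite_finite_induct) auto
  have qx: "q x \<noteq> 0" and sep: "\<And>k. k \<in> K \<Longrightarrow> k \<noteq> mat 1 \<Longrightarrow> complex_act k x $ c k \<noteq> x $ c k"
    using x finite_K by (auto simp: F_def prod_apply)
  define h where "h = (\<Prod>k\<in>K - {mat 1}. (\<lambda>z. z $ c k - complex_act k x $ c k))"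
  have "h \<in> poly_fun"
    unfolding h_def using poly_fun_diff[OF poly_fun_coord poly_fun_const]
    by (intro poly_fun_prod) (simp add: fun_diff_def)
  moreover have "(\<Sum>k\<in>K. (\<lambda>z. (h * q) (complex_act k z))) x \<noteq> 0"
  proof -
    have "h (complex_act k x) = 0" if "k \<in> K - {mat 1}" for k
      using that finite_K by (auto simp: h_def prod_apply)
    then have "(\<Sum>k\<in>K. (h * q) (complex_act k x)) = (\<Sum>k\<in>{mat 1}. (h * q) (complex_act k x))"
      using finite_K one_mem by (intro sum.mono_neutral_right) auto
    also have "\<dots> \<noteq> 0" using sep[symmetric] qx finite_K by (auto simp: h_def prod_apply)
    finally show ?thesis by (simp add: sum_fun_apply)
  qed
  ultimately show ?thesis by (intro bexI[of _ h] notI) (drule fun_cong[of _ _ x], simp)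
qed

text \<open>The field of fractions of \<open>S\<close> has degree at most \<open>|K|\<close> over its \<open>K\<close>-fixed elements. As in Artin's
proof, one solves the relation and all its conjugates simultaneously and then takes traces; the
factor \<open>h\<close> prevents the trace from vanishing.\<close>

lemma dependent_over_invariants:
  assumes I: "finite I" "card K < card I" and z: "\<And>i. i \<in> I \<Longrightarrow> z i \<in> poly_fun"
  shows "\<exists>p. (\<forall>i\<in>I. p i \<in> invariants) \<and> (\<exists>i\<in>I. p i \<noteq> 0) \<and> (\<Sum>i\<in>I. z i * p i) = 0"
proof -
  have "\<exists>q. (\<forall>i\<in>I. q i \<in> poly_fun) \<and> (\<exists>i\<in>I. q i \<noteq> 0) \<and>
      (\<forall>k\<in>K. (\<Sum>i\<in>I. (\<lambda>x. z i (complex_act k x)) * q i) = 0)"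
    using finite_K I z
    by (intro underdetermined_system_solvable poly_fun_zero poly_fun_one poly_fun_add poly_fun_mult
          poly_fun_uminus poly_fun_no_zero_divisors poly_fun_complex_act) auto
  then obtain q j where q: "\<And>i. i \<in> I \<Longrightarrow> q i \<in> poly_fun" and j: "j \<in> I" "q j \<noteq> 0"
    and sol: "\<And>k. k \<in> K \<Longrightarrow> (\<Sum>i\<in>I. (\<lambda>x. z i (complex_act k x)) * q i) = 0" by blast
  obtain h where h: "h \<in> poly_fun" "(\<Sum>k\<in>K. (\<lambda>z. (h * q j) (complex_act k z))) \<noteq> 0"
    using separating_polynomial[OF q[OF j(1)] j(2)] by blast
  define p where "p i = (\<Sum>k\<in>K. (\<lambda>z. (h * q i) (complex_act k z)))" for i
  have "p i \<in> invariants" if "i \<in> I" for i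
    unfolding p_def using h q that by (intro orbit_sum_invariant poly_fun_mult)
  moreover have "p j \<noteq> 0" using h(2) by (simp only: p_def not_False_eq_True)
  moreover have "(\<Sum>i\<in>I. z i * p i) = 0"
  proof
    fix x
    have "(\<Sum>i\<in>I. z i x * q i (complex_act k x)) = 0" if k: "k \<in> K" for k
      using fun_cong[OF sol[OF transpose_mem[OF k]], of "complex_act k x"] k
      by (simp add: sum_fun_apply)
    then have "(\<Sum>k\<in>K. h (complex_act k x) * (\<Sum>i\<in>I. z i x * q i (complex_act k x))) = 0"
      by simp
    also have "(\<Sum>k\<in>K. h (complex_act k x) * (\<Sum>i\<in>I. z i x * q i (complex_act k x))) =
        (\<Sum>i\<in>I. z i x * p i x)"
      unfolding p_def by (simp add: sum_fun_apply sum_distrib_left mult_ac) (rule sum.swap)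
    finally show "(\<Sum>i\<in>I. z i * p i) x = 0 x" by (simp add: sum_fun_apply)
  qed
  ultimately show ?thesis using j(1) by blast
qed

end

context reflection_generated_group
begin

lemma dependent_mod_fibre_ideal:
  assumes "finite I" "card K < card I" "\<And>i. i \<in> I \<Longrightarrow> z i \<in> poly_fun"
  shows "\<not> independent_mod (fibre_ideal \<Lambda>) I z"
proof
  assume ind: "independent_mod (fibre_ideal \<Lambda>) I z"
  obtain p where p: "\<forall>i\<in>I. p i \<in> invariants" "\<exists>i\<in>I. p i \<noteq> 0" "(\<Sum>i\<in>I. z i * p i) = 0"
    using dependent_over_invariants[of I z] assms by blast
  have "\<forall>i\<in>I. p i = 0"
    by (rule independent_over_invariants[of I z \<Lambda> p]) (use assms ind p in blast)+
  then show False using p(2) by blast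
qed

text \<open>The powers \<open>1, z\<^sub>i, z\<^sub>i\<^sup>2, \<dots>\<close> up to the exponent \<open>|K|\<close> are too many to be independent modulo the ideal.\<close>

lemma fibre_ideal_contains_univariate:
  "\<exists>p. p \<noteq> 0 \<and> (\<lambda>z. poly p (z $ i)) \<in> fibre_ideal \<Lambda>"
proof -
  have "\<not> independent_mod (fibre_ideal \<Lambda>) {..card K} (\<lambda>j z. (z $ i) ^ j)"
  proof (rule dependent_mod_fibre_ideal)
    fix j
    have "(\<lambda>z. z $ i) ^ j = (\<lambda>z::complex^'n. (z $ i) ^ j)"
      by (induction j) (auto simp: fun_eq_iff)
    then show "(\<lambda>z::complex^'n. (z $ i) ^ j) \<in> poly_fun"
      using poly_fun_power[OF poly_fun_coord] by metis
  qed auto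
  then obtain c where c: "(\<Sum>j\<le>card K. cscale (c j) (\<lambda>z. (z $ i) ^ j)) \<in> fibre_ideal \<Lambda>"
      "\<exists>j\<le>card K. c j \<noteq> 0"
    by (auto simp: independent_mod_def)
  define p where "p = (\<Sum>j\<le>card K. monom (c j) j)"
  have "coeff p j = c j" if "j \<le> card K" for j
    using that by (simp add: p_def coeff_sum)
  then have "p \<noteq> 0" using c(2) by auto
  moreover have "(\<lambda>z. poly p (z $ i)) = (\<Sum>j\<le>card K. cscale (c j) (\<lambda>z. (z $ i) ^ j))"
    by (simp add: fun_eq_iff p_def poly_sum poly_monom sum_fun_apply)
  ultimately show ?thesis using c(1) by (intro exI[of _ p]) simp
qed

text \<open>The set \<open>Z\<close> extends a basis of the ideal to one of the whole ring.\<close>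

lemma fibre_ideal_codim_le:
  "\<exists>Z. finite Z \<and> card Z \<le> card K \<and> Z \<subseteq> poly_fun \<and> poly_fun \<subseteq> cfun.span (Z \<union> fibre_ideal \<Lambda>)"
proof -
  let ?J = "fibre_ideal \<Lambda>"
  obtain BJ where BJ: "BJ \<subseteq> ?J" "cfun.independent BJ" "?J \<subseteq> cfun.span BJ"
    using cfun.maximal_independent_subset by blast
  have "BJ \<subseteq> poly_fun" using BJ(1) fibre_ideal_subset by blast
  then obtain B where B: "BJ \<subseteq> B" "B \<subseteq> poly_fun" "cfun.independent B" "poly_fun \<subseteq> cfun.span B"
    using cfun.maximal_independent_subset_extend[OF _ BJ(2)] by blast
  define Z where "Z = B - BJ"
  have ind: "independent_mod ?J I (\<lambda>x. x)" if I: "finite I" "I \<subseteq> Z" for I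
    unfolding independent_mod_def
  proof (intro allI impI ballI, rule ccontr)
    fix c i assume c: "(\<Sum>x\<in>I. cscale (c x) x) \<in> ?J" and i: "i \<in> I" "c i \<noteq> 0"
    have all: "(\<Sum>x\<in>I. cscale (c x) x) \<in> cfun.span (B - {i})"
      using c BJ(3) cfun.span_mono[of BJ "B - {i}"] B(1) i I(2) by (auto simp: Z_def)
    have others: "(\<Sum>x\<in>I - {i}. cscale (c x) x) \<in> cfun.span (B - {i})"
      using I(2) by (intro cfun.span_sum cfun.span_scale cfun.span_base) (auto simp: Z_def)
    have "(\<Sum>x\<in>I. cscale (c x) x) = cscale (c i) i + (\<Sum>x\<in>I - {i}. cscale (c x) x)"
      using I i by (simp add: sum.remove)
    then have "cscale (c i) i \<in> cfun.span (B - {i})"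
      using cfun.span_diff[OF all others] by (simp only: add_diff_cancel_right')
    then have "cscale (inverse (c i)) (cscale (c i) i) \<in> cfun.span (B - {i})"
      by (rule cfun.span_scale)
    then have "i \<in> cfun.span (B - {i})" using i(2) by (simp add: cscale_def mult.assoc[symmetric])
    then show False using B(3) i I(2) unfolding cfun.dependent_def Z_def by blast
  qed
  have "finite Z \<and> card Z \<le> card K"
  proof (rule ccontr)
    assume "\<not> ?thesis"
    then obtain I where "I \<subseteq> Z" "card I = Suc (card K)" "finite I"
      by (metis Suc_leI infinite_arbitrarily_large not_le obtain_subset_with_card_n)
    then show False
      using ind[of I] dependent_mod_fibre_ideal[of I "\<lambda>x. x" \<Lambda>] B(2) by (auto simp: Z_def)
  qed
  moreover have "B \<subseteq> Z \<union> ?J" using BJ(1) by (auto simp: Z_def)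
  then have "poly_fun \<subseteq> cfun.span (Z \<union> ?J)" using B(4) cfun.span_mono by blast
  ultimately show ?thesis using B(2) by (intro exI[of _ Z]) (auto simp: Z_def)
qed

end

section \<open>Orthogonal pseudo-reflections\<close>

text \<open>Used for the top coefficient of a characteristic polynomial, whose Leibniz expansion consists of
such products.\<close>

lemma coeff_prod_degree_le_1:
  fixes q :: "'i \<Rightarrow> 'r::comm_semiring_1 poly"
  assumes "finite I" "\<And>i. i \<in> I \<Longrightarrow> degree (q i) \<le> 1"
  shows "coeff (prod q I) (card I) = (\<Prod>i\<in>I. coeff (q i) 1) \<and> degree (prod q I) \<le> card I"
  using assms
proof (induction I rule: finite_induct)
  case (insert i I)
  have q: "degree (q i) \<le> 1" and IH: "coeff (prod q I) (card I) = (\<Prod>i\<in>I. coeff (q i) 1)"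
    "degree (prod q I) \<le> card I" using insert by auto
  have "coeff (q i * prod q I) (1 + card I) = coeff (q i) 1 * coeff (prod q I) (card I)"
  proof -
    have "q i = [:coeff (q i) 0, coeff (q i) 1:]"
      using q by (intro poly_eqI) (auto simp: coeff_pCons coeff_eq_0 split: nat.split)
    moreover have "coeff [:a, b:] 1 = b" "coeff ([:a, b:] * p) (Suc m) = a * coeff p (Suc m) + b * coeff p m"
      for a b :: 'r and p m by simp_all
    moreover have "coeff (prod q I) (Suc (card I)) = 0" using IH(2) by (intro coeff_eq_0) simp
    ultimately show ?thesis by (metis add_0 mult_zero_right plus_1_eq_Suc)
  qed
  moreover have "degree (q i * prod q I) \<le> 1 + card I"
    using degree_mult_le[of "q i" "prod q I"] q IH(2) by linarith
  ultimately show ?case using insert.hyps IH(1) by simp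
qed simp

lemma degree_charpoly_ge: "CARD('n) \<le> degree (charpoly (A :: complex^'n^'n))"
proof -
  define M where "M = mat [:0, 1:] - map_matrix (\<lambda>a. [:a:]) A"
  have M: "degree (M $ i $ j) \<le> 1" "coeff (M $ i $ j) 1 = (mat 1 :: complex^'n^'n) $ i $ j" for i j
    by (auto simp: M_def mat_def map_matrix_def)
  have "coeff (charpoly A) CARD('n) =
      (\<Sum>p | p permutes UNIV. coeff (of_int (sign p) * (\<Prod>i\<in>UNIV. M $ i $ p i)) CARD('n))"
    by (simp add: charpoly_def det_def M_def coeff_sum)
  also have "\<dots> = (\<Sum>p | p permutes UNIV. of_int (sign p) * (\<Prod>i\<in>UNIV. (mat 1 :: complex^'n^'n) $ i $ p i))"
  proof (intro sum.cong refl)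
    fix p :: "'n \<Rightarrow> 'n"
    have "coeff (\<Prod>i\<in>UNIV. M $ i $ p i) CARD('n) = (\<Prod>i\<in>UNIV. (mat 1 :: complex^'n^'n) $ i $ p i)"
      using coeff_prod_degree_le_1[of UNIV "\<lambda>i. M $ i $ p i"] M by simp
    then show "coeff (of_int (sign p) * (\<Prod>i\<in>UNIV. M $ i $ p i)) CARD('n) =
        of_int (sign p) * (\<Prod>i\<in>UNIV. (mat 1 :: complex^'n^'n) $ i $ p i)"
      by (cases p rule: sign_cases) simp_all
  qed
  also have "\<dots> = det (mat 1 :: complex^'n^'n)" by (simp add: det_def)
  finally show ?thesis by (intro le_degree) simp
qed

lemma poly_charpoly_of_real:
  fixes s :: "real^'n^'n"
  shows "poly (charpoly (complex_matrix s)) (of_real x) = of_real (det (mat x - s))"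
proof -
  have "poly (of_int (sign p) * (\<Prod>i\<in>UNIV. (mat [:0, 1:] - map_matrix (\<lambda>a. [:a:]) (complex_matrix s)) $ i $ p i)) (of_real x)
     = of_real (of_int (sign p) * (\<Prod>i\<in>UNIV. (mat x - s) $ i $ p i))" for p
  proof -
    have "poly ((mat [:0, 1:] - map_matrix (\<lambda>a. [:a:]) (complex_matrix s)) $ i $ j) (of_real x) = of_real ((mat x - s) $ i $ j)" for i j
      by (simp add: mat_def map_matrix_def complex_matrix_def)
    then show ?thesis by (cases p rule: sign_cases) (simp_all add: poly_prod)
  qed
  then show ?thesis by (simp add: charpoly_def det_def poly_sum)
qed

text \<open>For an orthogonal matrix the algebraic multiplicity of the eigenvalue \<open>1\<close> does not exceed the
geometric one. With the basis \<open>b\<close> as the columns of \<open>P\<close>, the rows of \<open>P\<^sup>T (x - s) P\<close> with index in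
\<open>A\<close> are divisible by \<open>x - 1\<close>, because \<open>s\<^sup>T b\<^sub>i = b\<^sub>i\<close> for fixed vectors \<open>b\<^sub>i\<close>. After division the matrix \<open>C x\<close> is
nonsingular at \<open>x = 1\<close>: a vector in the kernel of \<open>C 1\<close> would give a nonzero fixed vector of \<open>s\<close>
orthogonal to all fixed vectors.\<close>

lemma orthogonal_matrix_fixed_multiplicity:
  fixes s :: "real^'n^'n" and b :: "'n \<Rightarrow> real^'n"
  assumes s: "orthogonal_matrix s"
    and b: "inj b" "independent (range b)" "span (range b) = UNIV"
    and fixed: "\<And>i. i \<in> A \<Longrightarrow> s *v b i = b i" and A: "{x. s *v x = x} \<subseteq> span (b ` A)"
  shows "Polynomial.order 1 (charpoly (complex_matrix s)) \<le> card A"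
proof (rule ccontr)
  assume "\<not> ?thesis"
  then have "[:-1, 1:] ^ Suc (card A) dvd charpoly (complex_matrix s)"
    by (subst order_divides) auto
  then obtain w where w: "charpoly (complex_matrix s) = [:-1, 1:] ^ Suc (card A) * w" by (elim dvdE)
  define P where "P = (\<chi> i j. b j $ i)"
  define C where "C x = (\<chi> i. if i \<in> A then \<chi> j. b i \<bullet> b j else \<chi> j. x * (b i \<bullet> b j) - b i \<bullet> (s *v b j))" for x
  have trans: "b i \<bullet> (s *v y) = b i \<bullet> y" if "i \<in> A" for i y
  proof -
    have "transpose s *v b i = b i"
      using fixed[OF that] s by (metis matrix_vector_mul_assoc matrix_vector_mul_lid orthogonal_matrix_def)
    then show ?thesis by (metis dot_lmul_matrix transpose_matrix_vector)
  qed
  have Pv: "P *v v = (\<Sum>j\<in>UNIV. v $ j *\<^sub>R b j)" for v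
    by (simp add: P_def matrix_vector_mult_def vec_eq_iff mult.commute)
  have det_eq: "det P ^ 2 * det (mat x - s) = (x - 1) ^ card A * det (C x)" for x
  proof -
    have "transpose P ** ((mat x - s) ** P) = (\<chi> i. (if i \<in> A then x - 1 else 1) *s C x $ i)"
    proof -
      have "((mat x - s) ** P) $ k $ j = x * b j $ k - (s *v b j) $ k" for k j
      proof -
        have "((mat x - s) ** P) $ k $ j = (\<Sum>l\<in>UNIV. (if k = l then x * b j $ l else 0) - s $ k $ l * b j $ l)"
          by (auto simp: P_def matrix_matrix_mult_def mat_def algebra_simps intro!: sum.cong)
        then show ?thesis by (simp add: sum_subtractf matrix_vector_mult_def)
      qed
      then have "(transpose P ** ((mat x - s) ** P)) $ i $ j = x * (b i \<bullet> b j) - b i \<bullet> (s *v b j)" for i j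
        by (simp add: matrix_matrix_mult_def transpose_def P_def inner_vec_def right_diff_distrib sum_subtractf
            sum_distrib_left mult_ac)
      then show ?thesis by (auto simp: vec_eq_iff C_def trans left_diff_distrib)
    qed
    then have "det (transpose P ** ((mat x - s) ** P)) = (\<Prod>i\<in>UNIV. if i \<in> A then x - 1 else 1) * det (C x)"
      by (simp add: det_rows_mul)
    also have "(\<Prod>i\<in>UNIV. if i \<in> A then x - 1 else 1) = (x - 1) ^ card A"
      by (simp add: prod.If_cases)
    finally show ?thesis by (simp add: det_mul power2_eq_square mult_ac)
  qed
  have ne: "of_real (det (C x)) = of_real ((det P)^2 * (x - 1)) * poly w (of_real x)" if "x \<noteq> 1" for x
  proof -
    have "of_real ((x - 1) ^ card A) * (of_real (det (C x)) :: complex) = of_real (det P ^ 2 * det (mat x - s))"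
      by (simp only: det_eq of_real_mult)
    also have "\<dots> = of_real ((x - 1) ^ card A) * (of_real ((det P)^2 * (x - 1)) * poly w (of_real x))"
    proof -
      have "complex_of_real (det (mat x - s)) = of_real (x - 1) ^ Suc (card A) * poly w (of_real x)"
        unfolding poly_charpoly_of_real[symmetric] w by (simp add: poly_power algebra_simps)
      then show ?thesis by (simp only: of_real_mult of_real_power power_Suc mult_ac)
    qed
    finally show ?thesis using that by simp
  qed
  have "det (C 1) = 0"
  proof -
    have C_cont: "((\<lambda>x. C x $ i $ j) \<longlongrightarrow> C 1 $ i $ j) (at 1)" for i j
      by (cases "i \<in> A") (auto simp: C_def intro!: tendsto_eq_intros)
    have "((\<lambda>x. det (C x)) \<longlongrightarrow> det (C 1)) (at 1)"
      unfolding det_def by (intro tendsto_intros C_cont)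
    then have "((\<lambda>x. complex_of_real (det (C x))) \<longlongrightarrow> of_real (det (C 1))) (at 1)"
      by (rule tendsto_of_real)
    moreover have "((\<lambda>x. of_real ((det P)^2 * (x - 1)) * poly w (of_real x)) \<longlongrightarrow> 0) (at (1::real))"
      by (auto intro!: tendsto_eq_intros)
    then have "((\<lambda>x. complex_of_real (det (C x))) \<longlongrightarrow> 0) (at 1)"
      by (rule Lim_transform_eventually) (auto simp: eventually_at_filter ne)
    ultimately have "complex_of_real (det (C 1)) = 0" using tendsto_unique trivial_limit_at by blast
    then show ?thesis by simp
  qed
  then obtain v where v: "C 1 *v v = 0" "v \<noteq> 0"
    by (metis invertible_det_nz invertible_left_inverse matrix_left_invertible_ker)
  define y where "y = P *v v"
  have bil: "(\<Sum>j\<in>UNIV. b i \<bullet> b j * v $ j) = b i \<bullet> y"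
    "(\<Sum>j\<in>UNIV. b i \<bullet> (s *v b j) * v $ j) = b i \<bullet> (s *v y)" for i
    by (simp_all add: y_def Pv inner_sum_right linear_sum[OF matrix_vector_mul_linear] mult.commute
        matrix_vector_mult_scaleR)
  have C_row: "(\<Sum>j\<in>UNIV. C 1 $ i $ j * v $ j) = 0" for i :: 'n
    using arg_cong[OF v(1), of "\<lambda>u. u $ i"] by (simp add: matrix_vector_mult_def)
  have rows: "(if i \<in> A then b i \<bullet> y else b i \<bullet> y - b i \<bullet> (s *v y)) = 0" for i
    using C_row[of i] bil[of i] by (cases "i \<in> A") (auto simp: C_def left_diff_distrib sum_subtractf)
  have orth: "b i \<bullet> y = 0" if "i \<in> A" for i
    using rows[of i] that by simp
  have "orthogonal (y - s *v y) (b i)" for i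
    unfolding orthogonal_def
    using rows[of i] trans[of i y] by (subst inner_commute) (auto simp: inner_diff_right split: if_splits)
  then have "orthogonal (y - s *v y) (y - s *v y)"
    using orthogonal_to_span[of "y - s *v y" "range b" "y - s *v y"] b(3) by force
  then have "s *v y = y" unfolding orthogonal_def inner_eq_zero_iff by simp
  then have "y \<in> span (b ` A)" using A by auto
  moreover have "orthogonal y u" if "u \<in> b ` A" for u
    using that orth inner_commute[of y] by (auto simp: orthogonal_def)
  ultimately have "y \<bullet> y = 0" using orthogonal_to_span unfolding orthogonal_def by blast
  then have "(\<Sum>j\<in>UNIV. v $ j *\<^sub>R b j) = 0" by (simp add: y_def Pv)
  then have "(\<Sum>u\<in>range b. v $ inv_into UNIV b u *\<^sub>R u) = 0"
    using b(1) by (simp add: sum.reindex)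
  then have "v $ inv_into UNIV b (b j) = 0" for j
    using independentD[OF b(2), of "range b" "\<lambda>u. v $ inv_into UNIV b u" "b j"] by simp
  then show False using v(2) b(1) by (simp add: vec_eq_iff)
qed

text \<open>The pseudo-reflection condition counts eigenvalues with algebraic multiplicity; by the preceding
lemma it bounds the codimension of the fixed space by one. So a basis of the fixed space misses at
most one vector \<open>u\<close> of a basis of the whole space, and \<open>s u - u\<close> spans the range of \<open>s - 1\<close>.\<close>

lemma orthogonal_pseudo_reflection_rank_one:
  fixes s :: "real^'n^'n"
  assumes "orthogonal_matrix s" "pseudo_reflection s"
  shows "\<exists>v a. \<forall>x. s *v x = x + (a \<bullet> x) *s v"
proof -
  define F where "F = {x. s *v x = x}"
  obtain BF where BF: "BF \<subseteq> F" "independent BF" "F \<subseteq> span BF"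
    using maximal_independent_subset by blast
  obtain B where B: "BF \<subseteq> B" "independent B" "UNIV \<subseteq> span B"
    by (rule maximal_independent_subset_extend[OF subset_UNIV BF(2)])
  then have B_UNIV: "span B = UNIV" by (simp only: top.extremum_uniqueI)
  have "card B = CARD('n)"
    using dim_eq_card[of B UNIV] B B_UNIV by simp
  moreover have finB: "finite B" using B(2) by (rule finiteI_independent)
  ultimately obtain b where b: "bij_betw b (UNIV :: 'n set) B"
    using finite_same_card_bij[of "UNIV :: 'n set" B] by auto
  define A where "A = b -` BF"
  have bA: "b ` A = BF" using b B(1) by (auto simp: A_def bij_betw_def)
  have inj: "inj b" and range: "range b = B" using b by (auto simp: bij_betw_def)
  have "Polynomial.order 1 (charpoly (complex_matrix s)) \<le> card A"
    using assms(1) inj B B_UNIV BF bA by (intro orthogonal_matrix_fixed_multiplicity[where b = b])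
      (auto simp: range F_def A_def)
  moreover have "card A = card BF" using bA inj card_image by (metis inj_on_subset subset_UNIV)
  moreover have "Polynomial.order 1 (charpoly (complex_matrix s)) + 1 \<ge> CARD('n)"
  proof -
    let ?E = "eigenvalues (complex_matrix s)"
    have nz: "charpoly (complex_matrix s) \<noteq> 0" using degree_charpoly_ge[of "complex_matrix s"] by auto
    have "size ?E = size {#z \<in># ?E. z = 1#} + size {#z \<in># ?E. z \<noteq> 1#}"
      by (metis multiset_partition size_union)
    also have "size {#z \<in># ?E. z = 1#} = Polynomial.order 1 (charpoly (complex_matrix s))"
      using nz by (simp add: filter_eq_replicate_mset eigenvalues_def)
    finally show ?thesis
      using degree_charpoly_ge[of "complex_matrix s"] assms(2)
      by (simp add: pseudo_reflection_def eigenvalues_def size_proots_complex)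
  qed
  ultimately have "card (B - BF) \<le> 1"
    using \<open>card B = CARD('n)\<close> finB B(1) card_Diff_subset[of BF B] finite_subset[of BF B] by simp
  then have single: "\<forall>x\<in>B - BF. \<forall>y\<in>B - BF. x = y"
    using card_le_Suc0_iff_eq[of "B - BF"] finB by simp
  obtain u where u: "B \<subseteq> insert u BF"
    using single by (cases "B - BF = {}") blast+
  define v where "v = s *v u - u"
  have "s *v x - x \<in> span {v}" for x
  proof -
    have "x \<in> span B" using B_UNIV by simp
    then show ?thesis
    proof (rule span_induct)
      show "subspace {x. s *v x - x \<in> span {v}}"
      proof (rule subspaceI; clarify)
        show "s *v 0 - 0 \<in> span {v}" by (simp add: span_zero)
        show "s *v (x + y) - (x + y) \<in> span {v}" if "s *v x - x \<in> span {v}" "s *v y - y \<in> span {v}" for x y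
          using span_add[OF that] by (simp add: matrix_vector_right_distrib algebra_simps)
        show "s *v (c *\<^sub>R x) - c *\<^sub>R x \<in> span {v}" if "s *v x - x \<in> span {v}" for c x
          using span_scale[OF that, of c] by (simp add: matrix_vector_mult_scaleR scaleR_diff_right)
      qed
      show "x \<in> B \<Longrightarrow> s *v x - x \<in> span {v}" for x
        using u BF(1) by (cases "x = u") (auto simp: F_def v_def span_zero span_base)
    qed
  qed
  then have k: "\<exists>k. s *v x - x = k *\<^sub>R v" for x by (auto simp: span_singleton)
  define a where "a = (1 / (v \<bullet> v)) *\<^sub>R (transpose s *v v - v)"
  have "s *v x = x + (a \<bullet> x) *s v" for x
  proof -
    obtain k where k: "s *v x - x = k *\<^sub>R v" using k by blast
    show ?thesis
    proof (cases "v = 0")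
      case True
      then show ?thesis using k by simp
    next
      case False
      have "(transpose s *v v) \<bullet> x = v \<bullet> (s *v x)"
        by (simp add: dot_lmul_matrix)
      then have "a \<bullet> x = (v \<bullet> (s *v x - x)) / (v \<bullet> v)"
        by (simp add: a_def inner_diff_left inner_diff_right)
      also have "\<dots> = k" using k False by simp
      finally show ?thesis using k by (simp add: scalar_mult_eq_scaleR algebra_simps)
    qed
  qed
  then show ?thesis by blast
qed


section \<open>Independence of multiplicative functions\<close>

text \<open>Dedekind's argument: \<open>f (x \<cdot> y) - \<psi>\<^sub>0 y f x\<close> eliminates the character \<open>\<psi>\<^sub>0\<close> and multiplies the
coefficient of any other \<open>\<psi>\<close> by \<open>\<psi> y - \<psi>\<^sub>0 y\<close>, which is nonzero for some \<open>y\<close>. Allowing an invariant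
subspace \<open>W\<close> instead of \<open>{0}\<close> makes the lemma yield the irreducibility of the generic eigenspaces
as well as the linear independence of characters.\<close>

lemma multiplicative_components_in_subspace:
  fixes opr :: "'a \<Rightarrow> 'a \<Rightarrow> 'a"
  assumes "finite X"
    and multiplicative: "\<And>\<psi> x y. \<psi> \<in> X \<Longrightarrow> \<psi> (opr x y) = \<psi> x * \<psi> y"
    and W: "cfun.subspace W" and shift: "\<And>f y. f \<in> W \<Longrightarrow> (\<lambda>x. f (opr x y)) \<in> W"
    and "(\<Sum>\<psi>\<in>X. cscale (c \<psi>) \<psi>) \<in> W"
  shows "\<forall>\<psi>\<in>X. cscale (c \<psi>) \<psi> \<in> W"
  using assms(1,2,5)
proof (induction X arbitrary: c rule: finite_induct)
  case (insert \<psi>\<^sub>0 X)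
  let ?f = "\<Sum>\<psi>\<in>insert \<psi>\<^sub>0 X. cscale (c \<psi>) \<psi>"
  have others: "cscale (c \<psi>) \<psi> \<in> W" if \<psi>: "\<psi> \<in> X" for \<psi>
  proof -
    have "\<psi> \<noteq> \<psi>\<^sub>0" using \<psi> insert.hyps by blast
    then obtain y where y: "\<psi> y - \<psi>\<^sub>0 y \<noteq> 0" by (auto simp: fun_eq_iff)
    have "(\<lambda>x. ?f (opr x y)) - cscale (\<psi>\<^sub>0 y) ?f \<in> W"
      by (intro cfun.subspace_diff[OF W] cfun.subspace_scale[OF W] shift insert.prems)
    also have "(\<lambda>x. ?f (opr x y)) - cscale (\<psi>\<^sub>0 y) ?f = (\<Sum>\<psi>\<in>X. cscale (c \<psi> * (\<psi> y - \<psi>\<^sub>0 y)) \<psi>)"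
    proof
      fix x
      have "(\<Sum>\<psi>\<in>X. c \<psi> * \<psi> (opr x y)) = (\<Sum>\<psi>\<in>X. c \<psi> * (\<psi> x * \<psi> y))"
        using insert.prems(1) by (intro sum.cong) auto
      then show "((\<lambda>x. ?f (opr x y)) - cscale (\<psi>\<^sub>0 y) ?f) x = (\<Sum>\<psi>\<in>X. cscale (c \<psi> * (\<psi> y - \<psi>\<^sub>0 y)) \<psi>) x"
        using insert.hyps insert.prems(1)[of \<psi>\<^sub>0 x y]
        by (simp add: sum_fun_apply sum_distrib_left algebra_simps sum_subtractf)
    qed
    finally have "\<forall>\<psi>\<in>X. cscale (c \<psi> * (\<psi> y - \<psi>\<^sub>0 y)) \<psi> \<in> W"
      using insert.IH[of "\<lambda>\<psi>. c \<psi> * (\<psi> y - \<psi>\<^sub>0 y)"] insert.prems(1) by blast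
    then have "cscale (inverse (\<psi> y - \<psi>\<^sub>0 y)) (cscale (c \<psi> * (\<psi> y - \<psi>\<^sub>0 y)) \<psi>) \<in> W"
      using \<psi> by (blast intro: cfun.subspace_scale[OF W])
    also have "cscale (inverse (\<psi> y - \<psi>\<^sub>0 y)) (cscale (c \<psi> * (\<psi> y - \<psi>\<^sub>0 y)) \<psi>) = cscale (c \<psi>) \<psi>"
      using y by (simp add: fun_eq_iff)
    finally show ?thesis .
  qed
  then have "?f - (\<Sum>\<psi>\<in>X. cscale (c \<psi>) \<psi>) \<in> W"
    by (intro cfun.subspace_diff[OF W] cfun.subspace_sum[OF W] insert.prems)
  then have "cscale (c \<psi>\<^sub>0) \<psi>\<^sub>0 \<in> W" using insert.hyps by simp
  then show ?case using others by blast
qed simp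

lemma multiplicative_functions_independent:
  fixes opr :: "'a \<Rightarrow> 'a \<Rightarrow> 'a"
  assumes "finite X"
    and "\<And>\<psi> x y. \<psi> \<in> X \<Longrightarrow> \<psi> (opr x y) = \<psi> x * \<psi> y"
    and nonzero: "\<And>\<psi>. \<psi> \<in> X \<Longrightarrow> \<psi> \<noteq> 0"
    and "(\<Sum>\<psi>\<in>X. cscale (c \<psi>) \<psi>) = 0" and "\<psi> \<in> X"
  shows "c \<psi> = 0"
proof -
  have "\<forall>\<psi>\<in>X. cscale (c \<psi>) \<psi> \<in> {0}"
    by (rule multiplicative_components_in_subspace[where opr = opr]) (use assms in \<open>auto simp: fun_eq_iff\<close>)
  then have "cscale (c \<psi>) \<psi> = 0" using assms(5) by blast
  then show ?thesis using nonzero[OF assms(5)] by (metis cfun.scale_eq_0_iff)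
qed

section \<open>Polynomials and polynomial functions\<close>

abbreviation lookup where "lookup \<equiv> Poly_Mapping.lookup"
abbreviation keys where "keys \<equiv> Poly_Mapping.keys"
abbreviation single where "single \<equiv> Poly_Mapping.single"

definition monomial_fun :: "('n::finite \<Rightarrow>\<^sub>0 nat) \<Rightarrow> complex^'n \<Rightarrow> complex" where
  "monomial_fun m z = (\<Prod>i\<in>UNIV. (z $ i) ^ lookup m i)"

lemma sum_keys_superset:
  fixes P :: "'a \<Rightarrow>\<^sub>0 complex"
  assumes "finite S" "keys P \<subseteq> S"
  shows "(\<Sum>m\<in>keys P. lookup P m * g m) = (\<Sum>m\<in>S. lookup P m * g m)"
  using assms by (intro sum.mono_neutral_left) (auto simp: in_keys_iff)

lemma sum_keys_add:
  fixes P Q :: "'a \<Rightarrow>\<^sub>0 complex"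
  shows "(\<Sum>m\<in>keys (P + Q). lookup (P + Q) m * g m) =
    (\<Sum>m\<in>keys P. lookup P m * g m) + (\<Sum>m\<in>keys Q. lookup Q m * g m)"
proof -
  let ?S = "keys P \<union> keys Q"
  have S: "finite ?S" "keys (P + Q) \<subseteq> ?S" "keys P \<subseteq> ?S" "keys Q \<subseteq> ?S"
    using Poly_Mapping.keys_add[of P Q] by auto
  show ?thesis
    unfolding sum_keys_superset[OF S(1,2)] sum_keys_superset[OF S(1,3)] sum_keys_superset[OF S(1,4)]
    by (simp add: lookup_add distrib_right sum.distrib)
qed

lemma sum_keys_single:
  "(\<Sum>m\<in>keys (single k c). lookup (single k c) m * g m) = c * g k" for c :: complex
  by (cases "c = 0") auto

lemma poly_eval_eq: "poly_eval P z = (\<Sum>m\<in>keys P. lookup P m * monomial_fun m z)"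
  by (simp add: poly_eval_def monomial_fun_def)

lemma poly_eval_add: "poly_eval (P + Q) = poly_eval P + poly_eval Q"
  by (rule ext) (simp add: poly_eval_eq sum_keys_add)

lemma poly_eval_single: "poly_eval (single m c) = cscale c (monomial_fun m)"
  by (rule ext) (simp only: poly_eval_eq sum_keys_single cscale_apply)

lemma sum_singles: "(\<Sum>m\<in>keys P. single m (lookup P m)) = P" for P :: "'a \<Rightarrow>\<^sub>0 complex"
  by (rule poly_mapping_eqI) (simp add: lookup_sum lookup_single when_def in_keys_iff)

lemma cpoly_induct [case_names single add]:
  fixes P :: "'a \<Rightarrow>\<^sub>0 complex"
  assumes "\<And>m c. \<Phi> (single m c)" "\<And>P Q. \<Phi> P \<Longrightarrow> \<Phi> Q \<Longrightarrow> \<Phi> (P + Q)"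
  shows "\<Phi> P"
proof -
  have "\<Phi> (\<Sum>m\<in>S. single m (lookup P m))" if "finite S" for S
    using that assms(1)[of undefined 0]
    by (induction S rule: finite_induct) (auto intro: assms)
  then show ?thesis using sum_singles[of P] by (metis finite_keys)
qed

lemma monomial_fun_add: "monomial_fun (m + m') = monomial_fun m * monomial_fun m'"
  by (rule ext) (simp add: monomial_fun_def lookup_add power_add prod.distrib)

lemma poly_eval_mult: "poly_eval (P * Q) = poly_eval P * poly_eval Q"
proof (induction P rule: cpoly_induct)
  case (single m c)
  show ?case
  proof (induction Q rule: cpoly_induct)
    case (single m' c')
    show ?case by (rule ext) (simp add: mult_single poly_eval_single monomial_fun_add)
  qed (simp only: distrib_left poly_eval_add)
qed (simp only: distrib_right poly_eval_add)

lemma monomial_fun_zero: "monomial_fun 0 = 1"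
  by (rule ext) (simp add: monomial_fun_def)

lemma monomial_fun_variable: "monomial_fun (single i 1) = (\<lambda>z::complex^'n. z $ i)"
proof
  fix z :: "complex^'n"
  have "monomial_fun (single i 1) z = (\<Prod>j\<in>UNIV. if j = i then z $ j else 1)"
    unfolding monomial_fun_def by (intro prod.cong) (auto simp: lookup_single when_def)
  then show "monomial_fun (single i 1) z = z $ i" by simp
qed

lemma range_poly_eval: "range (poly_eval :: 'n::finite cpoly \<Rightarrow> _) = poly_fun"
proof (rule subset_antisym; rule subsetI)
  fix f :: "complex^'n \<Rightarrow> complex"
  assume "f \<in> range poly_eval"
  then obtain P :: "'n cpoly" where "f = poly_eval P" by blast
  moreover have "monomial_fun m \<in> poly_fun" for m :: "'n \<Rightarrow>\<^sub>0 nat"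
  proof -
    have "monomial_fun m = (\<Prod>i\<in>UNIV. (\<lambda>z. z $ i) ^ lookup m i)"
    proof
      fix z :: "complex^'n"
      have "(\<Prod>i\<in>A. (\<lambda>z. z $ i) ^ lookup m i) z = (\<Prod>i\<in>A. (z $ i) ^ lookup m i)" for A
      proof (induction A rule: infinite_finite_induct)
        case (insert i A)
        have "((\<lambda>z. z $ i) ^ k) z = z $ i ^ k" for k by (induction k) auto
        then show ?case using insert by simp
      qed auto
      then show "monomial_fun m z = (\<Prod>i\<in>UNIV. (\<lambda>z. z $ i) ^ lookup m i) z" by (simp add: monomial_fun_def)
    qed
    then show ?thesis by (simp add: poly_fun_prod poly_fun_power)
  qed
  moreover have "poly_eval P \<in> poly_fun" for P :: "'n cpoly"
    by (induction P rule: cpoly_induct)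
       (simp_all only: poly_eval_single poly_eval_add poly_fun_cscale poly_fun_add \<open>\<And>m. monomial_fun m \<in> poly_fun\<close>)
  ultimately show "f \<in> poly_fun" by blast
next
  fix f :: "complex^'n \<Rightarrow> complex"
  assume "f \<in> poly_fun"
  then show "f \<in> range poly_eval"
  proof (induction rule: poly_fun_induct)
    case (const c)
    have "(\<lambda>z. c) = poly_eval (single 0 c)"
      unfolding poly_eval_single monomial_fun_zero by (simp add: fun_eq_iff)
    then show ?case by blast
  next
    case (coord_mult f i)
    then obtain P where "f = poly_eval P" by blast
    then have "(\<lambda>z. z $ i * f z) = poly_eval (single (single i 1) 1 * P)"
      unfolding poly_eval_mult poly_eval_single monomial_fun_variable by (simp add: fun_eq_iff)
    then show ?case by blast
  next
    case (add f g)
    then obtain P Q where "f = poly_eval P" "g = poly_eval Q" by blast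
    then have "(\<lambda>z. f z + g z) = poly_eval (P + Q)" by (simp add: poly_eval_add fun_eq_iff)
    then show ?case by blast
  qed
qed

lemma inj_monomial_fun: "inj (monomial_fun :: ('n::finite \<Rightarrow>\<^sub>0 nat) \<Rightarrow> _)"
proof (rule injI)
  fix m m' :: "'n \<Rightarrow>\<^sub>0 nat"
  assume eq: "monomial_fun m = monomial_fun m'"
  have ev: "monomial_fun m (\<chi> j. if j = i then 2 else 1) = 2 ^ lookup m i" for m and i :: 'n
  proof -
    have "monomial_fun m (\<chi> j. if j = i then 2 else 1) = (\<Prod>j\<in>UNIV. if j = i then 2 ^ lookup m j else 1)"
      unfolding monomial_fun_def by (intro prod.cong) auto
    then show ?thesis by simp
  qed
  have "(2::complex) ^ lookup m i = 2 ^ lookup m' i" for i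
    using ev[of m i] ev[of m' i] eq by simp
  then have "of_nat (2 ^ lookup m i) = (of_nat (2 ^ lookup m' i) :: complex)" for i by simp
  then have "(2::nat) ^ lookup m i = 2 ^ lookup m' i" for i by (simp only: of_nat_eq_iff)
  then have "lookup m i = lookup m' i" for i by simp
  then show "m = m'" by (intro poly_mapping_eqI)
qed

text \<open>Monomials are distinct characters of the monoid \<open>\<complex>\<^sup>n\<close> under coordinatewise multiplication, so
they are linearly independent as functions.\<close>

lemma inj_poly_eval: "inj (poly_eval :: 'n::finite cpoly \<Rightarrow> _)"
proof (rule injI)
  fix P Q :: "'n cpoly"
  assume eq: "poly_eval P = poly_eval Q"
  define R where "R = P - Q"
  have "P = R + Q" by (simp add: R_def)
  then have R: "poly_eval R = 0" using eq poly_eval_add[of R Q] by simp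
  have "lookup R m = 0" if m: "m \<in> keys R" for m
  proof -
    define X where "X = monomial_fun ` keys R"
    define c where "c \<psi> = lookup R (the_inv monomial_fun \<psi>)" for \<psi> :: "complex^'n \<Rightarrow> complex"
    have "(\<Sum>\<psi>\<in>X. cscale (c \<psi>) \<psi>) = (\<Sum>m\<in>keys R. cscale (lookup R m) (monomial_fun m))"
      unfolding X_def by (subst sum.reindex)
        (auto simp: c_def the_inv_f_f[OF inj_monomial_fun] intro: inj_on_subset[OF inj_monomial_fun])
    also have "\<dots> = 0"
      using R by (auto simp: fun_eq_iff poly_eval_eq sum_fun_apply)
    finally have "c (monomial_fun m) = 0"
    proof (rule multiplicative_functions_independent[where opr = "\<lambda>z w. \<chi> i. z $ i * w $ i", rotated 3])
      show "\<psi> \<noteq> 0" if "\<psi> \<in> X" for \<psi>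
      proof -
        have "\<psi> (\<chi> i. 1) = 1" using that by (auto simp: X_def monomial_fun_def)
        then show ?thesis by auto
      qed
    qed (use m in \<open>auto simp: X_def monomial_fun_def power_mult_distrib prod.distrib\<close>)
    then show ?thesis by (simp add: c_def the_inv_f_f[OF inj_monomial_fun])
  qed
  then have "R = 0" by (intro poly_mapping_eqI) (metis in_keys_iff lookup_zero)
  then show "P = Q" by (simp add: R_def)
qed

section \<open>Partial derivatives of smooth functions\<close>

lemma partial_deriv_has_derivative:
  "(f has_derivative f') (at x) \<Longrightarrow> partial_deriv i f x = f' (axis i 1)"
  unfolding partial_deriv_def by (metis frechet_derivative_at)

lemma partial_deriv_along_axis:
  assumes "f differentiable (at (y + s *\<^sub>R axis i 1))"
  shows "((\<lambda>t. f (y + t *\<^sub>R axis i 1)) has_vector_derivative partial_deriv i f (y + s *\<^sub>R axis i 1)) (at s)"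
proof -
  have f: "(f has_derivative frechet_derivative f (at (y + s *\<^sub>R axis i 1))) (at (y + s *\<^sub>R axis i 1))"
    using assms by (simp add: frechet_derivative_works)
  have "((\<lambda>t. y + t *\<^sub>R axis i (1::real)) has_derivative (\<lambda>t. t *\<^sub>R axis i 1)) (at s)"
    by (auto intro!: derivative_eq_intros)
  then have "((\<lambda>t. f (y + t *\<^sub>R axis i 1)) has_derivative
      (\<lambda>t. frechet_derivative f (at (y + s *\<^sub>R axis i 1)) (t *\<^sub>R axis i 1))) (at s)"
    using f by (rule has_derivative_compose)
  then show ?thesis
    unfolding has_vector_derivative_def partial_deriv_def
    by (simp add: linear_cmul[OF has_derivative_linear[OF f]])
qed

lemma smooth_differentiable: "smooth f \<Longrightarrow> f differentiable (at x)"
  unfolding smooth_def by (metis iterated_partial_deriv_def foldr.simps(1) id_apply)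

lemma iterated_partial_deriv_Nil [simp]: "iterated_partial_deriv [] f = f"
  and iterated_partial_deriv_Cons [simp]:
    "iterated_partial_deriv (i # is) f = partial_deriv i (iterated_partial_deriv is f)"
  and iterated_partial_deriv_append:
    "iterated_partial_deriv (is @ js) f = iterated_partial_deriv is (iterated_partial_deriv js f)"
  by (simp_all add: iterated_partial_deriv_def)

lemma smooth_iterated: "smooth f \<Longrightarrow> smooth (iterated_partial_deriv is f)"
  unfolding smooth_def iterated_partial_deriv_append[symmetric] by blast

lemma smooth_partial_deriv: "smooth f \<Longrightarrow> smooth (partial_deriv i f)"
  using smooth_iterated[of f "[i]"] by simp

text \<open>The left-hand side is symmetric in \<open>i\<close> and \<open>j\<close>. It is evaluated by applying the mean value
  theorem in one direction and then in the other. The inner product with \<open>u\<close> makes the function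
  real-valued, as that theorem requires.\<close>

lemma second_difference_mean_value:
  fixes f :: "real^'n \<Rightarrow> complex"
  assumes f: "smooth f" and h: "h > 0"
  shows "\<exists>p. norm (p - x) \<le> 2 * h \<and>
    u \<bullet> (f (x + h *\<^sub>R axis i 1 + h *\<^sub>R axis j 1) - f (x + h *\<^sub>R axis i 1)
      - f (x + h *\<^sub>R axis j 1) + f x) = h * h * (u \<bullet> partial_deriv j (partial_deriv i f) p)"
proof -
  let ?ei = "axis i 1 :: real^'n" and ?ej = "axis j 1 :: real^'n"
  define g where "g s = u \<bullet> f (x + h *\<^sub>R ?ej + s *\<^sub>R ?ei) - u \<bullet> f (x + s *\<^sub>R ?ei)" for s
  have deriv: "((\<lambda>t. u \<bullet> F (y + t *\<^sub>R axis k 1)) has_real_derivative u \<bullet> partial_deriv k F (y + s *\<^sub>R axis k 1)) (at s)"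
    if "smooth F" for F :: "real^'n \<Rightarrow> complex" and y k s
  proof -
    have "((\<lambda>t. u \<bullet> F (y + t *\<^sub>R axis k 1)) has_vector_derivative u \<bullet> partial_deriv k F (y + s *\<^sub>R axis k 1)) (at s)"
      by (intro bounded_linear.has_vector_derivative[OF bounded_linear_inner_right]
          partial_deriv_along_axis smooth_differentiable that)
    then show ?thesis by (simp add: has_real_derivative_iff_has_vector_derivative)
  qed
  have "\<exists>s>0. s < h \<and> g h - g 0 = (h - 0) * (u \<bullet> partial_deriv i f (x + h *\<^sub>R ?ej + s *\<^sub>R ?ei) - u \<bullet> partial_deriv i f (x + s *\<^sub>R ?ei))"
    unfolding g_def by (rule MVT2[OF h]) (intro DERIV_diff deriv f)
  then obtain s where s: "0 < s" "s < h" and gs: "g h - g 0 = h * (u \<bullet> partial_deriv i f (x + h *\<^sub>R ?ej + s *\<^sub>R ?ei) - u \<bullet> partial_deriv i f (x + s *\<^sub>R ?ei))"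
    by auto
  define k where "k t = u \<bullet> partial_deriv i f (x + s *\<^sub>R ?ei + t *\<^sub>R ?ej)" for t
  have "\<exists>t>0. t < h \<and> k h - k 0 = (h - 0) * (u \<bullet> partial_deriv j (partial_deriv i f) (x + s *\<^sub>R ?ei + t *\<^sub>R ?ej))"
    unfolding k_def by (rule MVT2[OF h]) (intro deriv smooth_partial_deriv f)
  then obtain t where t: "0 < t" "t < h" and kt: "k h - k 0 = h * (u \<bullet> partial_deriv j (partial_deriv i f) (x + s *\<^sub>R ?ei + t *\<^sub>R ?ej))"
    by auto
  have "g h - g 0 = h * (k h - k 0)" using gs by (simp add: k_def algebra_simps)
  moreover have "norm ((x + s *\<^sub>R ?ei + t *\<^sub>R ?ej) - x) \<le> 2 * h"
  proof -
    have "norm (s *\<^sub>R ?ei + t *\<^sub>R ?ej) \<le> norm (s *\<^sub>R ?ei) + norm (t *\<^sub>R ?ej)" by (rule norm_triangle_ineq)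
    also have "\<dots> \<le> 2 * h" using s t by simp
    finally show ?thesis by (simp add: algebra_simps)
  qed
  moreover have "g h - g 0 = u \<bullet> (f (x + h *\<^sub>R ?ei + h *\<^sub>R ?ej) - f (x + h *\<^sub>R ?ei) - f (x + h *\<^sub>R ?ej) + f x)"
    by (simp add: g_def inner_diff_right inner_add_right algebra_simps)
  ultimately show ?thesis using kt by (intro exI[of _ "x + s *\<^sub>R ?ei + t *\<^sub>R ?ej"]) (simp add: mult.assoc)
qed

text \<open>Both mixed derivatives are limits of the same second difference quotient; each is continuous because it is
differentiable.\<close>

lemma partial_deriv_commute:
  fixes f :: "real^'n \<Rightarrow> complex"
  assumes f: "smooth f"
  shows "partial_deriv i (partial_deriv j f) = partial_deriv j (partial_deriv i f)"
proof
  fix x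
  let ?a = "partial_deriv i (partial_deriv j f)" and ?b = "partial_deriv j (partial_deriv i f)"
  have cont: "isCont ?a x" "isCont ?b x"
    using f by (auto intro!: differentiable_imp_continuous_within smooth_differentiable smooth_partial_deriv)
  have "u \<bullet> (?a x - ?b x) = 0" for u
  proof -
    have "\<exists>pq. norm (fst pq - x) \<le> 2 / Suc n \<and> norm (snd pq - x) \<le> 2 / Suc n \<and>
        u \<bullet> ?a (fst pq) = u \<bullet> ?b (snd pq)" for n
    proof -
      define h where "h = 1 / real (Suc n)"
      have h: "h > 0" by (simp add: h_def)
      obtain p where p: "norm (p - x) \<le> 2 * h" "u \<bullet> (f (x + h *\<^sub>R axis j 1 + h *\<^sub>R axis i 1) - f (x + h *\<^sub>R axis j 1)
          - f (x + h *\<^sub>R axis i 1) + f x) = h * h * (u \<bullet> ?a p)"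
        using second_difference_mean_value[OF f h, of x u j i] by blast
      obtain q where q: "norm (q - x) \<le> 2 * h" "u \<bullet> (f (x + h *\<^sub>R axis i 1 + h *\<^sub>R axis j 1) - f (x + h *\<^sub>R axis i 1)
          - f (x + h *\<^sub>R axis j 1) + f x) = h * h * (u \<bullet> ?b q)"
        using second_difference_mean_value[OF f h, of x u i j] by blast
      have "h * h * (u \<bullet> ?a p) = h * h * (u \<bullet> ?b q)"
        unfolding p(2)[symmetric] q(2)[symmetric] by (simp add: algebra_simps)
      then have "u \<bullet> ?a p = u \<bullet> ?b q" using h by simp
      then show ?thesis using p(1) q(1) by (intro exI[of _ "(p, q)"]) (simp add: h_def)
    qed
    then have "\<forall>n. \<exists>pq. norm (fst pq - x) \<le> 2 / Suc n \<and> norm (snd pq - x) \<le> 2 / Suc n \<and>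
        u \<bullet> ?a (fst pq) = u \<bullet> ?b (snd pq)" by blast
    from choice[OF this] obtain r where
      r: "\<forall>n. norm (fst (r n) - x) \<le> 2 / Suc n \<and> norm (snd (r n) - x) \<le> 2 / Suc n \<and>
        u \<bullet> ?a (fst (r n)) = u \<bullet> ?b (snd (r n))" ..
    define p where "p n = fst (r n)" for n
    define q where "q n = snd (r n)" for n
    have pq: "norm (p n - x) \<le> 2 / Suc n" "norm (q n - x) \<le> 2 / Suc n" "u \<bullet> ?a (p n) = u \<bullet> ?b (q n)" for n
      using r by (simp_all add: p_def q_def)
    have lim: "(\<lambda>n. 2 / real (Suc n)) \<longlonglongrightarrow> 0"
      using tendsto_mult_right_zero[OF LIMSEQ_inverse_real_of_nat, of 2] by (simp add: divide_inverse)
    have "p \<longlonglongrightarrow> x"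
      by (rule LIM_zero_cancel[OF Lim_null_comparison[OF always_eventually[OF allI[OF pq(1)]] lim]])
    moreover have "q \<longlonglongrightarrow> x"
      by (rule LIM_zero_cancel[OF Lim_null_comparison[OF always_eventually[OF allI[OF pq(2)]] lim]])
    ultimately have "(\<lambda>n. ?a (p n)) \<longlonglongrightarrow> ?a x" and "(\<lambda>n. ?b (q n)) \<longlonglongrightarrow> ?b x"
      using isCont_tendsto_compose[OF cont(1)] isCont_tendsto_compose[OF cont(2)] by blast+
    then have "(\<lambda>n. u \<bullet> ?a (p n)) \<longlonglongrightarrow> u \<bullet> ?a x" and "(\<lambda>n. u \<bullet> ?b (q n)) \<longlonglongrightarrow> u \<bullet> ?b x"
      using tendsto_inner[OF tendsto_const] by blast+
    then have "u \<bullet> ?a x = u \<bullet> ?b x" using pq(3) LIMSEQ_unique by auto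
    then show ?thesis by (simp add: inner_diff_right)
  qed
  then have "(?a x - ?b x) \<bullet> (?a x - ?b x) = 0" .
  then show "?a x = ?b x" by simp
qed

lemma iterated_partial_deriv_remove1:
  assumes "smooth f" "i \<in> set is"
  shows "iterated_partial_deriv is f = partial_deriv i (iterated_partial_deriv (remove1 i is) f)"
  using assms(2)
proof (induction "is")
  case (Cons j js)
  then show ?case
    using partial_deriv_commute[OF smooth_iterated[OF assms(1)]] by (cases "i = j") auto
qed simp

lemma iterated_partial_deriv_mset:
  assumes "smooth f" "mset is = mset js"
  shows "iterated_partial_deriv is f = iterated_partial_deriv js f"
  using assms(2)
proof (induction "is" arbitrary: js)
  case (Cons i "is")
  then have "i \<in> set js" by (metis list.set_intros(1) set_mset_mset)
  moreover have "mset is = mset (remove1 i js)" using Cons.prems by (metis mset.simps(2) mset_remove1 add_mset_remove_trivial)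
  ultimately show ?case
    using Cons.IH[of "remove1 i js"] iterated_partial_deriv_remove1[OF assms(1), of i js] by (simp only: iterated_partial_deriv_Cons)
qed simp

lemma partial_deriv_add:
  "f differentiable (at x) \<Longrightarrow> g differentiable (at x) \<Longrightarrow> partial_deriv i (f + g) x = partial_deriv i f x + partial_deriv i g x"
  by (subst partial_deriv_has_derivative[of "f + g"])
     (auto simp: plus_fun_def partial_deriv_def intro!: has_derivative_add simp flip: frechet_derivative_works)

lemma partial_deriv_cscale:
  "f differentiable (at x) \<Longrightarrow> partial_deriv i (cscale c f) x = c * partial_deriv i f x"
  by (subst partial_deriv_has_derivative[of "cscale c f"])
     (auto simp: cscale_def partial_deriv_def intro!: has_derivative_mult_right simp flip: frechet_derivative_works)

lemma iterated_partial_deriv_add: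
  assumes "smooth f" "smooth g"
  shows "iterated_partial_deriv is (f + g) = iterated_partial_deriv is f + iterated_partial_deriv is g"
proof (induction "is")
  case (Cons i "is")
  show ?case
    unfolding iterated_partial_deriv_Cons Cons.IH
    by (rule ext) (simp add: partial_deriv_add smooth_differentiable smooth_iterated assms)
qed simp

lemma iterated_partial_deriv_cscale:
  assumes "smooth f"
  shows "iterated_partial_deriv is (cscale c f) = cscale c (iterated_partial_deriv is f)"
proof (induction "is")
  case (Cons i "is")
  show ?case
    unfolding iterated_partial_deriv_Cons Cons.IH
    by (rule ext) (simp add: partial_deriv_cscale smooth_differentiable smooth_iterated assms)
qed simp

lemma smooth_add:
  assumes "smooth f" "smooth g"
  shows "smooth (f + g)"
  unfolding smooth_def iterated_partial_deriv_add[OF assms] unfolding plus_fun_def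
  using assms by (auto intro!: differentiable_add simp: smooth_def)

lemma smooth_cscale:
  assumes "smooth f"
  shows "smooth (cscale c f)"
  unfolding smooth_def iterated_partial_deriv_cscale[OF assms] unfolding cscale_def
  using assms by (auto intro!: differentiable_mult simp: smooth_def)

lemma partial_deriv_zero: "partial_deriv i 0 = 0"
  by (rule ext) (simp add: partial_deriv_def zero_fun_def)

lemma smooth_zero: "smooth 0"
proof -
  have "iterated_partial_deriv is 0 = 0" for "is" :: "'a list"
    by (induction "is") (simp_all only: iterated_partial_deriv_Nil iterated_partial_deriv_Cons partial_deriv_zero)
  then show ?thesis unfolding smooth_def by (simp add: zero_fun_def)
qed


section \<open>Constant coefficient operators as a module over polynomial functions\<close>

lemma monomial_list_exists:
  fixes m :: "'n::finite \<Rightarrow>\<^sub>0 nat"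
  shows "\<exists>is. \<forall>i. count_list is i = lookup m i"
proof -
  obtain "is" where "mset is = (\<Sum>i\<in>UNIV. replicate_mset (lookup m i) i)" using ex_mset by blast
  then have "count_list is i = lookup m i" for i
    by (simp add: count_sum flip: count_mset)
  then show ?thesis by blast
qed

lemma monomial_deriv_eq:
  assumes "smooth f" "\<And>i. count_list js i = lookup m i"
  shows "monomial_deriv m f = iterated_partial_deriv js f"
  unfolding monomial_deriv_def
  using someI_ex[OF monomial_list_exists[of m]] assms
  by (intro iterated_partial_deriv_mset multiset_eqI) (simp_all add: count_mset)

lemma monomial_deriv_zero: "smooth f \<Longrightarrow> monomial_deriv 0 f = f"
  by (subst monomial_deriv_eq[where js = "[]"]) auto

lemma monomial_deriv_variable: "smooth f \<Longrightarrow> monomial_deriv (single i 1) f = partial_deriv i f"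
  by (subst monomial_deriv_eq[where js = "[i]"]) (auto simp: lookup_single when_def)

lemma monomial_deriv_add_exponent:
  assumes "smooth f"
  shows "monomial_deriv (m + m') f = monomial_deriv m (monomial_deriv m' f)"
proof -
  obtain "is" js where l: "\<And>i. count_list is i = lookup m i" "\<And>i. count_list js i = lookup m' i"
    using monomial_list_exists by metis
  then have "monomial_deriv (m + m') f = iterated_partial_deriv (is @ js) f"
    by (intro monomial_deriv_eq assms) (simp add: lookup_add)
  then show ?thesis
    using assms by (simp add: iterated_partial_deriv_append monomial_deriv_eq[of _ "is"] monomial_deriv_eq[of _ js] l smooth_iterated)
qed

lemma smooth_monomial_deriv: "smooth f \<Longrightarrow> smooth (monomial_deriv m f)"
  by (simp add: monomial_deriv_def smooth_iterated)

lemma monomial_deriv_add: "smooth f \<Longrightarrow> smooth g \<Longrightarrow> monomial_deriv m (f + g) = monomial_deriv m f + monomial_deriv m g"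
  by (simp only: monomial_deriv_def iterated_partial_deriv_add)

lemma monomial_deriv_cscale: "smooth f \<Longrightarrow> monomial_deriv m (cscale c f) = cscale c (monomial_deriv m f)"
  by (simp only: monomial_deriv_def iterated_partial_deriv_cscale)

lemma poly_diff_op_add_poly: "poly_diff_op (P + Q) f = poly_diff_op P f + poly_diff_op Q f"
  by (rule ext) (simp add: poly_diff_op_def sum_keys_add)

lemma poly_diff_op_single: "poly_diff_op (single m c) f = cscale c (monomial_deriv m f)"
  by (rule ext) (simp only: poly_diff_op_def sum_keys_single cscale_apply)

lemma smooth_poly_diff_op: "smooth f \<Longrightarrow> smooth (poly_diff_op P f)"
  by (induction P rule: cpoly_induct)
     (simp_all only: poly_diff_op_single poly_diff_op_add_poly smooth_cscale smooth_add smooth_monomial_deriv)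

lemma poly_diff_op_add:
  assumes "smooth f" "smooth g"
  shows "poly_diff_op P (f + g) = poly_diff_op P f + poly_diff_op P g"
proof (induction P rule: cpoly_induct)
  case (single m c)
  show ?case unfolding poly_diff_op_single monomial_deriv_add[OF assms] by (rule cfun.scale_right_distrib)
next
  case (add P Q)
  show ?case unfolding poly_diff_op_add_poly add by (simp only: ac_simps)
qed

lemma poly_diff_op_cscale:
  assumes "smooth f"
  shows "poly_diff_op P (cscale c f) = cscale c (poly_diff_op P f)"
proof (induction P rule: cpoly_induct)
  case (single m c')
  show ?case unfolding poly_diff_op_single monomial_deriv_cscale[OF assms] by (rule cfun.scale_left_commute)
next
  case (add P Q)
  show ?case unfolding poly_diff_op_add_poly add by (rule cfun.scale_right_distrib[symmetric])
qed

lemma poly_diff_op_mult: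
  assumes "smooth f"
  shows "poly_diff_op (P * Q) f = poly_diff_op P (poly_diff_op Q f)"
proof (induction P rule: cpoly_induct)
  case (single m c)
  show ?case
  proof (induction Q rule: cpoly_induct)
    case (single m' c')
    show ?case
      unfolding mult_single poly_diff_op_single monomial_deriv_add_exponent[OF assms]
        monomial_deriv_cscale[OF smooth_monomial_deriv[OF assms]]
      by (rule cfun.scale_scale[symmetric])
  next
    case (add Q Q')
    show ?case
      unfolding distrib_left poly_diff_op_add_poly add
      by (simp only: poly_diff_op_add smooth_poly_diff_op assms)
  qed
next
  case (add P P')
  show ?case unfolding distrib_right poly_diff_op_add_poly add ..
qed

text \<open>The constant coefficient operator \<open>p(\<partial>)\<close> of a polynomial function \<open>p\<close>, which makes sense because a
polynomial is determined by its values.\<close>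

definition diff_op :: "(complex^'n \<Rightarrow> complex) \<Rightarrow> (real^'n \<Rightarrow> complex) \<Rightarrow> real^'n \<Rightarrow> complex" where
  "diff_op p = poly_diff_op (the_inv poly_eval p)"

lemma diff_op_poly_eval [simp]: "diff_op (poly_eval P) = poly_diff_op P"
  by (simp add: diff_op_def the_inv_f_f[OF inj_poly_eval])

lemma poly_fun_obtain_poly:
  assumes "p \<in> poly_fun"
  obtains P where "p = poly_eval P"
  using assms range_poly_eval by blast

lemma smooth_diff_op: "smooth f \<Longrightarrow> smooth (diff_op p f)"
  by (simp add: diff_op_def smooth_poly_diff_op)

lemma diff_op_add_poly:
  "p \<in> poly_fun \<Longrightarrow> q \<in> poly_fun \<Longrightarrow> diff_op (p + q) f = diff_op p f + diff_op q f"
  by (elim poly_fun_obtain_poly) (simp only: poly_eval_add[symmetric] diff_op_poly_eval poly_diff_op_add_poly)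

lemma diff_op_mult:
  "p \<in> poly_fun \<Longrightarrow> q \<in> poly_fun \<Longrightarrow> smooth f \<Longrightarrow> diff_op (p * q) f = diff_op p (diff_op q f)"
  by (elim poly_fun_obtain_poly) (simp only: poly_eval_mult[symmetric] diff_op_poly_eval poly_diff_op_mult)

lemma diff_op_const: "smooth f \<Longrightarrow> diff_op (\<lambda>z. c) f = cscale c f"
proof -
  assume "smooth f"
  moreover have "(\<lambda>z. c) = poly_eval (single 0 c)"
    unfolding poly_eval_single monomial_fun_zero by (simp add: fun_eq_iff)
  ultimately show ?thesis
    by (metis diff_op_poly_eval poly_diff_op_single monomial_deriv_zero)
qed

lemma diff_op_cscale_poly:
  assumes "p \<in> poly_fun" "smooth f"
  shows "diff_op (cscale c p) f = cscale c (diff_op p f)"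
proof -
  have "cscale c p = (\<lambda>z. c) * p" by (simp add: fun_eq_iff)
  then show ?thesis using assms by (simp only: diff_op_mult poly_fun_const diff_op_const smooth_diff_op)
qed

lemma diff_op_variable: "smooth f \<Longrightarrow> diff_op (\<lambda>z. z $ i) f = partial_deriv i f"
proof -
  assume "smooth f"
  moreover have "(\<lambda>z. z $ i) = poly_eval (single (single i 1) 1)"
    unfolding poly_eval_single monomial_fun_variable by simp
  ultimately show ?thesis
    by (metis diff_op_poly_eval poly_diff_op_single monomial_deriv_variable cfun.scale_one)
qed

lemma diff_op_add: "smooth f \<Longrightarrow> smooth g \<Longrightarrow> diff_op p (f + g) = diff_op p f + diff_op p g"
  by (simp only: diff_op_def poly_diff_op_add)

lemma diff_op_cscale: "smooth f \<Longrightarrow> diff_op p (cscale c f) = cscale c (diff_op p f)"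
  by (simp only: diff_op_def poly_diff_op_cscale)

lemma diff_op_zero: "smooth f \<Longrightarrow> diff_op 0 f = 0"
  using diff_op_const[of f 0] by (simp add: zero_fun_def cscale_def)

lemma diff_op_sum_poly:
  assumes "smooth f" "\<And>i. i \<in> I \<Longrightarrow> p i \<in> poly_fun"
  shows "diff_op (sum p I) f = (\<Sum>i\<in>I. diff_op (p i) f)"
  using assms(2)
proof (induction I rule: infinite_finite_induct)
  case (insert i I)
  then have "diff_op (p i + sum p I) f = diff_op (p i) f + diff_op (sum p I) f"
    by (intro diff_op_add_poly poly_fun_sum) auto
  then show ?case unfolding sum.insert[OF insert.hyps] using insert.IH insert.prems by (metis insertI2)
qed (simp_all only: sum.infinite sum.empty diff_op_zero[OF assms(1)] simp_thms)

lemma smooth_sum: "(\<And>i. i \<in> I \<Longrightarrow> smooth (F i)) \<Longrightarrow> smooth (sum F I)"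
proof (induction I rule: infinite_finite_induct)
  case (insert i I)
  then have "smooth (F i + sum F I)" by (intro smooth_add) auto
  then show ?case unfolding sum.insert[OF insert.hyps] .
qed (simp_all only: sum.infinite sum.empty smooth_zero simp_thms)

lemma diff_op_fun_zero: "diff_op p 0 = 0"
  using diff_op_cscale[OF smooth_zero, of p 0] by (simp only: cfun.scale_zero_left)

lemma diff_op_sum:
  assumes "\<And>i. i \<in> I \<Longrightarrow> smooth (F i)"
  shows "diff_op p (sum F I) = (\<Sum>i\<in>I. diff_op p (F i))"
  using assms
proof (induction I rule: infinite_finite_induct)
  case (insert i I)
  then have "diff_op p (F i + sum F I) = diff_op p (F i) + diff_op p (sum F I)"
    by (intro diff_op_add smooth_sum) auto
  then show ?case unfolding sum.insert[OF insert.hyps] using insert.IH insert.prems by (metis insertI2)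
qed (simp_all only: sum.infinite sum.empty diff_op_fun_zero simp_thms)

section \<open>Uniqueness for ordinary differential equations with constant coefficients\<close>

text \<open>The function \<open>exp (- a t) h t\<close> is constant.\<close>

lemma first_order_ode_unique:
  fixes h :: "real \<Rightarrow> complex"
  assumes "\<And>t. (h has_vector_derivative a * h t) (at t)" "h 0 = 0"
  shows "h t = 0"
proof -
  have "((\<lambda>t. exp (- a * of_real t)) has_vector_derivative (- a * exp (- a * of_real t))) (at t)" for t
    by (rule has_vector_derivative_real_field) (auto intro!: derivative_eq_intros)
  then have "((\<lambda>t. exp (- a * of_real t) * h t) has_vector_derivative
      exp (- a * of_real t) * (a * h t) + (- a * exp (- a * of_real t)) * h t) (at t)" for t
    by (intro has_vector_derivative_mult assms(1))
  then have "((\<lambda>t. exp (- a * of_real t) * h t) has_vector_derivative 0) (at t within UNIV)" for t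
    by (simp add: algebra_simps)
  then obtain c where c: "\<And>t. exp (- a * of_real t) * h t = c"
    using has_vector_derivative_zero_constant[of UNIV "\<lambda>t. exp (- a * of_real t) * h t"] by auto
  have "c = 0" using c[of 0] assms(2) by simp
  then show ?thesis using c[of t] by simp
qed

text \<open>The sequence \<open>u\<close> consists of a function and its derivatives. If \<open>a\<close> is a root of \<open>q\<close> and
\<open>q = (X - a) r\<close>, then \<open>r(d/dt) u\<close> solves a first order equation, hence vanishes, and induction applies
to \<open>r\<close>.\<close>

lemma constant_coefficient_ode_unique:
  fixes u :: "nat \<Rightarrow> real \<Rightarrow> complex" and q :: "complex poly"
  assumes deriv: "\<And>j t. (u j has_vector_derivative u (Suc j) t) (at t)"
    and initial: "\<And>j. u j 0 = 0"
    and "q \<noteq> 0" "\<And>t. (\<Sum>j\<le>degree q. coeff q j * u j t) = 0"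
  shows "u 0 t = 0"
  using assms(3,4)
proof (induction "degree q" arbitrary: q t)
  case 0
  then have "coeff q 0 \<noteq> 0" by (metis leading_coeff_neq_0)
  then show ?case using 0 by simp
next
  case (Suc n)
  obtain a where a: "poly q a = 0"
    using fundamental_theorem_of_algebra[of q] Suc.hyps(2) by (metis constant_degree nat.distinct(1))
  then obtain r where q: "q = [:-a, 1:] * r" by (metis poly_eq_0_iff_dvd dvdE)
  have r: "r \<noteq> 0" "degree r = n"
  proof -
    show "r \<noteq> 0" using Suc.prems(1) q by auto
    then have "degree q = Suc (degree r)" unfolding q by (subst degree_mult_eq) auto
    then show "degree r = n" using Suc.hyps(2) by simp
  qed
  define h where "h m t = (\<Sum>j\<le>n. coeff r j * u (j + m) t)" for m t
  have "(\<Sum>j\<le>Suc n. coeff q j * u j t) = h 1 t - a * h 0 t" for t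
  proof -
    have "h 0 t = (\<Sum>j\<le>Suc n. coeff r j * u j t)"
      using r by (simp add: h_def coeff_eq_0)
    then have h0: "h 0 t = coeff r 0 * u 0 t + (\<Sum>j\<le>n. coeff r (Suc j) * u (Suc j) t)"
      by (simp only: sum.atMost_Suc_shift)
    have "(\<Sum>j\<le>Suc n. coeff q j * u j t) = coeff q 0 * u 0 t + (\<Sum>j\<le>n. coeff q (Suc j) * u (Suc j) t)"
      by (simp only: sum.atMost_Suc_shift)
    also have "\<dots> = h 1 t - a * h 0 t"
      unfolding h0 by (simp add: q h_def algebra_simps sum_subtractf sum.distrib sum_distrib_left)
    finally show ?thesis .
  qed
  then have h1: "h 1 t = a * h 0 t" for t
    using Suc.prems(2)[of t] Suc.hyps(2) by (metis eq_iff_diff_eq_0)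
  have "(h 0 has_vector_derivative h 1 t) (at t)" for t
    unfolding h_def by (auto intro!: has_vector_derivative_sum has_vector_derivative_mult_right deriv)
  then have "h 0 t = 0" for t
    using first_order_ode_unique[of "h 0" a t] h1 initial by (simp add: h_def)
  then show ?case
    using Suc.hyps(1)[of r t] r by (simp add: h_def)
qed

section \<open>The dimension of a joint eigenspace\<close>

context finite_orthogonal_group
begin

lemma joint_eigenspace_smooth: "f \<in> joint_eigenspace K \<Lambda> \<Longrightarrow> smooth f"
  by (simp add: joint_eigenspace_def)

lemma poly_eval_invariant_iff: "poly_eval P \<in> invariants \<longleftrightarrow> P \<in> invariant_polys K"
  using range_poly_eval by (auto simp: invariants_def invariant_polys_def)

lemma joint_eigenspace_iff:
  "f \<in> joint_eigenspace K \<Lambda> \<longleftrightarrow> smooth f \<and> (\<forall>r\<in>invariants. diff_op r f = cscale (r \<Lambda>) f)"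
proof -
  have "(\<forall>r\<in>invariants. diff_op r f = cscale (r \<Lambda>) f) \<longleftrightarrow>
      (\<forall>P\<in>invariant_polys K. poly_diff_op P f = cscale (poly_eval P \<Lambda>) f)"
  proof (intro iffI ballI)
    fix r assume "\<forall>P\<in>invariant_polys K. poly_diff_op P f = cscale (poly_eval P \<Lambda>) f" "r \<in> invariants"
    then show "diff_op r f = cscale (r \<Lambda>) f"
      by (metis poly_fun_obtain_poly invariant_poly_fun poly_eval_invariant_iff diff_op_poly_eval)
  next
    fix P assume "\<forall>r\<in>invariants. diff_op r f = cscale (r \<Lambda>) f" "P \<in> invariant_polys K"
    then show "poly_diff_op P f = cscale (poly_eval P \<Lambda>) f"
      by (metis poly_eval_invariant_iff diff_op_poly_eval)
  qed
  then show ?thesis by (simp add: joint_eigenspace_def)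
qed

lemma subspace_joint_eigenspace: "cfun.subspace (joint_eigenspace K \<Lambda>)"
proof (rule cfun.subspaceI)
  show "0 \<in> joint_eigenspace K \<Lambda>"
    by (simp only: joint_eigenspace_iff smooth_zero diff_op_fun_zero cfun.scale_zero_right simp_thms ball_triv)
next
  fix f g assume "f \<in> joint_eigenspace K \<Lambda>" "g \<in> joint_eigenspace K \<Lambda>"
  then show "f + g \<in> joint_eigenspace K \<Lambda>"
    unfolding joint_eigenspace_iff using smooth_add diff_op_add cfun.scale_right_distrib by metis
next
  fix c f assume "f \<in> joint_eigenspace K \<Lambda>"
  then show "cscale c f \<in> joint_eigenspace K \<Lambda>"
    unfolding joint_eigenspace_iff using smooth_cscale diff_op_cscale cfun.scale_left_commute by metis
qed

text \<open>The operators of the generators \<open>(r - r \<Lambda>) q\<close> annihilate \<open>f\<close> because \<open>r(\<partial>) f = r(\<Lambda>) f\<close>.\<close>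

lemma diff_op_fibre_ideal:
  assumes p: "p \<in> fibre_ideal \<Lambda>" and f: "f \<in> joint_eigenspace K \<Lambda>"
  shows "diff_op p f = 0"
proof -
  have sm: "smooth f" using f by (rule joint_eigenspace_smooth)
  have "p \<in> poly_fun \<and> diff_op p f = 0"
    using p
  proof (induction rule: fibre_ideal_induct)
    case subspace
    show ?case
      by (rule cfun.subspaceI)
         (simp_all only: mem_Collect_eq poly_fun_zero poly_fun_add poly_fun_cscale diff_op_zero[OF sm]
           diff_op_add_poly diff_op_cscale_poly[OF _ sm] add_0 cfun.scale_zero_right simp_thms)
  next
    case (base r q)
    have r: "r \<in> poly_fun" using base(1) by (rule invariant_poly_fun)
    have eq: "(\<lambda>z. (r z - r \<Lambda>) * q z) = q * r + cscale (- r \<Lambda>) q"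
      by (simp add: fun_eq_iff algebra_simps)
    have "diff_op (q * r) f = cscale (r \<Lambda>) (diff_op q f)"
      using f base by (simp only: diff_op_mult r sm joint_eigenspace_iff diff_op_cscale simp_thms)
    then have "diff_op (q * r + cscale (- r \<Lambda>) q) f = cscale (r \<Lambda>) (diff_op q f) + cscale (- r \<Lambda>) (diff_op q f)"
      using base(2) by (simp only: diff_op_add_poly poly_fun_mult poly_fun_cscale r diff_op_cscale_poly[OF _ sm])
    also have "\<dots> = 0" by (simp add: fun_eq_iff)
    finally show ?case
      unfolding eq using r base(2) by (simp only: poly_fun_add poly_fun_mult poly_fun_cscale simp_thms)
  qed
  then show ?thesis by blast
qed

end

context reflection_generated_group
begin

text \<open>Let \<open>N\<close> be the set of points where all derivatives of \<open>f\<close> vanish. If \<open>q(z\<^sub>i)\<close> lies in the ideal, all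
derivatives of \<open>f\<close> satisfy the equation \<open>q(d/dt) = 0\<close> along lines parallel to the \<open>i\<close>-th axis; so \<open>N\<close>
contains with a point the line through it. From \<open>0\<close> every point is reached along such lines.\<close>

lemma joint_eigenfunction_determined_at_0:
  assumes f: "f \<in> joint_eigenspace K \<Lambda>" and 0: "\<And>p. p \<in> poly_fun \<Longrightarrow> diff_op p f 0 = 0"
  shows "f = 0"
proof -
  have sm: "smooth f" using f by (rule joint_eigenspace_smooth)
  define N where "N = {x. \<forall>p\<in>poly_fun. diff_op p f x = 0}"
  have step: "x + t *\<^sub>R axis i 1 \<in> N" if x: "x \<in> N" for x t i
    unfolding N_def
  proof safe
    fix p :: "complex^'n \<Rightarrow> complex" assume p: "p \<in> poly_fun"
    obtain q where q: "q \<noteq> 0" "(\<lambda>z. poly q (z $ i)) \<in> fibre_ideal \<Lambda>"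
      using fibre_ideal_contains_univariate by blast
    define v where "v j = (\<lambda>z. z $ i) ^ j * p" for j
    have v: "v j \<in> poly_fun" for j
      unfolding v_def by (intro poly_fun_mult poly_fun_power poly_fun_coord p)
    define u where "u j s = diff_op (v j) f (x + s *\<^sub>R axis i 1)" for j s
    have "u 0 t = 0"
    proof (rule constant_coefficient_ode_unique[of u q])
      fix j s
      have "diff_op (v (Suc j)) f = partial_deriv i (diff_op (v j) f)"
      proof -
        have "v (Suc j) = (\<lambda>z. z $ i) * v j" by (simp only: v_def power_Suc mult.assoc)
        then show ?thesis
          by (simp only: diff_op_mult poly_fun_coord v sm diff_op_variable smooth_diff_op)
      qed
      then show "(u j has_vector_derivative u (Suc j) s) (at s)"
        unfolding u_def by (simp add: partial_deriv_along_axis smooth_differentiable smooth_diff_op sm)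
      show "u j 0 = 0" using x v by (simp add: u_def N_def)
      show "q \<noteq> 0" by (rule q)
    next
      fix s
      have "(\<Sum>j\<le>degree q. cscale (coeff q j) (v j)) = (\<lambda>z. poly q (z $ i)) * p"
      proof
        fix z :: "complex^'n"
        have "((\<lambda>z. z $ i) ^ j) z = (z $ i) ^ j" for j by (induction j) auto
        then show "(\<Sum>j\<le>degree q. cscale (coeff q j) (v j)) z = ((\<lambda>z. poly q (z $ i)) * p) z"
          by (simp add: sum_fun_apply v_def poly_altdef sum_distrib_right mult.assoc)
      qed
      then have "(\<Sum>j\<le>degree q. cscale (coeff q j) (v j)) \<in> fibre_ideal \<Lambda>"
        using fibre_ideal_mult[OF q(2) p] by simp
      then have "diff_op (\<Sum>j\<le>degree q. cscale (coeff q j) (v j)) f = 0"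
        by (rule diff_op_fibre_ideal[OF _ f])
      then have "(\<Sum>j\<le>degree q. cscale (coeff q j) (diff_op (v j) f)) = 0"
        by (simp only: diff_op_sum_poly[OF sm] poly_fun_cscale v diff_op_cscale_poly[OF v sm])
      from fun_cong[OF this, of "x + s *\<^sub>R axis i 1"]
      show "(\<Sum>j\<le>degree q. coeff q j * u j s) = 0" by (simp add: sum_fun_apply u_def)
    qed
    then show "diff_op p f (x + t *\<^sub>R axis i 1) = 0" by (simp add: u_def v_def)
  qed
  have "(\<Sum>i\<in>A. x $ i *\<^sub>R axis i 1) \<in> N" if "finite A" for A and x :: "real^'n"
    using that
  proof (induction A rule: finite_induct)
    case empty
    show ?case using 0 by (simp add: N_def)
  next
    case (insert i A)
    then show ?case using step[of "\<Sum>i\<in>A. x $ i *\<^sub>R axis i 1" "x $ i" i] by (simp add: add.commute)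
  qed
  then have "(\<Sum>i\<in>UNIV. x $ i *\<^sub>R axis i 1) \<in> N" for x :: "real^'n" by simp
  moreover have "(\<Sum>i\<in>UNIV. x $ i *\<^sub>R axis i 1) = x" for x :: "real^'n"
    using basis_expansion[of x] by (simp only: scalar_mult_eq_scaleR)
  ultimately have "x \<in> N" for x :: "real^'n" by metis
  then have "diff_op (\<lambda>z. 1) f x = 0" for x by (auto simp: N_def)
  then show ?thesis using diff_op_const[OF sm, of 1] by (simp add: fun_eq_iff)
qed

text \<open>With more than \<open>|K|\<close> elements in \<open>B\<close>, some nontrivial combination \<open>f\<close> of \<open>B\<close> satisfies
\<open>(p(\<partial>)f)(0) = 0\<close> for the at most \<open>|K|\<close> functions \<open>p\<close> that span modulo the ideal, hence for all
polynomial functions \<open>p\<close>.\<close>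

lemma independent_in_joint_eigenspace:
  assumes B: "finite B" "B \<subseteq> joint_eigenspace K \<Lambda>" "cfun.independent B"
  shows "card B \<le> card K"
proof (rule ccontr)
  assume large: "\<not> card B \<le> card K"
  obtain Z where Z: "finite Z" "card Z \<le> card K" "Z \<subseteq> poly_fun" "poly_fun \<subseteq> cfun.span (Z \<union> fibre_ideal \<Lambda>)"
    using fibre_ideal_codim_le by blast
  have "\<exists>c. (\<forall>b\<in>B. c b \<in> (UNIV :: complex set)) \<and> (\<exists>b\<in>B. c b \<noteq> 0) \<and> (\<forall>p\<in>Z. (\<Sum>b\<in>B. diff_op p b 0 * c b) = 0)"
    using Z(1,2) B(1) large by (intro underdetermined_system_solvable) auto
  then obtain c where c: "\<exists>b\<in>B. c b \<noteq> 0" "\<And>p. p \<in> Z \<Longrightarrow> (\<Sum>b\<in>B. diff_op p b 0 * c b) = 0" by blast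
  define f where "f = (\<Sum>b\<in>B. cscale (c b) b)"
  have fE: "f \<in> joint_eigenspace K \<Lambda>"
    unfolding f_def using B(2)
    by (intro cfun.subspace_sum[OF subspace_joint_eigenspace] cfun.subspace_scale[OF subspace_joint_eigenspace]) auto
  have sm: "smooth f" using fE by (rule joint_eigenspace_smooth)
  have smB: "smooth b" if "b \<in> B" for b using that B(2) joint_eigenspace_smooth by blast
  have Z0: "diff_op p f 0 = 0" if "p \<in> Z" for p
  proof -
    have "diff_op p f = (\<Sum>b\<in>B. cscale (c b) (diff_op p b))"
      unfolding f_def using smB by (simp add: diff_op_sum diff_op_cscale smooth_cscale)
    then show ?thesis using c(2)[OF that] by (simp add: sum_fun_apply mult.commute)
  qed
  have "p \<in> poly_fun \<and> diff_op p f 0 = 0" if "p \<in> cfun.span (Z \<union> fibre_ideal \<Lambda>)" for p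
    using that
  proof (induction rule: cfun.span_induct)
    case base
    show ?case
      by (rule cfun.subspaceI)
         (simp_all only: mem_Collect_eq poly_fun_zero poly_fun_add poly_fun_cscale diff_op_zero[OF sm]
           diff_op_add_poly diff_op_cscale_poly[OF _ sm] plus_fun_apply zero_fun_apply cscale_apply
           add_0 mult_zero_right simp_thms)
  next
    case (step p)
    then show ?case
      using Z(3) Z0 fibre_ideal_subset diff_op_fibre_ideal[OF _ fE] by (metis Un_iff subsetD zero_fun_apply)
  qed
  then have "f = 0" using Z(4) by (intro joint_eigenfunction_determined_at_0[OF fE]) blast
  then have "\<forall>b\<in>B. c b = 0"
    using cfun.independentD[OF B(3,1) order_refl, of c] unfolding f_def by blast
  then show False using c(1) by blast
qed

lemma joint_eigenspace_dimension:
  "\<exists>B. finite B \<and> card B \<le> card K \<and> cfun.independent B \<and> cfun.span B = joint_eigenspace K \<Lambda>"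
proof -
  obtain B where B: "B \<subseteq> joint_eigenspace K \<Lambda>" "cfun.independent B" "joint_eigenspace K \<Lambda> \<subseteq> cfun.span B"
    using cfun.maximal_independent_subset by blast
  have "finite B \<and> card B \<le> card K"
  proof (rule ccontr)
    assume "\<not> ?thesis"
    then obtain C where C: "C \<subseteq> B" "card C = Suc (card K)" "finite C"
      by (metis Suc_leI infinite_arbitrarily_large not_le obtain_subset_with_card_n)
    then have "card C \<le> card K"
      using B cfun.independent_mono[OF B(2) C(1)] by (intro independent_in_joint_eigenspace) blast+
    then show False using C(2) by simp
  qed
  moreover have "cfun.span B = joint_eigenspace K \<Lambda>"
    using B(1,3) cfun.span_minimal[OF _ subspace_joint_eigenspace] by blast
  ultimately show ?thesis using B(2) by blast
qed

end


section \<open>Exponential functions in the joint eigenspaces\<close>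

definition exp_fun :: "complex^'n \<Rightarrow> real^'n \<Rightarrow> complex" where
  "exp_fun \<mu> x = exp (\<Sum>j\<in>UNIV. \<mu> $ j * of_real (x $ j))"

lemma exp_fun_add: "exp_fun \<mu> (x + y) = exp_fun \<mu> x * exp_fun \<mu> y"
  by (simp add: exp_fun_def distrib_left sum.distrib exp_add)

lemma exp_fun_0 [simp]: "exp_fun \<mu> 0 = 1"
  by (simp add: exp_fun_def)

lemma exp_fun_nonzero [simp]: "exp_fun \<mu> x \<noteq> 0"
  by (simp add: exp_fun_def)

lemma exp_character_eq: "exp_character \<Lambda> x = inverse (exp_fun \<Lambda> x)"
  by (simp add: exp_character_def exp_fun_def exp_minus)

lemma exp_fun_complex_act:
  "exp_fun (complex_act k \<mu>) x = exp_fun \<mu> (transpose k *v x)"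
proof -
  have "(\<Sum>j\<in>UNIV. complex_act k \<mu> $ j * of_real (x $ j)) =
      (\<Sum>j\<in>UNIV. \<Sum>l\<in>UNIV. of_real (k $ j $ l) * \<mu> $ l * of_real (x $ j))"
    by (simp add: complex_act_def complex_matrix_def map_matrix_def matrix_vector_mult_def sum_distrib_right)
  also have "\<dots> = (\<Sum>l\<in>UNIV. \<Sum>j\<in>UNIV. of_real (k $ j $ l) * \<mu> $ l * of_real (x $ j))"
    by (rule sum.swap)
  also have "\<dots> = (\<Sum>l\<in>UNIV. \<mu> $ l * of_real ((transpose k *v x) $ l))"
    by (simp add: matrix_vector_mult_def transpose_def sum_distrib_left mult_ac del: transpose_matrix_vector)
  finally show ?thesis by (simp add: exp_fun_def del: transpose_matrix_vector)
qed

lemma exp_fun_has_derivative: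
  "(exp_fun \<mu> has_derivative (\<lambda>v. exp_fun \<mu> x * (\<Sum>j\<in>UNIV. \<mu> $ j * of_real (v $ j)))) (at x)"
proof -
  have "((\<lambda>x::real^'a. \<Sum>j\<in>UNIV. \<mu> $ j * of_real (x $ j)) has_derivative (\<lambda>v. \<Sum>j\<in>UNIV. \<mu> $ j * of_real (v $ j))) (at x)"
    by (intro has_derivative_sum has_derivative_mult_right has_derivative_of_real
          bounded_linear.has_derivative[OF bounded_linear_vec_nth] has_derivative_ident)
  moreover have "(exp has_derivative (\<lambda>h. exp (\<Sum>j\<in>UNIV. \<mu> $ j * of_real (x $ j)) * h)) (at (\<Sum>j\<in>UNIV. \<mu> $ j * of_real (x $ j)))"
    using DERIV_exp by (simp add: has_field_derivative_def)
  ultimately show ?thesis unfolding exp_fun_def by (rule has_derivative_compose)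
qed

lemma partial_deriv_exp_fun: "partial_deriv i (exp_fun \<mu>) = cscale (\<mu> $ i) (exp_fun \<mu>)"
proof
  fix x
  have "(\<Sum>j\<in>UNIV. \<mu> $ j * of_real (axis i 1 $ j)) = (\<Sum>j\<in>UNIV. if j = i then \<mu> $ j else 0)"
    by (intro sum.cong) (auto simp: axis_def)
  then show "partial_deriv i (exp_fun \<mu>) x = cscale (\<mu> $ i) (exp_fun \<mu>) x"
    unfolding partial_deriv_has_derivative[OF exp_fun_has_derivative] by simp
qed

lemma smooth_exp_fun: "smooth (exp_fun \<mu>)"
proof -
  have diff: "cscale c (exp_fun \<mu>) differentiable (at x)" for c x
    unfolding cscale_def differentiable_def
    using has_derivative_mult_right[OF exp_fun_has_derivative[of \<mu> x], of c] by blast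
  have "\<exists>c. iterated_partial_deriv is (exp_fun \<mu>) = cscale c (exp_fun \<mu>)" for "is"
  proof (induction "is")
    case Nil
    show ?case by (intro exI[of _ 1]) (simp add: fun_eq_iff)
  next
    case (Cons i "is")
    then obtain c where c: "iterated_partial_deriv is (exp_fun \<mu>) = cscale c (exp_fun \<mu>)" by blast
    have "partial_deriv i (cscale c (exp_fun \<mu>)) = cscale (c * \<mu> $ i) (exp_fun \<mu>)"
      using exp_fun_has_derivative[of \<mu>]
      by (intro ext) (subst partial_deriv_cscale, auto simp: differentiable_def partial_deriv_exp_fun)
    then show ?case using c by auto
  qed
  then show ?thesis unfolding smooth_def using diff by metis
qed

lemma diff_op_exp_fun:
  assumes "p \<in> poly_fun"
  shows "diff_op p (exp_fun \<mu>) = cscale (p \<mu>) (exp_fun \<mu>)"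
  using assms
proof (induction rule: poly_fun_induct)
  case (const c)
  show ?case by (rule diff_op_const[OF smooth_exp_fun])
next
  case (coord_mult f i)
  have "(\<lambda>z. z $ i * f z) = (\<lambda>z. z $ i) * f" by (simp add: fun_eq_iff)
  then have "diff_op (\<lambda>z. z $ i * f z) (exp_fun \<mu>) = diff_op (\<lambda>z. z $ i) (diff_op f (exp_fun \<mu>))"
    using coord_mult.hyps by (simp only: diff_op_mult poly_fun_coord smooth_exp_fun)
  also have "\<dots> = cscale (f \<mu>) (cscale (\<mu> $ i) (exp_fun \<mu>))"
    unfolding coord_mult.IH by (simp only: diff_op_cscale smooth_exp_fun diff_op_variable partial_deriv_exp_fun)
  finally show ?case by (simp add: cscale_def mult_ac)
next
  case (add f g)
  have "(\<lambda>z. f z + g z) = f + g" by (simp add: fun_eq_iff)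
  then show ?case using add by (simp only: diff_op_add_poly cfun.scale_left_distrib plus_fun_apply)
qed

text \<open>The exponent is the gradient at \<open>0\<close>.\<close>

lemma inj_exp_fun: "inj exp_fun"
proof (rule injI)
  fix \<mu> \<nu> :: "complex^'n" assume eq: "exp_fun \<mu> = exp_fun \<nu>"
  have "\<mu> $ i = \<nu> $ i" for i
  proof -
    have "cscale (\<mu> $ i) (exp_fun \<mu>) 0 = cscale (\<nu> $ i) (exp_fun \<nu>) 0"
      by (metis eq partial_deriv_exp_fun)
    then show ?thesis by simp
  qed
  then show "\<mu> = \<nu>" by (simp add: vec_eq_iff)
qed

context finite_orthogonal_group
begin

abbreviation orbit_exponential :: "complex^'n \<Rightarrow> real^'n^'n \<Rightarrow> real^'n \<Rightarrow> complex" where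
  "orbit_exponential \<Lambda> k \<equiv> exp_fun (complex_act k \<Lambda>)"

lemma orbit_exponential_in_joint_eigenspace: "k \<in> K \<Longrightarrow> orbit_exponential \<Lambda> k \<in> joint_eigenspace K \<Lambda>"
  by (simp add: joint_eigenspace_iff smooth_exp_fun diff_op_exp_fun invariant_poly_fun invariant_act)

lemma inj_on_orbit_exponential:
  assumes "generic K \<Lambda>"
  shows "inj_on (orbit_exponential \<Lambda>) K"
proof (rule inj_onI)
  fix k h assume kh: "k \<in> K" "h \<in> K" and "orbit_exponential \<Lambda> k = orbit_exponential \<Lambda> h"
  then have "complex_act k \<Lambda> = complex_act h \<Lambda>" using inj_exp_fun by (auto dest: injD)
  then have "complex_act (transpose h ** k) \<Lambda> = \<Lambda>" using kh by (simp add: complex_act_mult)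
  then have "transpose h ** k = mat 1"
    using assms kh mult_mem transpose_mem unfolding generic_def by blast
  then have "h ** (transpose h ** k) = h" by simp
  then show "k = h" using kh by (simp add: matrix_mul_assoc mult_transpose_self)
qed

lemma orbit_exponentials_independent:
  assumes "generic K \<Lambda>" "(\<Sum>k\<in>K. cscale (c k) (orbit_exponential \<Lambda> k)) = 0" "k \<in> K"
  shows "c k = 0"
proof -
  note inj = inj_on_orbit_exponential[OF assms(1)]
  define c' where "c' = c \<circ> the_inv_into K (orbit_exponential \<Lambda>)"
  have c': "c' (orbit_exponential \<Lambda> k) = c k" if "k \<in> K" for k
    using that by (simp add: c'_def the_inv_into_f_f[OF inj])
  have "(\<Sum>\<psi>\<in>orbit_exponential \<Lambda> ` K. cscale (c' \<psi>) \<psi>) = (\<Sum>k\<in>K. cscale (c k) (orbit_exponential \<Lambda> k))"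
    by (subst sum.reindex[OF inj]) (auto simp: c' intro!: sum.cong)
  then have "c' (orbit_exponential \<Lambda> k) = 0"
    using assms(2,3) finite_K
    by (intro multiplicative_functions_independent[of "orbit_exponential \<Lambda> ` K" "(+)" c'])
       (auto simp: exp_fun_add fun_eq_iff)
  then show ?thesis using c' assms(3) by simp
qed

end

text \<open>Genericity provides \<open>|K|\<close> distinct exponents, so the exponentials attain the bound on the dimension.\<close>

lemma (in reflection_generated_group) generic_joint_eigenspace:
  assumes "generic K \<Lambda>"
  shows "joint_eigenspace K \<Lambda> = {\<Sum>k\<in>K. cscale (c k) (orbit_exponential \<Lambda> k) | c. True}"
proof -
  let ?X = "orbit_exponential \<Lambda> ` K"
  note inj = inj_on_orbit_exponential[OF assms]
  have fin: "finite ?X" using finite_K by simp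
  have reindex: "(\<Sum>v\<in>?X. cscale (u v) v) = (\<Sum>k\<in>K. cscale (u (orbit_exponential \<Lambda> k)) (orbit_exponential \<Lambda> k))" for u
    by (subst sum.reindex[OF inj]) simp
  have ind: "cfun.independent ?X"
  proof
    assume "cfun.dependent ?X"
    then obtain u where u: "\<exists>v\<in>?X. u v \<noteq> 0" "(\<Sum>v\<in>?X. cscale (u v) v) = 0"
      using cfun.dependent_finite[OF fin] by blast
    then show False
      using orbit_exponentials_independent[OF assms, of "\<lambda>k. u (orbit_exponential \<Lambda> k)"] unfolding reindex by blast
  qed
  have sub: "?X \<subseteq> joint_eigenspace K \<Lambda>" using orbit_exponential_in_joint_eigenspace by blast
  have "joint_eigenspace K \<Lambda> \<subseteq> cfun.span ?X"
  proof
    fix f assume f: "f \<in> joint_eigenspace K \<Lambda>"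
    show "f \<in> cfun.span ?X"
    proof (rule ccontr)
      assume nf: "f \<notin> cfun.span ?X"
      then have "cfun.independent (insert f ?X)" using ind by (rule cfun.independent_insertI)
      then have "card (insert f ?X) \<le> card K"
        using f sub fin by (intro independent_in_joint_eigenspace) auto
      moreover have "f \<notin> ?X" by (rule contrapos_nn[OF nf cfun.span_base])
      then have "card (insert f ?X) = Suc (card K)" using fin card_image[OF inj] by simp
      ultimately show False by simp
    qed
  qed
  then have "joint_eigenspace K \<Lambda> = cfun.span ?X"
    using cfun.span_minimal[OF sub subspace_joint_eigenspace] by blast
  also have "\<dots> = {\<Sum>k\<in>K. cscale (c k) (orbit_exponential \<Lambda> k) | c. True}"
  proof -
    have "(\<Sum>k\<in>K. cscale (c k) (orbit_exponential \<Lambda> k)) \<in> cfun.span ?X" for c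
      by (intro cfun.span_sum cfun.span_scale cfun.span_base) auto
    moreover have "\<exists>c. f = (\<Sum>k\<in>K. cscale (c k) (orbit_exponential \<Lambda> k))" if "f \<in> cfun.span ?X" for f
    proof -
      from that have "f \<in> range (\<lambda>u. \<Sum>v\<in>?X. cscale (u v) v)"
        by (simp only: cfun.span_finite[OF fin])
      then obtain u where "f = (\<Sum>v\<in>?X. cscale (u v) v)" ..
      then show ?thesis unfolding reindex by (rule exI[of _ "\<lambda>k. u (orbit_exponential \<Lambda> k)"])
    qed
    ultimately show ?thesis by blast
  qed
  finally show ?thesis .
qed

section \<open>The motion group and its representations\<close>

context finite_orthogonal_group
begin

lemma motion_group_simps [simp]:
  "carrier (motion_group K) = UNIV \<times> K"
  "(x, k) \<otimes>\<^bsub>motion_group K\<^esub> (y, h) = (x + k *v y, k ** h)"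
  "\<one>\<^bsub>motion_group K\<^esub> = (0, mat 1)"
  by (simp_all add: motion_group_def)

lemma group_motion_group: "group (motion_group K)"
proof (rule groupI)
  fix g assume "g \<in> carrier (motion_group K)"
  then obtain x k where g: "g = (x, k)" "k \<in> K" by auto
  show "\<exists>h\<in>carrier (motion_group K). h \<otimes>\<^bsub>motion_group K\<^esub> g = \<one>\<^bsub>motion_group K\<^esub>"
    using g by (intro bexI[of _ "(- (transpose k *v x), transpose k)"])
      (simp_all add: transpose_mem transpose_mult_self del: transpose_matrix_vector)
qed (auto simp: one_mem mult_mem matrix_mul_assoc matrix_vector_right_distrib matrix_vector_mul_assoc add.assoc)

lemma motion_group_inv:
  assumes "k \<in> K"
  shows "inv\<^bsub>motion_group K\<^esub> (x, k) = (- (transpose k *v x), transpose k)"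
  using assms
  by (intro group.inv_equality[OF group_motion_group])
     (simp_all add: transpose_mem transpose_mult_self del: transpose_matrix_vector)

lemma act_mult: "act (g \<otimes>\<^bsub>motion_group K\<^esub> h) y = act g (act h y)"
  by (cases g; cases h) (simp add: act_def matrix_vector_right_distrib matrix_vector_mul_assoc add.assoc)

definition translate :: "(real^'n) \<times> (real^'n^'n) \<Rightarrow> (real^'n \<Rightarrow> complex) \<Rightarrow> real^'n \<Rightarrow> complex" where
  "translate g f x = f (act (inv\<^bsub>motion_group K\<^esub> g) x)"

lemma eigenspace_rep_eq: "eigenspace_rep K \<Lambda> = (joint_eigenspace K \<Lambda>, translate)"
  by (simp add: eigenspace_rep_def translate_def fun_eq_iff)

lemma translate_add: "translate g (f + h) = translate g f + translate g h"
  and translate_cscale: "translate g (cscale c f) = cscale c (translate g f)"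
  by (simp_all add: translate_def fun_eq_iff)

lemma translate_one: "translate \<one>\<^bsub>motion_group K\<^esub> f = f"
  using monoid.inv_one[OF group.is_monoid[OF group_motion_group]] by (simp add: fun_eq_iff translate_def act_def)

lemma translate_mult:
  assumes "g \<in> carrier (motion_group K)" "h \<in> carrier (motion_group K)"
  shows "translate (g \<otimes>\<^bsub>motion_group K\<^esub> h) f = translate g (translate h f)"
  using assms group.inv_mult_group[OF group_motion_group assms] by (simp only: fun_eq_iff translate_def act_mult simp_thms)

text \<open>Translations act on an exponential by scalars, and \<open>K\<close> moves its exponent.\<close>

lemma translate_exp_fun:
  assumes "k \<in> K"
  shows "translate (y, k) (exp_fun \<mu>) = cscale (exp_fun (complex_act k \<mu>) (- y)) (exp_fun (complex_act k \<mu>))"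
proof
  fix x
  have "act (inv\<^bsub>motion_group K\<^esub> (y, k)) x = transpose k *v (x - y)"
    using assms by (simp add: motion_group_inv act_def matrix_vector_mult_diff_distrib del: transpose_matrix_vector)
  also have "x - y = - y + x" by simp
  finally have "act (inv\<^bsub>motion_group K\<^esub> (y, k)) x = transpose k *v (- y + x)" .
  then show "translate (y, k) (exp_fun \<mu>) x = cscale (exp_fun (complex_act k \<mu>) (- y)) (exp_fun (complex_act k \<mu>)) x"
    by (simp only: translate_def exp_fun_complex_act[symmetric] exp_fun_add cscale_apply)
qed

lemma translate_by_translation: "translate (- y, mat 1) f x = f (x + y)"
  by (simp add: translate_def motion_group_inv one_mem act_def add.commute del: transpose_matrix_vector)

end

context reflection_generated_group
begin

lemma generic_eigenspace_representation:
  assumes gen: "generic K \<Lambda>"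
  shows "representation (motion_group K) (eigenspace_rep K \<Lambda>)"
proof -
  let ?E = "joint_eigenspace K \<Lambda>"
  have "translate g f \<in> ?E" if g: "g \<in> carrier (motion_group K)" and f: "f \<in> ?E" for g f
  proof -
    obtain y h where gh: "g = (y, h)" "h \<in> K" using g by auto
    obtain c where c: "f = (\<Sum>k\<in>K. cscale (c k) (orbit_exponential \<Lambda> k))"
      using f generic_joint_eigenspace[OF gen] by auto
    have summand: "translate g (cscale (c k) (orbit_exponential \<Lambda> k)) \<in> ?E" if "k \<in> K" for k
      unfolding gh(1) translate_cscale translate_exp_fun[OF gh(2)] complex_act_mult[symmetric]
      using that gh(2) by (intro cfun.subspace_scale[OF subspace_joint_eigenspace]
          orbit_exponential_in_joint_eigenspace mult_mem)
    have "translate g (sum F A) = (\<Sum>k\<in>A. translate g (F k))" for F :: "real^'n^'n \<Rightarrow> _" and A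
      by (auto simp: fun_eq_iff translate_def sum_fun_apply)
    then show ?thesis unfolding c using summand by (metis (no_types, lifting) cfun.subspace_sum[OF subspace_joint_eigenspace])
  qed
  then show ?thesis
    unfolding eigenspace_rep_eq representation_def
    by (auto simp: subspace_joint_eigenspace clinear_on_def translate_add translate_cscale translate_one
        translate_mult simp del: motion_group_simps)
qed

text \<open>A nonzero invariant subspace \<open>W\<close> is stable under translations, so it contains the components of its
members and hence one of the exponentials; the members of \<open>K\<close> map this one to all the others.\<close>

lemma generic_eigenspace_irreducible:
  assumes gen: "generic K \<Lambda>"
  shows "irreducible_rep (motion_group K) (eigenspace_rep K \<Lambda>)"
proof -
  let ?E = "joint_eigenspace K \<Lambda>"
  have "?E \<noteq> {0}"
  proof -
    have "orbit_exponential \<Lambda> (mat 1) \<noteq> 0"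
      using exp_fun_nonzero[of "complex_act (mat 1) \<Lambda>" 0] by (metis zero_fun_apply)
    then show ?thesis using orbit_exponential_in_joint_eigenspace[OF one_mem, of \<Lambda>] by blast
  qed
  moreover have "W = ?E" if W: "cfun.subspace W" "W \<subseteq> ?E" "\<And>g f. g \<in> carrier (motion_group K) \<Longrightarrow> f \<in> W \<Longrightarrow> translate g f \<in> W"
      and nz: "W \<noteq> {0}" for W
  proof -
    obtain f where f: "f \<in> W" "f \<noteq> 0" using nz cfun.subspace_0[OF W(1)] by blast
    obtain c where c: "f = (\<Sum>k\<in>K. cscale (c k) (orbit_exponential \<Lambda> k))"
      using f W(2) generic_joint_eigenspace[OF gen] by auto
    note inj = inj_on_orbit_exponential[OF gen]
    define c' where "c' = c \<circ> the_inv_into K (orbit_exponential \<Lambda>)"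
    have c': "c' (orbit_exponential \<Lambda> k) = c k" if "k \<in> K" for k
      using that by (simp add: c'_def the_inv_into_f_f[OF inj])
    have "(\<Sum>\<psi>\<in>orbit_exponential \<Lambda> ` K. cscale (c' \<psi>) \<psi>) = f"
      unfolding c by (subst sum.reindex[OF inj]) (auto simp: c' intro!: sum.cong)
    moreover have "(\<lambda>x. h (x + y)) \<in> W" if "h \<in> W" for h y
    proof -
      have "(\<lambda>x. h (x + y)) = translate (- y, mat 1) h" by (simp add: fun_eq_iff translate_by_translation)
      then show ?thesis using W(3)[of "(- y, mat 1)" h] that one_mem by simp
    qed
    ultimately have "\<forall>\<psi>\<in>orbit_exponential \<Lambda> ` K. cscale (c' \<psi>) \<psi> \<in> W"
      using f(1) finite_K W(1)
      by (intro multiplicative_components_in_subspace[where opr = "(+)"]) (auto simp: exp_fun_add)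
    then have comp: "cscale (c k) (orbit_exponential \<Lambda> k) \<in> W" if "k \<in> K" for k
      using c' that by force
    obtain k where k: "k \<in> K" "c k \<noteq> 0"
      using f(2) c by (metis (no_types, lifting) cfun.scale_zero_left sum.neutral)
    have "cscale (inverse (c k)) (cscale (c k) (orbit_exponential \<Lambda> k)) \<in> W"
      by (rule cfun.subspace_scale[OF W(1) comp[OF k(1)]])
    then have ek: "orbit_exponential \<Lambda> k \<in> W" using k(2) by simp
    have eh: "orbit_exponential \<Lambda> h \<in> W" if "h \<in> K" for h
    proof -
      have m: "h ** transpose k \<in> K" using that k mult_mem transpose_mem by blast
      have "complex_act (h ** transpose k) (complex_act k \<Lambda>) = complex_act h \<Lambda>"
        using k by (simp add: complex_act_mult)
      then have "translate (0, h ** transpose k) (orbit_exponential \<Lambda> k) = orbit_exponential \<Lambda> h"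
        unfolding translate_exp_fun[OF m] by simp
      then show ?thesis using W(3)[OF _ ek, of "(0, h ** transpose k)"] m by simp
    qed
    then have "?E \<subseteq> W"
      unfolding generic_joint_eigenspace[OF gen]
      by (auto intro!: cfun.subspace_sum[OF W(1)] cfun.subspace_scale[OF W(1)])
    then show ?thesis using W(2) by blast
  qed
  ultimately show ?thesis
    using generic_eigenspace_representation[OF gen]
    unfolding eigenspace_rep_eq irreducible_rep_def by (auto simp: image_subset_iff simp del: motion_group_simps)
qed

end

section \<open>Induced representations\<close>

context finite_orthogonal_group
begin

text \<open>Covariance under right translations determines \<open>f\<close> by its values at the points \<open>(0, k)\<close>, since
\<open>(x, k) = (0, k) (k\<^sup>-\<^sup>1 x, 1)\<close>.\<close>

lemma mem_induced_space_iff: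
  "f \<in> induced_space K (exp_character \<Lambda>) \<longleftrightarrow>
     (\<forall>x k. f (x, k) = (if k \<in> K then f (0, k) * orbit_exponential \<Lambda> k x else 0))"
proof
  assume f: "f \<in> induced_space K (exp_character \<Lambda>)"
  show "\<forall>x k. f (x, k) = (if k \<in> K then f (0, k) * orbit_exponential \<Lambda> k x else 0)"
  proof (intro allI)
    fix x k
    have covariant: "f (y + k *v z, k) = exp_fun \<Lambda> z * f (y, k)" if "k \<in> K" for y z
      using f that by (auto simp: induced_space_def exp_character_eq)
    have "f (k *v (transpose k *v x), k) = exp_fun \<Lambda> (transpose k *v x) * f (0, k)" if "k \<in> K"
      using covariant[OF that, of 0 "transpose k *v x"] by (simp only: add_0)
    moreover have "k *v (transpose k *v x) = x" if "k \<in> K"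
      using that by (simp only: matrix_vector_mul_assoc mult_transpose_self matrix_vector_mul_lid)
    ultimately show "f (x, k) = (if k \<in> K then f (0, k) * orbit_exponential \<Lambda> k x else 0)"
      using f by (auto simp: exp_fun_complex_act induced_space_def simp del: transpose_matrix_vector)
  qed
next
  assume *: "\<forall>x k. f (x, k) = (if k \<in> K then f (0, k) * orbit_exponential \<Lambda> k x else 0)"
  have act: "orbit_exponential \<Lambda> k (k *v x) = exp_fun \<Lambda> x" if "k \<in> K" for k x
    using that by (simp only: exp_fun_complex_act matrix_vector_mul_assoc transpose_mult_self matrix_vector_mul_lid)
  have "f (y + k *v x, k) = exp_fun \<Lambda> x * f (y, k)" if "k \<in> K" for y k x
  proof -
    have "f (y + k *v x, k) = f (0, k) * (orbit_exponential \<Lambda> k y * orbit_exponential \<Lambda> k (k *v x))"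
      using *[rule_format, of "y + k *v x" k] that by (simp add: exp_fun_add)
    also have "\<dots> = exp_fun \<Lambda> x * f (y, k)"
      using *[rule_format, of y k] that by (simp add: act)
    finally show ?thesis .
  qed
  moreover have "f (x, k) = 0" if "k \<notin> K" for x k using * that by simp
  ultimately show "f \<in> induced_space K (exp_character \<Lambda>)"
    by (auto simp: induced_space_def exp_character_eq)
qed

lemma induced_rep_invariant:
  "cfun.subspace (fst (induced_rep K \<psi>))"
  "g \<in> carrier (motion_group K) \<Longrightarrow> f \<in> fst (induced_rep K \<psi>) \<Longrightarrow> snd (induced_rep K \<psi>) g f \<in> fst (induced_rep K \<psi>)"
proof -
  show "cfun.subspace (fst (induced_rep K \<psi>))"
    by (auto simp: induced_rep_def induced_space_def cfun.subspace_def algebra_simps)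
next
  assume g: "g \<in> carrier (motion_group K)" and f: "f \<in> fst (induced_rep K \<psi>)"
  interpret G: group "motion_group K" by (rule group_motion_group)
  have "f (inv\<^bsub>motion_group K\<^esub> g \<otimes>\<^bsub>motion_group K\<^esub> (h \<otimes>\<^bsub>motion_group K\<^esub> (x, mat 1))) =
      inverse (\<psi> x) * f (inv\<^bsub>motion_group K\<^esub> g \<otimes>\<^bsub>motion_group K\<^esub> h)" if h: "h \<in> carrier (motion_group K)" for h x
  proof -
    have "(x, mat 1) \<in> carrier (motion_group K)" using one_mem by simp
    then have "inv\<^bsub>motion_group K\<^esub> g \<otimes>\<^bsub>motion_group K\<^esub> (h \<otimes>\<^bsub>motion_group K\<^esub> (x, mat 1)) =
        inv\<^bsub>motion_group K\<^esub> g \<otimes>\<^bsub>motion_group K\<^esub> h \<otimes>\<^bsub>motion_group K\<^esub> (x, mat 1)"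
      using g h by (simp only: G.m_assoc G.inv_closed)
    moreover have "inv\<^bsub>motion_group K\<^esub> g \<otimes>\<^bsub>motion_group K\<^esub> h \<in> carrier (motion_group K)"
      using g h by (simp only: G.m_closed G.inv_closed)
    moreover have "f (g' \<otimes>\<^bsub>motion_group K\<^esub> (x, mat 1)) = inverse (\<psi> x) * f g'"
      if "g' \<in> carrier (motion_group K)" for g'
      using f that by (simp add: induced_rep_def induced_space_def del: motion_group_simps)
    ultimately show ?thesis by metis
  qed
  moreover have "h \<otimes>\<^bsub>motion_group K\<^esub> (x, mat 1) \<in> carrier (motion_group K)" if "h \<in> carrier (motion_group K)" for h x
    using that one_mem by (intro G.m_closed) auto
  ultimately show "snd (induced_rep K \<psi>) g f \<in> fst (induced_rep K \<psi>)"
    unfolding induced_rep_def induced_space_def by (simp del: motion_group_simps)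
qed

end

text \<open>The intertwiner sums over the fibres of \<open>(x, k) \<mapsto> x\<close>, that is, over the cosets of \<open>K\<close> in the motion
group. It sends the values \<open>f (0, k)\<close> to coefficients with respect to the basis of exponentials.\<close>

lemma (in reflection_generated_group) induced_equivalent_eigenspace:
  assumes gen: "generic K \<Lambda>"
  shows "equivalent_rep (motion_group K) (induced_rep K (exp_character \<Lambda>)) (eigenspace_rep K \<Lambda>)"
proof -
  let ?V = "induced_space K (exp_character \<Lambda>)" and ?E = "joint_eigenspace K \<Lambda>"
  define \<Phi> :: "((real^'n) \<times> (real^'n^'n) \<Rightarrow> complex) \<Rightarrow> real^'n \<Rightarrow> complex"
    where "\<Phi> f x = (\<Sum>k\<in>K. f (x, k))" for f x
  have \<Phi>: "\<Phi> f = (\<Sum>k\<in>K. cscale (f (0, k)) (orbit_exponential \<Lambda> k))" if "f \<in> ?V" for f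
  proof
    fix x
    show "\<Phi> f x = (\<Sum>k\<in>K. cscale (f (0, k)) (orbit_exponential \<Lambda> k)) x"
      unfolding \<Phi>_def sum_fun_apply cscale_apply
    proof (rule sum.cong[OF refl])
      fix k assume "k \<in> K"
      then show "f (x, k) = f (0, k) * orbit_exponential \<Lambda> k x"
        using that[unfolded mem_induced_space_iff, rule_format, of x k] by (simp only: if_True)
    qed
  qed
  have "clinear_on ?V \<Phi>"
    by (auto simp: clinear_on_def \<Phi>_def fun_eq_iff sum.distrib sum_distrib_left)
  moreover have "bij_betw \<Phi> ?V ?E"
  proof (rule bij_betw_imageI)
    show "inj_on \<Phi> ?V"
    proof (rule inj_onI)
      fix f f' assume f: "f \<in> ?V" "f' \<in> ?V" "\<Phi> f = \<Phi> f'"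
      have "(\<Sum>k\<in>K. cscale (f (0, k) - f' (0, k)) (orbit_exponential \<Lambda> k)) = \<Phi> f - \<Phi> f'"
        unfolding \<Phi>[OF f(1)] \<Phi>[OF f(2)] by (simp add: cfun.scale_left_diff_distrib sum_subtractf)
      also have "\<dots> = 0" using f(3) by simp
      finally have "f (0, k) = f' (0, k)" if "k \<in> K" for k
        using orbit_exponentials_independent[OF gen, of "\<lambda>k. f (0, k) - f' (0, k)"] that by auto
      then have "f (x, k) = f' (x, k)" for x k
        using f(1,2) unfolding mem_induced_space_iff by (metis (full_types))
      then show "f = f'" by (auto simp: fun_eq_iff)
    qed
    show "\<Phi> ` ?V = ?E"
    proof (rule subset_antisym; rule subsetI)
      fix h assume "h \<in> \<Phi> ` ?V"
      then obtain f where "f \<in> ?V" "h = \<Phi> f" by blast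
      then have "h = (\<Sum>k\<in>K. cscale (f (0, k)) (orbit_exponential \<Lambda> k))" using \<Phi> by simp
      then show "h \<in> ?E" unfolding generic_joint_eigenspace[OF gen]
        by (intro CollectI exI[of _ "\<lambda>k. f (0, k)"] conjI TrueI)
    next
      fix h assume "h \<in> ?E"
      then obtain c where c: "h = (\<Sum>k\<in>K. cscale (c k) (orbit_exponential \<Lambda> k))"
        unfolding generic_joint_eigenspace[OF gen] by blast
      define f where "f = (\<lambda>(x, k). if k \<in> K then c k * orbit_exponential \<Lambda> k x else 0)"
      have f: "f \<in> ?V" unfolding mem_induced_space_iff by (simp add: f_def)
      have "\<Phi> f = h" unfolding \<Phi>[OF f] c by (intro sum.cong) (auto simp: f_def)
      then show "h \<in> \<Phi> ` ?V" using f by blast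
    qed
  qed
  moreover have "\<Phi> (snd (induced_rep K (exp_character \<Lambda>)) g f) = translate g (\<Phi> f)"
    if g: "g \<in> carrier (motion_group K)" for g f
  proof
    fix x
    obtain y h where gi: "inv\<^bsub>motion_group K\<^esub> g = (y, h)" "h \<in> K"
      using group.inv_closed[OF group_motion_group g] by auto
    have "\<Phi> (snd (induced_rep K (exp_character \<Lambda>)) g f) x = (\<Sum>k\<in>K. f (y + h *v x, h ** k))"
      by (simp add: \<Phi>_def induced_rep_def gi)
    also have "\<dots> = (\<Sum>k\<in>K. f (y + h *v x, k))"
      by (rule sum.reindex_bij_betw[OF bij_betw_mult_left[OF gi(2)], of "\<lambda>k. f (y + h *v x, k)"])
    also have "\<dots> = translate g (\<Phi> f) x"
      by (simp add: translate_def \<Phi>_def gi act_def)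
    finally show "\<Phi> (snd (induced_rep K (exp_character \<Lambda>)) g f) x = translate g (\<Phi> f) x" .
  qed
  ultimately show ?thesis
    unfolding eigenspace_rep_eq equivalent_rep_def induced_rep_def by auto
qed

section \<open>Equivalence classes of representations\<close>

lemma equivalent_rep_refl: "equivalent_rep G R R"
  unfolding equivalent_rep_def
  by (cases R) (auto simp: clinear_on_def intro!: exI[of _ "\<lambda>f. f"] bij_betw_id[unfolded id_def])

lemma equivalent_rep_trans:
  assumes "equivalent_rep G R S" "equivalent_rep G S T"
  shows "equivalent_rep G R T"
proof -
  obtain V \<rho> W \<sigma> U \<tau> where R: "R = (V, \<rho>)" "S = (W, \<sigma>)" "T = (U, \<tau>)" by (metis surj_pair)
  obtain \<Phi> where \<Phi>: "clinear_on V \<Phi>" "bij_betw \<Phi> V W" "\<forall>g\<in>carrier G. \<forall>f\<in>V. \<Phi> (\<rho> g f) = \<sigma> g (\<Phi> f)"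
    using assms(1) unfolding R equivalent_rep_def by auto
  obtain \<Psi> where \<Psi>: "clinear_on W \<Psi>" "bij_betw \<Psi> W U" "\<forall>g\<in>carrier G. \<forall>f\<in>W. \<Psi> (\<sigma> g f) = \<tau> g (\<Psi> f)"
    using assms(2) unfolding R equivalent_rep_def by auto
  have W: "\<Phi> f \<in> W" if "f \<in> V" for f using \<Phi>(2) that by (auto simp: bij_betw_def)
  have "clinear_on V (\<Psi> \<circ> \<Phi>)" using \<Phi>(1) \<Psi>(1) W by (simp add: clinear_on_def)
  moreover have "bij_betw (\<Psi> \<circ> \<Phi>) V U" using \<Phi>(2) \<Psi>(2) by (rule bij_betw_trans)
  ultimately show ?thesis
    using \<Phi>(3) \<Psi>(3) W unfolding R equivalent_rep_def by (auto intro!: exI[of _ "\<Psi> \<circ> \<Phi>"])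
qed

text \<open>The part of being a representation on which the inverse of an equivalence depends.\<close>

definition invariant_space :: "'g monoid \<Rightarrow> ('g, 'a) rep \<Rightarrow> bool" where
  "invariant_space G R \<longleftrightarrow> cfun.subspace (fst R) \<and> (\<forall>g\<in>carrier G. \<forall>f\<in>fst R. snd R g f \<in> fst R)"

lemma equivalent_rep_sym:
  assumes "equivalent_rep G R S" "invariant_space G R"
  shows "equivalent_rep G S R"
proof -
  obtain V \<rho> W \<sigma> where R: "R = (V, \<rho>)" "S = (W, \<sigma>)" by (metis surj_pair)
  obtain \<Phi> where \<Phi>: "clinear_on V \<Phi>" "bij_betw \<Phi> V W" "\<forall>g\<in>carrier G. \<forall>f\<in>V. \<Phi> (\<rho> g f) = \<sigma> g (\<Phi> f)"
    using assms(1) unfolding R equivalent_rep_def by auto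
  have V: "cfun.subspace V" "\<And>g f. g \<in> carrier G \<Longrightarrow> f \<in> V \<Longrightarrow> \<rho> g f \<in> V"
    using assms(2) by (auto simp: R invariant_space_def)
  define \<Psi> where "\<Psi> = the_inv_into V \<Phi>"
  have inj: "inj_on \<Phi> V" using \<Phi>(2) by (simp add: bij_betw_def)
  have \<Psi>\<Phi>: "\<Psi> (\<Phi> f) = f" if "f \<in> V" for f unfolding \<Psi>_def by (rule the_inv_into_f_f[OF inj that])
  have W: "W = \<Phi> ` V" using \<Phi>(2) by (simp add: bij_betw_def)
  have "clinear_on W \<Psi>"
    unfolding clinear_on_def
  proof (intro conjI ballI allI)
    fix w w' assume "w \<in> W" "w' \<in> W"
    then obtain f f' where f: "f \<in> V" "f' \<in> V" "w = \<Phi> f" "w' = \<Phi> f'" using W by blast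
    then have "w + w' = \<Phi> (f + f')" using \<Phi>(1) by (auto simp only: clinear_on_def)
    then show "\<Psi> (w + w') = \<Psi> w + \<Psi> w'"
      using f \<Psi>\<Phi> cfun.subspace_add[OF V(1) f(1,2)] by metis
  next
    fix c w assume "w \<in> W"
    then obtain f where f: "f \<in> V" "w = \<Phi> f" using W by blast
    then have "cscale c w = \<Phi> (cscale c f)" using \<Phi>(1) by (auto simp only: clinear_on_def)
    then show "\<Psi> (cscale c w) = cscale c (\<Psi> w)"
      using f \<Psi>\<Phi> cfun.subspace_scale[OF V(1) f(1)] by metis
  qed
  moreover have "bij_betw \<Psi> W V" unfolding \<Psi>_def by (rule bij_betw_the_inv_into[OF \<Phi>(2)])
  moreover have "\<Psi> (\<sigma> g w) = \<rho> g (\<Psi> w)" if "g \<in> carrier G" "w \<in> W" for g w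
    using that \<Phi>(3) V(2) \<Psi>\<Phi> unfolding W by (metis imageE)
  ultimately show ?thesis unfolding R equivalent_rep_def by auto
qed

lemma equivalence_classes_eq:
  "equivalence_classes G \<R> = {{S \<in> \<R>. equivalent_rep G R S} | R. R \<in> \<R>}"
  unfolding equivalence_classes_def quotient_def by (auto simp: Image_def)

text \<open>Equivalence makes sense between representations on different underlying sets, so \<open>\<phi>\<close> sends a class to
all members of \<open>\<B>\<close> that are equivalent to its members.\<close>

lemma equivalence_classes_correspond:
  fixes \<A> :: "('g, 'a) rep set" and \<B> :: "('g, 'b) rep set"
  assumes A: "\<And>R. R \<in> \<A> \<Longrightarrow> invariant_space G R" and B: "\<And>S. S \<in> \<B> \<Longrightarrow> invariant_space G S"
    and AB: "\<And>R. R \<in> \<A> \<Longrightarrow> \<exists>S\<in>\<B>. equivalent_rep G R S"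
    and BA: "\<And>S. S \<in> \<B> \<Longrightarrow> \<exists>R\<in>\<A>. equivalent_rep G R S"
  shows "\<exists>\<phi>. bij_betw \<phi> (equivalence_classes G \<A>) (equivalence_classes G \<B>) \<and>
    (\<forall>X\<in>equivalence_classes G \<A>. \<forall>R\<in>X. \<forall>S\<in>\<phi> X. equivalent_rep G R S)"
proof -
  define \<phi> where "\<phi> X = {S \<in> \<B>. \<exists>R\<in>X. equivalent_rep G R S}" for X :: "('g, 'a) rep set"
  have \<phi>: "\<phi> {R' \<in> \<A>. equivalent_rep G R R'} = {S' \<in> \<B>. equivalent_rep G S S'}"
    if "R \<in> \<A>" "S \<in> \<B>" "equivalent_rep G R S" for R S
  proof (rule subset_antisym; rule subsetI)
    fix S' assume "S' \<in> \<phi> {R' \<in> \<A>. equivalent_rep G R R'}"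
    then obtain R' where R': "S' \<in> \<B>" "R' \<in> \<A>" "equivalent_rep G R R'" "equivalent_rep G R' S'"
      by (auto simp: \<phi>_def)
    have "equivalent_rep G S R" by (rule equivalent_rep_sym[OF that(3) A[OF that(1)]])
    then have "equivalent_rep G S S'"
      using equivalent_rep_trans[OF R'(3,4)] by (rule equivalent_rep_trans)
    then show "S' \<in> {S' \<in> \<B>. equivalent_rep G S S'}" using R'(1) by blast
  next
    fix S' assume "S' \<in> {S' \<in> \<B>. equivalent_rep G S S'}"
    then have S': "S' \<in> \<B>" "equivalent_rep G S S'" by auto
    then have "equivalent_rep G R S'" using equivalent_rep_trans[OF that(3)] by blast
    then show "S' \<in> \<phi> {R' \<in> \<A>. equivalent_rep G R R'}"
      using S'(1) that(1) equivalent_rep_refl[of G R] unfolding \<phi>_def by blast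
  qed
  have "bij_betw \<phi> (equivalence_classes G \<A>) (equivalence_classes G \<B>)"
  proof (rule bij_betw_imageI)
    show "inj_on \<phi> (equivalence_classes G \<A>)"
    proof (rule inj_onI)
      fix X X' assume "X \<in> equivalence_classes G \<A>" "X' \<in> equivalence_classes G \<A>" and eq: "\<phi> X = \<phi> X'"
      then obtain R R' where R: "R \<in> \<A>" "X = {T \<in> \<A>. equivalent_rep G R T}"
        and R': "R' \<in> \<A>" "X' = {T \<in> \<A>. equivalent_rep G R' T}"
        unfolding equivalence_classes_eq by blast
      obtain S where S: "S \<in> \<B>" "equivalent_rep G R S" using AB[OF R(1)] by blast
      have "S \<in> \<phi> X'" unfolding eq[symmetric] R(2) \<phi>[OF R(1) S] using S(1) equivalent_rep_refl[of G S] by blast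
      then obtain R'' where R'': "R'' \<in> \<A>" "equivalent_rep G R' R''" "equivalent_rep G R'' S"
        unfolding R'(2) \<phi>_def by blast
      have R'S: "equivalent_rep G R' S" using equivalent_rep_trans[OF R''(2,3)] .
      have "equivalent_rep G R R'"
        using equivalent_rep_trans[OF S(2) equivalent_rep_sym[OF R'S A[OF R'(1)]]] .
      moreover have "equivalent_rep G R' R"
        using equivalent_rep_trans[OF R'S equivalent_rep_sym[OF S(2) A[OF R(1)]]] .
      ultimately show "X = X'" unfolding R(2) R'(2) using equivalent_rep_trans by blast
    qed
    show "\<phi> ` equivalence_classes G \<A> = equivalence_classes G \<B>"
    proof (rule subset_antisym; rule subsetI)
      fix Y assume "Y \<in> \<phi> ` equivalence_classes G \<A>"
      then obtain R where R: "R \<in> \<A>" "Y = \<phi> {T \<in> \<A>. equivalent_rep G R T}"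
        unfolding equivalence_classes_eq by blast
      obtain S where S: "S \<in> \<B>" "equivalent_rep G R S" using AB[OF R(1)] by blast
      then show "Y \<in> equivalence_classes G \<B>"
        unfolding R(2) \<phi>[OF R(1) S] equivalence_classes_eq by blast
    next
      fix Y assume "Y \<in> equivalence_classes G \<B>"
      then obtain S where S: "S \<in> \<B>" "Y = {T \<in> \<B>. equivalent_rep G S T}"
        unfolding equivalence_classes_eq by blast
      obtain R where R: "R \<in> \<A>" "equivalent_rep G R S" using BA[OF S(1)] by blast
      have "Y = \<phi> {T \<in> \<A>. equivalent_rep G R T}" unfolding S(2) \<phi>[OF R(1) S(1) R(2)] ..
      then show "Y \<in> \<phi> ` equivalence_classes G \<A>"
        using R(1) unfolding equivalence_classes_eq by blast
    qed
  qed
  moreover have "equivalent_rep G R S" if X: "X \<in> equivalence_classes G \<A>" and RX: "R \<in> X" and SX: "S \<in> \<phi> X" for X R S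
  proof -
    obtain R0 where R0: "R0 \<in> \<A>" "X = {T \<in> \<A>. equivalent_rep G R0 T}"
      using X unfolding equivalence_classes_eq by blast
    obtain R' where R': "R' \<in> X" "equivalent_rep G R' S" using SX by (auto simp: \<phi>_def)
    have "equivalent_rep G R R0" using RX equivalent_rep_sym[OF _ A[OF R0(1)]] unfolding R0(2) by blast
    then show ?thesis using R' R0 equivalent_rep_trans by blast
  qed
  ultimately show ?thesis by blast
qed

lemma exp_character_unitary:
  assumes "purely_imaginary \<Lambda>"
  shows "unitary_character (exp_character \<Lambda>)"
proof -
  have "continuous_on UNIV (exp_character \<Lambda>)"
    unfolding exp_character_def by (intro continuous_intros)
  moreover have "cmod (exp_character \<Lambda> x) = 1" for x
    using assms by (simp add: exp_character_def purely_imaginary_def norm_exp_eq_Re)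
  ultimately show ?thesis by (simp add: unitary_character_def exp_character_eq exp_fun_add)
qed

context reflection_generated_group
begin

lemma generic_reps_correspond:
  "\<exists>\<phi>. bij_betw \<phi> (equivalence_classes (motion_group K) (generic_induced_reps K))
             (equivalence_classes (motion_group K) (generic_eigenspace_reps K)) \<and>
           (\<forall>X\<in>equivalence_classes (motion_group K) (generic_induced_reps K).
              \<forall>R\<in>X. \<forall>S\<in>\<phi> X. equivalent_rep (motion_group K) R S)"
proof (rule equivalence_classes_correspond)
  fix R assume "R \<in> generic_induced_reps K"
  then obtain \<Lambda> where \<Lambda>: "purely_imaginary \<Lambda>" "generic K \<Lambda>" "R = induced_rep K (exp_character \<Lambda>)"
    by (auto simp: generic_induced_reps_def generic_character_def)
  show "invariant_space (motion_group K) R"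
    unfolding \<Lambda>(3) invariant_space_def using induced_rep_invariant by blast
  show "\<exists>S\<in>generic_eigenspace_reps K. equivalent_rep (motion_group K) R S"
    using \<Lambda> induced_equivalent_eigenspace[OF \<Lambda>(2)] unfolding generic_eigenspace_reps_def by blast
next
  fix S assume "S \<in> generic_eigenspace_reps K"
  then obtain \<Lambda> where \<Lambda>: "purely_imaginary \<Lambda>" "generic K \<Lambda>" "S = eigenspace_rep K \<Lambda>"
    by (auto simp: generic_eigenspace_reps_def)
  show "invariant_space (motion_group K) S"
    using generic_eigenspace_representation[OF \<Lambda>(2)]
    unfolding \<Lambda>(3) invariant_space_def representation_def by (auto simp: eigenspace_rep_eq)
  have "induced_rep K (exp_character \<Lambda>) \<in> generic_induced_reps K"
    unfolding generic_induced_reps_def generic_character_def using \<Lambda> exp_character_unitary by blast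
  then show "\<exists>R\<in>generic_induced_reps K. equivalent_rep (motion_group K) R S"
    unfolding \<Lambda>(3) using induced_equivalent_eigenspace[OF \<Lambda>(2)] by blast
qed

end

lemma reflection_generated_groupI:
  fixes K :: "(real^'n^'n) set"
  assumes "finite_pseudo_reflection_group K"
  shows "\<exists>S. reflection_generated_group K S"
proof -
  have fin: "finite K" and sub: "subgroup K orthogonal_group"
    using assms by (auto simp: finite_pseudo_reflection_group_def)
  obtain S where S: "S \<subseteq> K" "\<And>s. s \<in> S \<Longrightarrow> pseudo_reflection s" "generate orthogonal_group S = K"
    using assms by (auto simp: finite_pseudo_reflection_group_def)
  have orth: "orthogonal_matrix a" if "a \<in> K" for a
    using subgroup.subset[OF sub] that by (auto simp: orthogonal_group_def)
  have "reflection_generated_group K S"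
  proof
    show "mat 1 \<in> K" using subgroup.one_closed[OF sub] by (simp add: orthogonal_group_def)
    show "a ** b \<in> K" if "a \<in> K" "b \<in> K" for a b
      using subgroup.m_closed[OF sub that] by (simp add: orthogonal_group_def)
    show "transpose a \<in> K" if "a \<in> K" for a
      using subgroup.m_inv_closed[OF sub that] orthogonal_group_inv[OF orth[OF that]] by simp
    show "\<exists>v a. \<forall>x. s *v x = x + (a \<bullet> x) *s v" if "s \<in> S" for s
      using that S orth by (intro orthogonal_pseudo_reflection_rank_one) auto
  qed (use fin orth S in auto)
  then show ?thesis ..
qed

theorem theorem4p18:
  fixes K :: "(real^'n^'n) set"
  assumes "finite_pseudo_reflection_group K"
  shows "(\<forall>\<Lambda>. (\<exists>B. finite B \<and> cfun.span B = joint_eigenspace K \<Lambda>) \<and>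
              cfun.dim (joint_eigenspace K \<Lambda>) \<le> card K)
    \<and> (\<forall>\<Lambda>. generic K \<Lambda> \<longrightarrow> irreducible_rep (motion_group K) (eigenspace_rep K \<Lambda>))
    \<and> (\<exists>\<phi>. bij_betw \<phi>
             (equivalence_classes (motion_group K) (generic_induced_reps K))
             (equivalence_classes (motion_group K) (generic_eigenspace_reps K)) \<and>
           (\<forall>X\<in>equivalence_classes (motion_group K) (generic_induced_reps K).
              \<forall>R\<in>X. \<forall>S\<in>\<phi> X. equivalent_rep (motion_group K) R S))"
proof -
  obtain S where "reflection_generated_group K S"
    using reflection_generated_groupI[OF assms] by blast
  then interpret reflection_generated_group K S .
  have "\<exists>B. finite B \<and> cfun.span B = joint_eigenspace K \<Lambda>"
    and "cfun.dim (joint_eigenspace K \<Lambda>) \<le> card K" for \<Lambda>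
  proof -
    obtain B where B: "finite B" "card B \<le> card K" "cfun.span B = joint_eigenspace K \<Lambda>"
      using joint_eigenspace_dimension by blast
    then show "\<exists>B. finite B \<and> cfun.span B = joint_eigenspace K \<Lambda>" by blast
    have "cfun.dim (joint_eigenspace K \<Lambda>) \<le> card B" using B by (intro cfun.dim_le_card) auto
    then show "cfun.dim (joint_eigenspace K \<Lambda>) \<le> card K" using B(2) by simp
  qed
  then show ?thesis
    using generic_eigenspace_irreducible generic_reps_correspond by blast
qed

end
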